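(* If a coarsely connected coarse median space $X$ admits a quasimedian quasiisometric embedding $\Phi$ in a finite-dimensional CAT(0) cube complex $C$, then $X$ is quasiisometric to a finite-dimensional CAT(0) cube complex.
   Context: A graph is median if for any three vertices $x_1,x_2,x_3$ there is a unique vertex $m$ (their median) with $\mathsf d(x_i,x_j)=\mathsf d(x_i,m)+\mathsf d(m,x_j)$ whenever $i\ne j$. A discrete median algebra is the 0-skeleton of a median graph with the median operation; median graphs are exactly the 1-skeleta of CAT(0) cube complexes. A metric space $(X,\mathsf d)$ is a coarse median space if it has a map $m:X^3\to X$ for which there is a function $h:\mathbf N\to[0,\infty)$ such that: (i) $\mathsf d(m(x,y,z),m(x',y',z'))\le h(1)(\mathsf d(x,x')+\mathsf d(y,y')+\mathsf d(z,z')+1)$ for all $x,y,z,x',y',z'\in X$; (ii) for all $n\in\mathbf N$, if $A\subset X$ has cardinality at most $n$ then there are a finite discrete median algebra $V$ and maps $f:A\to V$, $g:V\to X$ such that $\mathsf d(g(m_V(x,y,z)),m(g(x),g(y),g(z)))\le h(n)$ for all $x,y,z\in V$ and $\mathsf d(a,gf(a))\le h(n)$ for all $a\in A$. CAT(0) cube complexes of finite dimension are coarse median spaces via the median on their 0-skeleton (with the 1-skeleton metric, which is quasiisometric to the CAT(0) metric in finite dimension). A map $\psi:Y\to X$ between coarse median spaces is $D$-quasimedian if $\mathsf d_X(\psi m_Y(x,y,z),m_X(\psi(x),\psi(y),\psi(z)))\le D$ for all $x,y,z\in Y$, and quasimedian if it is $D$-quasimedian for some $D$. A space is coarsely connected if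 there is $C>0$ such that any two points $x,x'$ are joined by a finite sequence $x=x_0,\dots,x_n=x'$ with $\mathsf d(x_i,x_{i+1})\le C$ for all $i$. *)

theory Defs
  imports "HOL-Analysis.Abstract_Metric_Spaces"
begin

section \<open>Median graphs\<close>

text \<open>
  A simple graph is given by its vertex set and its symmetric, irreflexive adjacency relation.
  The graph distance is only meaningful between vertices of the same component.
\<close>

definition simple_graph :: "'a set \<Rightarrow> 'a rel \<Rightarrow> bool" where
  "simple_graph V E \<longleftrightarrow> E \<subseteq> V \<times> V \<and> sym E \<and> irrefl E"

definition connected_graph :: "'a set \<Rightarrow> 'a rel \<Rightarrow> bool" where
  "connected_graph V E \<longleftrightarrow> V \<times> V \<subseteq> E\<^sup>*"

definition graph_dist :: "'a rel \<Rightarrow> 'a \<Rightarrow> 'a \<Rightarrow> nat" where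
  "graph_dist E x y = (LEAST n. (x, y) \<in> E ^^ n)"

definition is_median :: "'a set \<Rightarrow> 'a rel \<Rightarrow> 'a \<Rightarrow> 'a \<Rightarrow> 'a \<Rightarrow> 'a \<Rightarrow> bool" where
  "is_median V E x y z m \<longleftrightarrow>
     m \<in> V \<and>
     graph_dist E x y = graph_dist E x m + graph_dist E m y \<and>
     graph_dist E y z = graph_dist E y m + graph_dist E m z \<and>
     graph_dist E x z = graph_dist E x m + graph_dist E m z"

definition median_graph :: "'a set \<Rightarrow> 'a rel \<Rightarrow> bool" where
  "median_graph V E \<longleftrightarrow>
     simple_graph V E \<and> connected_graph V E \<and>
     (\<forall>x\<in>V. \<forall>y\<in>V. \<forall>z\<in>V. \<exists>!m. is_median V E x y z m)"

definition graph_median :: "'a set \<Rightarrow> 'a rel \<Rightarrow> 'a \<Rightarrow> 'a \<Rightarrow> 'a \<Rightarrow> 'a" where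
  "graph_median V E x y z = (THE m. is_median V E x y z m)"


section \<open>Coarse geometry\<close>

text \<open>
  A discrete median algebra is the vertex set of a median graph with its median operation.
  In the definition of a coarse median space only finite ones occur, so their vertices may
  be taken to be natural numbers.
\<close>

definition coarse_median_space ::
    "'x set \<Rightarrow> ('x \<Rightarrow> 'x \<Rightarrow> real) \<Rightarrow> ('x \<Rightarrow> 'x \<Rightarrow> 'x \<Rightarrow> 'x) \<Rightarrow> bool" where
  "coarse_median_space X d m \<longleftrightarrow>
     Metric_space X d \<and>
     (\<forall>x\<in>X. \<forall>y\<in>X. \<forall>z\<in>X. m x y z \<in> X) \<and>
     (\<exists>h :: nat \<Rightarrow> real.
        (\<forall>n. 0 \<le> h n) \<and>
        (\<forall>x\<in>X. \<forall>y\<in>X. \<forall>z\<in>X. \<forall>x'\<in>X. \<forall>y'\<in>X. \<forall>z'\<in>X.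
           d (m x y z) (m x' y' z') \<le> h 1 * (d x x' + d y y' + d z z' + 1)) \<and>
        (\<forall>n A. A \<subseteq> X \<and> finite A \<and> card A \<le> n \<longrightarrow>
           (\<exists>(V :: nat set) E f g.
              finite V \<and> median_graph V E \<and> f \<in> A \<rightarrow> V \<and> g \<in> V \<rightarrow> X \<and>
              (\<forall>x\<in>V. \<forall>y\<in>V. \<forall>z\<in>V.
                 d (g (graph_median V E x y z)) (m (g x) (g y) (g z)) \<le> h n) \<and>
              (\<forall>a\<in>A. d a (g (f a)) \<le> h n))))"

definition quasimedian ::
    "'y set \<Rightarrow> ('y \<Rightarrow> 'y \<Rightarrow> 'y \<Rightarrow> 'y) \<Rightarrow> ('x \<Rightarrow> 'x \<Rightarrow> real) \<Rightarrow> ('x \<Rightarrow> 'x \<Rightarrow> 'x \<Rightarrow> 'x) \<Rightarrow>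
     ('y \<Rightarrow> 'x) \<Rightarrow> bool" where
  "quasimedian Y mY dX mX \<psi> \<longleftrightarrow>
     (\<exists>D. \<forall>x\<in>Y. \<forall>y\<in>Y. \<forall>z\<in>Y. dX (\<psi> (mY x y z)) (mX (\<psi> x) (\<psi> y) (\<psi> z)) \<le> D)"

definition coarsely_connected :: "'x set \<Rightarrow> ('x \<Rightarrow> 'x \<Rightarrow> real) \<Rightarrow> bool" where
  "coarsely_connected X d \<longleftrightarrow>
     (\<exists>C>0. \<forall>x\<in>X. \<forall>x'\<in>X. \<exists>(n::nat) s.
        s 0 = x \<and> s n = x' \<and> (\<forall>i\<le>n. s i \<in> X) \<and> (\<forall>i<n. d (s i) (s (Suc i)) \<le> C))"

definition quasiisometric_embedding ::
    "'x set \<Rightarrow> ('x \<Rightarrow> 'x \<Rightarrow> real) \<Rightarrow> 'y set \<Rightarrow> ('y \<Rightarrow> 'y \<Rightarrow> real) \<Rightarrow> ('x \<Rightarrow> 'y) \<Rightarrow> bool" where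
  "quasiisometric_embedding X dX Y dY f \<longleftrightarrow>
     f \<in> X \<rightarrow> Y \<and>
     (\<exists>k\<ge>1. \<exists>c\<ge>0. \<forall>x\<in>X. \<forall>x'\<in>X.
        dX x x' / k - c \<le> dY (f x) (f x') \<and> dY (f x) (f x') \<le> k * dX x x' + c)"

definition quasiisometry ::
    "'x set \<Rightarrow> ('x \<Rightarrow> 'x \<Rightarrow> real) \<Rightarrow> 'y set \<Rightarrow> ('y \<Rightarrow> 'y \<Rightarrow> real) \<Rightarrow> ('x \<Rightarrow> 'y) \<Rightarrow> bool" where
  "quasiisometry X dX Y dY f \<longleftrightarrow>
     quasiisometric_embedding X dX Y dY f \<and> (\<exists>r. \<forall>y\<in>Y. \<exists>x\<in>X. dY (f x) y \<le> r)"

definition quasiisometric ::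
    "'x set \<Rightarrow> ('x \<Rightarrow> 'x \<Rightarrow> real) \<Rightarrow> 'y set \<Rightarrow> ('y \<Rightarrow> 'y \<Rightarrow> real) \<Rightarrow> bool" where
  "quasiisometric X dX Y dY \<longleftrightarrow> (\<exists>f. quasiisometry X dX Y dY f)"


section \<open>CAT(0) cube complexes\<close>

text \<open>
  A cube complex is encoded by the vertex sets of its cubes.  The vertices of the standard
  \<open>n\<close>-cube are the subsets of \<open>{..<n}\<close>, and its (nonempty) faces are the intervals
  \<open>{S. A \<subseteq> S \<and> S \<subseteq> B}\<close> with \<open>A \<subseteq> B \<subseteq> {..<n}\<close>.  The conditions below say that every cube is
  embedded with exactly the faces of a standard cube, and that two cubes that meet do so in
  a single common face; these are the cubical complexes of Bridson and Haefliger.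
  Every CAT(0) cube complex is of this kind.
\<close>

definition is_cube :: "'a set set \<Rightarrow> nat \<Rightarrow> 'a set \<Rightarrow> bool" where
  "is_cube K n Q \<longleftrightarrow>
     (\<exists>\<phi>. bij_betw \<phi> (Pow {..<n}) Q \<and>
          {R \<in> K. R \<subseteq> Q} = {\<phi> ` {S. A \<subseteq> S \<and> S \<subseteq> B} | A B. A \<subseteq> B \<and> B \<subseteq> {..<n}})"

definition cube_complex :: "'a set set \<Rightarrow> bool" where
  "cube_complex K \<longleftrightarrow>
     (\<forall>Q\<in>K. \<exists>n. is_cube K n Q) \<and>
     (\<forall>Q\<in>K. \<forall>R\<in>K. Q \<inter> R \<noteq> {} \<longrightarrow> Q \<inter> R \<in> K)"

definition finite_dimensional :: "'a set set \<Rightarrow> bool" where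
  "finite_dimensional K \<longleftrightarrow> (\<exists>N. \<forall>Q\<in>K. \<forall>n. is_cube K n Q \<longrightarrow> n \<le> N)"

abbreviation vertices :: "'a set set \<Rightarrow> 'a set" where
  "vertices K \<equiv> \<Union>K"

definition adjacent :: "'a set set \<Rightarrow> 'a rel" where
  "adjacent K = {(u, v). u \<noteq> v \<and> {u, v} \<in> K}"

text \<open>
  As a metric space, and as a coarse median space, a CAT(0) cube complex is represented by its
  0-skeleton with the path metric and the median of the 1-skeleton.  In finite dimension this
  metric is quasiisometric to the CAT(0) metric.
\<close>

definition skeleton_dist :: "'a set set \<Rightarrow> 'a \<Rightarrow> 'a \<Rightarrow> real" where
  "skeleton_dist K u v = real (graph_dist (adjacent K) u v)"

definition skeleton_median :: "'a set set \<Rightarrow> 'a \<Rightarrow> 'a \<Rightarrow> 'a \<Rightarrow> 'a" where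
  "skeleton_median K = graph_median (vertices K) (adjacent K)"

text \<open>
  Simple connectedness is expressed through the edge-path group: up to insertion and deletion
  of backtracks, and pushing across squares, every closed edge path is constant.
\<close>

definition edge_path :: "'a set set \<Rightarrow> 'a list \<Rightarrow> bool" where
  "edge_path K p \<longleftrightarrow>
     p \<noteq> [] \<and> set p \<subseteq> vertices K \<and> successively (\<lambda>u v. (u, v) \<in> adjacent K) p"

inductive elementary_homotopy :: "'a set set \<Rightarrow> 'a list \<Rightarrow> 'a list \<Rightarrow> bool" for K where
  backtrack: "(v, w) \<in> adjacent K \<Longrightarrow> elementary_homotopy K (p @ [v, w, v] @ q) (p @ [v] @ q)"
| square: "\<lbrakk>{a, b, c, d} \<in> K; distinct [a, b, c, d];
            (a, b) \<in> adjacent K; (b, c) \<in> adjacent K;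
            (a, d) \<in> adjacent K; (d, c) \<in> adjacent K\<rbrakk>
    \<Longrightarrow> elementary_homotopy K (p @ [a, b, c] @ q) (p @ [a, d, c] @ q)"

definition simply_connected_complex :: "'a set set \<Rightarrow> bool" where
  "simply_connected_complex K \<longleftrightarrow>
     connected_graph (vertices K) (adjacent K) \<and>
     (\<forall>p. edge_path K p \<and> hd p = last p \<longrightarrow> equivclp (elementary_homotopy K) p [hd p])"

text \<open>
  The vertices of the link of \<open>v\<close> are the edges at \<open>v\<close>, represented by their other endpoints.
  The cubes containing \<open>v\<close> correspond to the simplices of the link (with \<open>{v}\<close> giving the empty
  simplex).
\<close>

definition link :: "'a set set \<Rightarrow> 'a \<Rightarrow> 'a set set" where
  "link K v = {{w \<in> Q. (v, w) \<in> adjacent K} | Q. Q \<in> K \<and> v \<in> Q}"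

text \<open>Taking \<open>x = y\<close> below forces the elements of \<open>T\<close> to be vertices of the complex.\<close>

definition flag_complex :: "'a set set \<Rightarrow> bool" where
  "flag_complex L \<longleftrightarrow> (\<forall>T. finite T \<and> T \<noteq> {} \<and> (\<forall>x\<in>T. \<forall>y\<in>T. {x, y} \<in> L) \<longrightarrow> T \<in> L)"

text \<open>
  The combinatorial definition of Gromov: simply connected with flag vertex links.
\<close>

definition CAT0_cube_complex :: "'a set set \<Rightarrow> bool" where
  "CAT0_cube_complex K \<longleftrightarrow>
     cube_complex K \<and> simply_connected_complex K \<and> (\<forall>v\<in>vertices K. flag_complex (link K v))"

end

theory Submission
  imports Defs
begin

text \<open>
  Call a set of vertices a halfspace if it consists of the vertices that are closer to one end of some
  edge than to the other.  Let \<open>M\<close> consist of the vertices \<open>x\<close> such that any two halfspaces containing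
  \<open>x\<close> have a point of \<open>\<Phi> ` X\<close> in common.  It is a median subalgebra, and by a Helly-type argument
  every point of \<open>M\<close> is obtained from \<open>\<Phi> ` X\<close> by a number of median operations that is bounded in terms
  of the dimension.  As \<open>\<Phi>\<close> is quasimedian, \<open>M\<close> lies in a bounded neighbourhood of \<open>\<Phi> ` X\<close>.  The traces of
  the halfspaces on \<open>M\<close> turn \<open>M\<close> into the 0-skeleton of a CAT(0) cube complex of no larger dimension,
  and \<open>M\<close> is coarsely connected, so points adjacent in that complex are at bounded distance in \<open>C\<close>.
  Hence \<open>\<Phi>\<close> is a quasiisometry to it.

  The 1-skeleton of \<open>C\<close> is a median graph for the following reason.  An edge path is reduced
  if moves across squares never produce a backtrack in it.  Edges act on the classes of reduced paths
  modulo moves across squares, homotopic paths act equally, and so in a simply connected complex any two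
  reduced paths with the same ends differ by moves across squares.  In particular the reduced paths are
  the geodesics, which gives the quadrangle condition.
\<close>

section \<open>Graphs with the quadrangle condition\<close>


text \<open>The complex \<open>C\<close> need not be locally finite, so a Helly argument cannot
  treat all the halfspaces bounded by edges at a point \<open>x\<close> of \<open>M\<close>
  together. What the dimension bounds is the number of neighbours of \<open>x\<close> on geodesics
  to one given vertex, since these span a cube with \<open>x\<close>. Therefore \<open>x\<close> is
  written as the median of three points, two of which are found by the Helly argument for at most
  \<open>N\<close> and at most \<open>2 * N\<close> halfspaces; this explains the depth
  \<open>2 * N + 1\<close>, uniform in \<open>x\<close>.

  Many halfspaces of \<open>C\<close> may have the same trace on \<open>M\<close> and become a
  single edge of the new complex. Coarse connectedness bounds the length of such an edge in
  \<open>C\<close>; without it there could be arbitrarily long gaps.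

  For the square moves, the obstacle is that equivalent paths may be related by a long chain of
  moves. Comparing first steps along such a chain requires completing three squares around a vertex
  to a cube, and this is where flag links enter. The pattern is that of the cube condition for
  cancellation in Garside-type monoids.\<close>

lemma relpow_symD: "(x, y) \<in> E ^^ n \<Longrightarrow> sym E \<Longrightarrow> (y, x) \<in> E ^^ n"
proof (induction n arbitrary: y)
  case (Suc n)
  then obtain z where "(x, z) \<in> E ^^ n" "(z, y) \<in> E" by auto
  then have "(z, x) \<in> E ^^ n" "(y, z) \<in> E" using Suc by (auto dest: symD)
  then show ?case by (meson relpow_Suc_I2)
qed auto

lemma graph_dist_le: "(x, y) \<in> E ^^ n \<Longrightarrow> graph_dist E x y \<le> n"
  unfolding graph_dist_def by (rule Least_le)

locale connected_simple_graph =
  fixes V :: "'a set" and E :: "'a rel"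
  assumes simple: "simple_graph V E" and connected: "connected_graph V E"
begin

abbreviation dist :: "'a \<Rightarrow> 'a \<Rightarrow> nat" where "dist \<equiv> graph_dist E"

abbreviation between :: "'a \<Rightarrow> 'a \<Rightarrow> 'a \<Rightarrow> bool" where
  "between x m y \<equiv> dist x y = dist x m + dist m y"

lemma edge_in: "(u, v) \<in> E \<Longrightarrow> u \<in> V" "(u, v) \<in> E \<Longrightarrow> v \<in> V"
  using simple by (auto simp: simple_graph_def)

lemma edge_sym: "(u, v) \<in> E \<Longrightarrow> (v, u) \<in> E"
  using simple by (auto simp: simple_graph_def dest: symD)

lemma edge_neq: "(u, v) \<in> E \<Longrightarrow> u \<noteq> v"
  using simple by (auto simp: simple_graph_def irrefl_def)

lemma dist_relpow: "x \<in> V \<Longrightarrow> y \<in> V \<Longrightarrow> (x, y) \<in> E ^^ dist x y"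
  using connected unfolding connected_graph_def graph_dist_def
  by (metis LeastI_ex mem_Sigma_iff rtrancl_imp_relpow subsetD)

lemma dist_refl [simp]: "dist x x = 0"
  using graph_dist_le[of x x 0 E] by simp

lemma dist_commute: "dist x y = dist y x"
proof -
  have "(x, y) \<in> E ^^ n \<longleftrightarrow> (y, x) \<in> E ^^ n" for n
    using simple relpow_symD[of _ _ n E] unfolding simple_graph_def by blast
  then show ?thesis by (simp add: graph_dist_def)
qed

lemma dist_triangle:
  assumes "x \<in> V" "y \<in> V" "z \<in> V" shows "dist x z \<le> dist x y + dist y z"
proof (rule graph_dist_le)
  show "(x, z) \<in> E ^^ (dist x y + dist y z)"
    unfolding relpow_add using dist_relpow[OF assms(1,2)] dist_relpow[OF assms(2,3)] by (rule relcompI)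
qed

lemma dist_eq_0: "x \<in> V \<Longrightarrow> y \<in> V \<Longrightarrow> dist x y = 0 \<longleftrightarrow> x = y"
  using dist_relpow[of x y] by auto

lemma dist_edge: "(x, y) \<in> E \<Longrightarrow> dist x y = 1"
  using graph_dist_le[of x y 1 E] dist_eq_0[of x y] edge_in[of x y] edge_neq[of x y] by fastforce

lemma step_towards:
  assumes "x \<in> V" "y \<in> V" "x \<noteq> y"
  obtains u where "(x, u) \<in> E" "dist x y = Suc (dist u y)"
proof -
  obtain k where k: "dist x y = Suc k" using assms dist_eq_0[of x y] by (cases "dist x y") auto
  then obtain u where u: "(x, u) \<in> E" "(u, y) \<in> E ^^ k"
    using relpow_Suc_D2[of x y k E] dist_relpow[OF assms(1,2)] by auto
  have "dist x y \<le> 1 + dist u y"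
    using dist_triangle[OF assms(1) edge_in(2)[OF u(1)] assms(2)] dist_edge[OF u(1)] by simp
  then show thesis using that u k graph_dist_le[OF u(2)] by force
qed

lemma between_edge: "(x, u) \<in> E \<Longrightarrow> between x u y \<longleftrightarrow> dist x y = Suc (dist u y)"
  using dist_edge by simp

lemma between_trans:
  assumes "between x m y" "between x u m" "x \<in> V" "y \<in> V" "m \<in> V" "u \<in> V"
  shows "between x u y" "between u m y"
  using assms dist_triangle[of x u y] dist_triangle[of u m y] by auto

end

text \<open>Among connected graphs these conditions characterise median graphs: the first two make
  the graph modular, so that medians exist, and the exclusion of K(2,3) makes them unique.\<close>

locale quadrangle_graph = connected_simple_graph +
  assumes bipartite: "(u, v) \<in> E \<Longrightarrow> z \<in> V \<Longrightarrow> dist z u \<noteq> dist z v"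
    and quadrangle: "z \<in> V \<Longrightarrow> (v, u) \<in> E \<Longrightarrow> (v, u') \<in> E \<Longrightarrow> u \<noteq> u' \<Longrightarrow>
      dist z v = Suc (dist z u) \<Longrightarrow> dist z v = Suc (dist z u') \<Longrightarrow>
      \<exists>w. (u, w) \<in> E \<and> (u', w) \<in> E \<and> dist z u = Suc (dist z w)"
    and no_K23: "(u, x) \<in> E \<Longrightarrow> (u, y) \<in> E \<Longrightarrow> (u, w) \<in> E \<Longrightarrow> (u', x) \<in> E \<Longrightarrow> (u', y) \<in> E \<Longrightarrow>
      (u', w) \<in> E \<Longrightarrow> x \<noteq> y \<Longrightarrow> y \<noteq> w \<Longrightarrow> x \<noteq> w \<Longrightarrow> u = u'"
begin

lemma edge_cases:
  assumes "(u, v) \<in> E" "z \<in> V"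
  shows "dist z v = Suc (dist z u) \<or> dist z u = Suc (dist z v)"
  using assms bipartite[of u v z] dist_triangle[of z u v] dist_triangle[of z v u]
    dist_edge[of u v] dist_edge[of v u] edge_sym[of u v] edge_in[of u v] by force

text \<open>Let \<open>v\<close> be a step from \<open>m\<close> towards \<open>y\<close>. If it
  leads away from \<open>z\<close>, then \<open>v\<close> is again not between \<open>y\<close> and
  \<open>z\<close>, and induction gives a step \<open>u\<close> from \<open>v\<close> towards both.
  The quadrangle condition at \<open>v\<close> for the neighbours \<open>m\<close> and
  \<open>u\<close> and the target \<open>z\<close> yields \<open>w\<close>; as \<open>u\<close> is
  two steps closer to \<open>y\<close> than \<open>m\<close>, its neighbour \<open>w\<close> is one
  step closer.\<close>

lemma common_step:
  assumes "m \<in> V" "y \<in> V" "z \<in> V" "\<not> between y m z"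
  shows "\<exists>u. (m, u) \<in> E \<and> dist m y = Suc (dist u y) \<and> dist m z = Suc (dist u z)"
  using assms
proof (induction "dist m y" arbitrary: m)
  case 0
  then show ?case using dist_eq_0 by simp
next
  case (Suc k)
  note inV = Suc.prems(1-3)
  from Suc have "m \<noteq> y" by auto
  then obtain v where v: "(m, v) \<in> E" "dist m y = Suc (dist v y)"
    using step_towards[OF inV(1,2)] by blast
  have vV: "v \<in> V" using v edge_in by blast
  show ?case
  proof (cases "dist m z = Suc (dist v z)")
    case True then show ?thesis using v by blast
  next
    case False
    then have vz: "dist v z = Suc (dist m z)"
      using edge_cases[OF v(1) inV(3)] by (simp add: dist_commute[of z])
    have "\<not> between y v z" using vz Suc.prems(4) v dist_commute[of y v] dist_commute[of y m] by simp
    then obtain u where u: "(v, u) \<in> E" "dist v y = Suc (dist u y)" "dist v z = Suc (dist u z)"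
      using Suc.hyps(1)[of v] Suc.hyps(2) v vV inV by auto
    have "u \<noteq> m" using u v by auto
    then obtain w where w: "(u, w) \<in> E" "(m, w) \<in> E" "dist z u = Suc (dist z w)"
      using quadrangle[OF inV(3) u(1) edge_sym[OF v(1)]] u(3) vz by (auto simp: dist_commute[of z])
    have "dist w y \<le> 1 + dist u y"
      using dist_triangle[of w u y] edge_in[OF w(1)] dist_edge[OF edge_sym[OF w(1)]] inV(2) by simp
    moreover have "dist m y \<le> 1 + dist w y"
      using dist_triangle[of m w y] edge_in[OF w(2)] dist_edge[OF w(2)] inV(2) by simp
    ultimately have "dist m y = Suc (dist w y)" using v u by simp
    moreover have "dist m z = Suc (dist w z)" using w(3) u(3) vz by (simp add: dist_commute[of z])
    ultimately show ?thesis using w by blast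
  qed
qed

text \<open>Move from \<open>x\<close> as far towards \<open>y\<close> as possible while staying on
  geodesics to both \<open>y\<close> and \<open>z\<close>; a failure of the third equation would
  allow a further common step.\<close>

lemma median_exists:
  assumes "x \<in> V" "y \<in> V" "z \<in> V"
  shows "\<exists>m. is_median V E x y z m"
proof -
  let ?P = "\<lambda>m. m \<in> V \<and> between x m y \<and> between x m z"
  have "?P x" using assms by auto
  then obtain m where m: "?P m" "\<And>m'. ?P m' \<Longrightarrow> dist m y \<le> dist m' y"
    using arg_min_natI[of ?P x "\<lambda>m. dist m y"] arg_min_nat_le[of ?P _ "\<lambda>m. dist m y"] by blast
  have "between y m z"
  proof (rule ccontr)
    assume "\<not> between y m z"
    then obtain u where u: "(m, u) \<in> E" "dist m y = Suc (dist u y)" "dist m z = Suc (dist u z)"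
      using common_step m(1) assms by blast
    have uV: "u \<in> V" using u edge_in by blast
    have "dist x u \<le> dist x m + 1" using dist_triangle[of x m u] assms m uV dist_edge[OF u(1)] by simp
    then have "?P u" using dist_triangle[of x u y] dist_triangle[of x u z] m(1) u uV assms by auto
    then show False using m(2)[of u] u by simp
  qed
  then show ?thesis using m(1) unfolding is_median_def by blast
qed

section \<open>Halfspaces, their boundary edges and their convexity\<close>

definition halfspace :: "'a \<Rightarrow> 'a \<Rightarrow> 'a set" where
  "halfspace u v = {z \<in> V. dist z u < dist z v}"

definition halfspaces :: "'a set set" where
  "halfspaces = {halfspace u v | u v. (u, v) \<in> E}"

lemma halfspaceI: "(u, v) \<in> E \<Longrightarrow> halfspace u v \<in> halfspaces"
  unfolding halfspaces_def by blast

lemma halfspace_sub: "H \<in> halfspaces \<Longrightarrow> H \<subseteq> V"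
  unfolding halfspaces_def halfspace_def by blast

lemma halfspace_compl: "(u, v) \<in> E \<Longrightarrow> V - halfspace u v = halfspace v u"
  unfolding halfspace_def using edge_cases by force

lemma compl_halfspaces: "H \<in> halfspaces \<Longrightarrow> V - H \<in> halfspaces"
  unfolding halfspaces_def using halfspace_compl edge_sym by blast

lemma halfspace_ends: "(u, v) \<in> E \<Longrightarrow> u \<in> halfspace u v" "(u, v) \<in> E \<Longrightarrow> v \<notin> halfspace u v"
  unfolding halfspace_def using edge_in dist_edge by auto

text \<open>A vertex on the side of \<open>a\<close> that is also on the side of \<open>e\<close>
  would be equally far from \<open>a\<close> and \<open>e\<close>. The quadrangle condition at
  \<open>b\<close> then gives these a third common neighbour besides \<open>b\<close> and
  \<open>c\<close>, which is a K(2,3).\<close>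

lemma halfspace_square_sub:
  assumes "(a, b) \<in> E" "(c, e) \<in> E" "(a, c) \<in> E" "(b, e) \<in> E" "a \<noteq> e" "b \<noteq> c"
  shows "halfspace a b \<subseteq> halfspace c e"
proof
  fix x assume x: "x \<in> halfspace a b"
  then have xV: "x \<in> V" and ab: "dist x b = Suc (dist x a)"
    using edge_cases[OF assms(1), of x] by (auto simp: halfspace_def)
  show "x \<in> halfspace c e"
  proof (rule ccontr)
    assume "x \<notin> halfspace c e"
    then have ce: "dist x c = Suc (dist x e)"
      using edge_cases[OF assms(2) xV] xV by (auto simp: halfspace_def)
    have ea: "dist x e = dist x a"
      using ab ce edge_cases[OF assms(3) xV] edge_cases[OF assms(4) xV] by arith
    then obtain w where w: "(a, w) \<in> E" "(e, w) \<in> E" "dist x a = Suc (dist x w)"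
      using quadrangle[OF xV edge_sym[OF assms(1)] assms(4,5) ab] ab by auto
    then have "a = e"
      using no_K23[OF assms(1,3) w(1) edge_sym[OF assms(4)] edge_sym[OF assms(2)] w(2)] assms(6) ab ce ea by force
    then show False using assms by simp
  qed
qed

lemma halfspace_square:
  assumes "(a, b) \<in> E" "(c, e) \<in> E" "(a, c) \<in> E" "(b, e) \<in> E" "a \<noteq> e" "b \<noteq> c"
  shows "halfspace a b = halfspace c e"
  using halfspace_square_sub[OF assms] halfspace_square_sub[of c e a b] assms edge_sym by blast

text \<open>The boundary edges of a halfspace are joined to each other by ladders of squares.\<close>

lemma halfspace_boundary:
  assumes "(a, b) \<in> E" "(z, z') \<in> E" "z \<in> halfspace a b" "z' \<notin> halfspace a b"
  shows "halfspace a b = halfspace z z'"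
  using assms(2-)
proof (induction "dist z a" arbitrary: z z')
  case (0 z z')
  note abV = edge_in[OF assms(1)]
  have zV: "z \<in> V" "z' \<in> V" using 0 edge_in by auto
  have za: "z = a" using 0 dist_eq_0 zV abV by auto
  have "dist z' b < dist z' a"
    using 0 zV edge_cases[OF assms(1), of z'] by (auto simp: halfspace_def)
  moreover have "dist z' a = 1" using za 0 dist_edge edge_sym by blast
  ultimately have "z' = b" using dist_eq_0 zV abV by simp
  then show ?case using za by simp
next
  case (Suc k z z')
  note abV = edge_in[OF assms(1)]
  have zV: "z \<in> V" "z' \<in> V" using Suc edge_in by auto
  have zb: "dist z b = Suc (dist z a)" using Suc.prems zV edge_cases[OF assms(1), of z]
    by (auto simp: halfspace_def)
  have z'a: "dist z' a = Suc (dist z' b)" using Suc.prems zV edge_cases[OF assms(1), of z']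
    by (auto simp: halfspace_def)
  have z'b: "dist z b = Suc (dist z' b)"
    using zb z'a edge_cases[OF Suc.prems(1), of a] edge_cases[OF Suc.prems(1), of b]
      abV by (simp add: dist_commute[of a] dist_commute[of b]) arith
  have "z \<noteq> a" using Suc.hyps(2) by auto
  \<comment> \<open>The rung \<open>z z'\<close> is replaced by one closer to the edge
    \<open>a b\<close>: \<open>y\<close> is a step towards \<open>a\<close>, and the quadrangle
    condition with respect to \<open>b\<close> closes the corner at \<open>z\<close> to a square
    with fourth vertex \<open>y'\<close>.\<close>
  then obtain y where y: "(z, y) \<in> E" "dist z a = Suc (dist y a)"
    using step_towards[OF zV(1) abV(1)] by blast
  have yV: "y \<in> V" using y edge_in by blast
  have yb: "dist z b = Suc (dist y b)"
    using zb y edge_cases[OF y(1) abV(2)] edge_cases[OF assms(1) yV]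
    by (simp add: dist_commute[of b]) arith
  have "y \<noteq> z'" using y z'a z'b zb by auto
  then obtain y' where y': "(y, y') \<in> E" "(z', y') \<in> E" "dist b y = Suc (dist b y')"
    using quadrangle[OF abV(2) y(1) Suc.prems(1)] yb z'b by (auto simp: dist_commute[of b])
  have y'V: "y' \<in> V" using y' edge_in by blast
  have "y \<in> halfspace a b" using y yb zb yV unfolding halfspace_def by auto
  moreover have "y' \<notin> halfspace a b"
    using y'(3) y yb zb z'a z'b edge_cases[OF y'(1) abV(1)] edge_cases[OF y'(2) abV(1)] unfolding halfspace_def
    by (simp add: dist_commute[of a] dist_commute[of b]) arith
  ultimately have "halfspace a b = halfspace y y'" using Suc.hyps y y' by auto
  also have "\<dots> = halfspace z z'"
  proof (rule halfspace_square)
    show "y \<noteq> z'" by fact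
    show "y' \<noteq> z" using y'(3) yb by (auto simp: dist_commute[of b])
  qed (use y y' Suc.prems edge_sym in auto)
  finally show ?case .
qed

lemma halfspaces_boundary:
  assumes "H \<in> halfspaces" "(z, z') \<in> E" "z \<in> H" "z' \<notin> H"
  shows "H = halfspace z z'"
  using assms halfspace_boundary unfolding halfspaces_def by blast

text \<open>Follow a geodesic from \<open>x\<close> through \<open>m\<close> to \<open>y\<close>. If
  its edge \<open>u m\<close> were the first to leave \<open>H\<close>, then \<open>H\<close> would
  be the halfspace of that edge, and \<open>y\<close> in \<open>H\<close> would be closer to
  \<open>u\<close> than to \<open>m\<close>.\<close>

lemma halfspace_convex:
  assumes "H \<in> halfspaces" "x \<in> H" "y \<in> H" "m \<in> V" "between x m y"
  shows "m \<in> H"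
  using assms(4,5)
proof (induction "dist x m" arbitrary: m)
  case 0
  then show ?case using dist_eq_0 assms halfspace_sub by auto
next
  case (Suc k m)
  have V: "x \<in> V" "y \<in> V" using assms halfspace_sub by auto
  have "m \<noteq> x" using Suc.hyps by auto
  then obtain u where u: "(m, u) \<in> E" "dist m x = Suc (dist u x)"
    using step_towards[OF Suc.prems(1) V(1)] by blast
  have uV: "u \<in> V" using u edge_in by blast
  have b: "between x u m" using u dist_edge[OF edge_sym[OF u(1)]] by (simp add: dist_commute[of x])
  have ux: "between x u y" "between u m y"
    using between_trans[OF Suc.prems(2) b] V uV Suc.prems by auto
  have "dist x u = k" using u Suc.hyps(2) dist_commute by simp
  then have uH: "u \<in> H" using Suc.hyps(1)[of u] uV ux by auto
  show ?case
  proof (rule ccontr)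
    assume "m \<notin> H"
    then have "H = halfspace u m" using halfspaces_boundary assms(1) u(1) edge_sym uH by blast
    then have "dist y u < dist y m" using assms(3) unfolding halfspace_def by auto
    then show False using ux(2) dist_commute[of y] by simp
  qed
qed

lemma halfspace_convex_compl:
  assumes "H \<in> halfspaces" "x \<in> V - H" "y \<in> V - H" "m \<in> V" "between x m y"
  shows "m \<notin> H"
  using halfspace_convex[OF compl_halfspaces] assms by blast

text \<open>Two of the three points lie on one side of \<open>H\<close>, the median is between them,
  and both sides are convex.\<close>

lemma median_in_halfspace:
  assumes "is_median V E x y z m" "H \<in> halfspaces" "x \<in> V" "y \<in> V" "z \<in> V"
  shows "m \<in> H \<longleftrightarrow> x \<in> H \<and> y \<in> H \<or> y \<in> H \<and> z \<in> H \<or> x \<in> H \<and> z \<in> H"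
  using assms halfspace_convex[OF assms(2)] halfspace_convex_compl[OF assms(2)]
  unfolding is_median_def by (metis DiffI)

lemma halfspace_separates:
  assumes "x \<in> V" "y \<in> V" "x \<noteq> y"
  obtains H where "H \<in> halfspaces" "x \<in> H" "y \<notin> H"
proof -
  obtain u where u: "(x, u) \<in> E" "dist x y = Suc (dist u y)" using step_towards[OF assms] by blast
  then have "y \<notin> halfspace x u" unfolding halfspace_def using dist_commute[of y] by simp
  then show thesis using that halfspaceI halfspace_ends u by blast
qed

lemma median_unique:
  assumes "x \<in> V" "y \<in> V" "z \<in> V" "is_median V E x y z m" "is_median V E x y z m'"
  shows "m = m'"
proof (rule ccontr)
  assume "m \<noteq> m'"
  then obtain H where "H \<in> halfspaces" "m \<in> H" "m' \<notin> H"
    using halfspace_separates[of m m'] assms(4,5) unfolding is_median_def by blast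
  then show False using median_in_halfspace[OF assms(4) _ assms(1-3)] median_in_halfspace[OF assms(5) _ assms(1-3)] by blast
qed

abbreviation med :: "'a \<Rightarrow> 'a \<Rightarrow> 'a \<Rightarrow> 'a" where "med \<equiv> graph_median V E"

lemma is_median_med:
  assumes "x \<in> V" "y \<in> V" "z \<in> V" shows "is_median V E x y z (med x y z)"
  unfolding graph_median_def
  using theI'[of "is_median V E x y z"] median_exists median_unique assms by metis

lemma med_in_V: "x \<in> V \<Longrightarrow> y \<in> V \<Longrightarrow> z \<in> V \<Longrightarrow> med x y z \<in> V"
  using is_median_med unfolding is_median_def by blast

lemma med_in_halfspace:
  assumes "H \<in> halfspaces" "x \<in> V" "y \<in> V" "z \<in> V"
  shows "med x y z \<in> H \<longleftrightarrow> x \<in> H \<and> y \<in> H \<or> y \<in> H \<and> z \<in> H \<or> x \<in> H \<and> z \<in> H"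
  using median_in_halfspace is_median_med assms by metis

lemma between_med: "x \<in> V \<Longrightarrow> y \<in> V \<Longrightarrow> z \<in> V \<Longrightarrow> between x (med x y z) y"
  using is_median_med unfolding is_median_def by blast

lemma eq_if_same_halfspaces:
  assumes "x \<in> V" "y \<in> V" "\<And>H. H \<in> halfspaces \<Longrightarrow> x \<in> H \<longleftrightarrow> y \<in> H"
  shows "x = y"
  using halfspace_separates[OF assms(1,2)] assms(3) by blast

lemma med_between:
  assumes "x \<in> V" "y \<in> V" "m \<in> V" "between x m y"
  shows "med x y m = m"
proof (rule eq_if_same_halfspaces)
  fix H assume H: "H \<in> halfspaces"
  show "med x y m \<in> H \<longleftrightarrow> m \<in> H"
    using med_in_halfspace[OF H assms(1-3)] halfspace_convex[OF H _ _ assms(3,4)]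
      halfspace_convex_compl[OF H _ _ assms(3,4)] assms(1,2) by blast
qed (use assms med_in_V in auto)

section \<open>Distance as a count of separating halfspaces\<close>

definition sep :: "'a \<Rightarrow> 'a \<Rightarrow> 'a set set" where
  "sep x y = {H \<in> halfspaces. x \<in> H \<and> y \<notin> H}"

text \<open>The first edge \<open>x u\<close> of a geodesic to \<open>y\<close> crosses one
  halfspace only: a halfspace containing \<open>x\<close> but not \<open>u\<close> equals
  \<open>halfspace x u\<close>. The others that separate \<open>x\<close> from \<open>y\<close> are
  those separating \<open>u\<close> from \<open>y\<close>.\<close>

lemma sep_card: "x \<in> V \<Longrightarrow> y \<in> V \<Longrightarrow> finite (sep x y) \<and> card (sep x y) = dist x y"
proof (induction "dist x y" arbitrary: x)
  case 0
  then show ?case using dist_eq_0 by (auto simp: sep_def)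
next
  case (Suc k x)
  then have "x \<noteq> y" by auto
  then obtain u where u: "(x, u) \<in> E" "dist x y = Suc (dist u y)" using step_towards Suc.prems by blast
  have uV: "u \<in> V" using u edge_in by blast
  have b: "between x u y" using u dist_edge by simp
  have "halfspace x u \<notin> sep u y" using halfspace_ends u by (auto simp: sep_def)
  moreover have y: "y \<notin> halfspace x u" using u(2) dist_commute[of y] by (simp add: halfspace_def)
  moreover have "sep x y = insert (halfspace x u) (sep u y)"
  proof (intro subset_antisym subsetI)
    fix H assume "H \<in> sep x y"
    then show "H \<in> insert (halfspace x u) (sep u y)"
      using halfspaces_boundary[OF _ u(1), of H] by (auto simp: sep_def)
  next
    fix H assume "H \<in> insert (halfspace x u) (sep u y)"
    then show "H \<in> sep x y"
    proof
      assume "H \<in> sep u y"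
      then show ?thesis
        using halfspace_convex_compl[OF _ _ _ uV b, of H] Suc.prems by (auto simp: sep_def)
    qed (use y halfspaceI[OF u(1)] halfspace_ends[OF u(1)] in \<open>simp add: sep_def\<close>)
  qed
  ultimately show ?case using Suc.hyps(1)[of u] Suc.hyps(2) u(2) uV Suc.prems by auto
qed

text \<open>By the majority rule a halfspace that separates the two medians separates one of the
  three pairs of arguments, so it suffices to count halfspaces.\<close>

lemma med_lipschitz:
  assumes "x \<in> V" "y \<in> V" "z \<in> V" "x' \<in> V" "y' \<in> V" "z' \<in> V"
  shows "dist (med x y z) (med x' y' z') \<le> dist x x' + dist y y' + dist z z'"
proof -
  have "sep (med x y z) (med x' y' z') \<subseteq> sep x x' \<union> sep y y' \<union> sep z z'"
  proof
    fix H assume "H \<in> sep (med x y z) (med x' y' z')"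
    then show "H \<in> sep x x' \<union> sep y y' \<union> sep z z'"
      using med_in_halfspace[of H x y z] med_in_halfspace[of H x' y' z'] assms
      unfolding sep_def by blast
  qed
  then have "card (sep (med x y z) (med x' y' z')) \<le> card (sep x x' \<union> sep y y' \<union> sep z z')"
    using sep_card assms by (intro card_mono) auto
  also have "\<dots> \<le> card (sep x x') + card (sep y y') + card (sep z z')"
    by (meson card_Un_le add_le_mono1 le_trans)
  finally show ?thesis using sep_card assms med_in_V by simp
qed

end

section \<open>Edge paths modulo moves across squares\<close>

text \<open>The arguments of \<open>sq\<close> are the corners of a square in cyclic order.
  \<open>sq_cube\<close> is the cube condition: three squares that pairwise share an edge at
  \<open>u\<close> are half of the faces of a cube whose corner opposite \<open>u\<close> is
  \<open>q\<close>.\<close>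

locale square_moves =
  fixes adj :: "'a \<Rightarrow> 'a \<Rightarrow> bool" and sq :: "'a \<Rightarrow> 'a \<Rightarrow> 'a \<Rightarrow> 'a \<Rightarrow> bool"
  assumes adj_sym: "adj x y \<Longrightarrow> adj y x"
    and sq_adj: "sq a b c e \<Longrightarrow> adj a b \<and> adj b c \<and> adj c e \<and> adj e a"
    and sq_distinct: "sq a b c e \<Longrightarrow> distinct [a, b, c, e]"
    and sq_rotate: "sq a b c e \<Longrightarrow> sq b c e a"
    and sq_reflect: "sq a b c e \<Longrightarrow> sq a e c b"
    and sq_unique: "sq a b c e \<Longrightarrow> sq a b c e' \<Longrightarrow> e = e'"
    and sq_cube: "sq u v x w \<Longrightarrow> sq u w t w' \<Longrightarrow> sq u w' y v \<Longrightarrow>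
      \<exists>q. sq v x q y \<and> sq w x q t \<and> sq w' t q y"
begin

text \<open>Edge paths are listed backwards here: the head of the list is the current endpoint.\<close>

inductive moves :: "'a list \<Rightarrow> 'a list \<Rightarrow> bool" (infix "\<bowtie>" 50) where
  refl: "p \<bowtie> p"
| sym: "p \<bowtie> q \<Longrightarrow> q \<bowtie> p"
| trans: "p \<bowtie> q \<Longrightarrow> q \<bowtie> r \<Longrightarrow> p \<bowtie> r"
| swap: "sq a b c e \<Longrightarrow> a # b # c # q \<bowtie> a # e # c # q"
| cons: "p \<bowtie> q \<Longrightarrow> x # p \<bowtie> x # q"

lemmas [trans] = moves.trans

lemma sq_corner: "sq v u w u' \<Longrightarrow> sq v u' x u \<Longrightarrow> x = w"
  using sq_unique[of u v u' w x] sq_rotate sq_reflect by blast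

lemma sq_opposite: "sq v u w u' \<Longrightarrow> sq v u' w u'' \<Longrightarrow> u'' = u"
  using sq_unique[of v u' w u u''] sq_reflect by blast

lemma moves_length: "p \<bowtie> q \<Longrightarrow> length p = length q"
  by (induction rule: moves.induct) auto

lemma moves_hd: "p \<bowtie> q \<Longrightarrow> hd p = hd q"
  by (induction rule: moves.induct) auto

lemma moves_Nil: "p \<bowtie> q \<Longrightarrow> p = [] \<longleftrightarrow> q = []"
  using moves_length by fastforce

lemma moves_last: "p \<bowtie> q \<Longrightarrow> last p = last q"
proof (induction rule: moves.induct)
  case (cons p q x)
  then show ?case using moves_Nil by simp
qed auto

lemma moves_successively: "p \<bowtie> q \<Longrightarrow> successively adj p \<longleftrightarrow> successively adj q"
proof (induction rule: moves.induct)
  case (swap a b c e q)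
  then show ?case using sq_adj adj_sym by auto
next
  case (cons p q x)
  then show ?case using moves_hd[of p q] moves_Nil[of p q] by (auto simp: successively_Cons)
qed auto

text \<open>Compares the first steps of two paths back from their endpoint: either these steps agree
  and the remaining paths are equivalent, or they are two sides of a square and both remaining paths
  can be led through its opposite corner. The analogue in monoids is cancellation together with
  common multiples. For paths with fewer than two vertices the condition is vacuous.\<close>

definition exchange :: "'a list \<Rightarrow> 'a list \<Rightarrow> bool" where
  "exchange p p' \<longleftrightarrow> (\<forall>v u r v' u' r'. p = v # u # r \<longrightarrow> p' = v' # u' # r' \<longrightarrow>
     v = v' \<and> (if u = u' then u # r \<bowtie> u # r'
       else \<exists>w s. sq v u w u' \<and> u # r \<bowtie> u # w # s \<and> u' # r' \<bowtie> u' # w # s))"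

text \<open>The second vertices \<open>u\<close>, \<open>u'\<close>, \<open>u''\<close> of the three
  paths give two squares that share the edge \<open>v u'\<close>, with corners \<open>w\<close> and
  \<open>w2\<close> opposite \<open>v\<close>. Both corners follow \<open>u'\<close> in equivalent
  forms of the tail of the middle path, so the hypothesis for shorter paths either identifies them
  or provides a square at \<open>u'\<close>. In the latter case three squares meet at
  \<open>u'\<close>, and the cube condition supplies the square at \<open>v\<close> that relates
  \<open>u\<close> to \<open>u''\<close>.\<close>

lemma exchange_trans:
  assumes IH: "\<And>q q'. length q < length p \<Longrightarrow> q \<bowtie> q' \<Longrightarrow> exchange q q'"
    and "exchange p p'" "exchange p' p''" "length p = length p'" "length p' = length p''"
  shows "exchange p p''"
  unfolding exchange_def
proof (intro allI impI, goal_cases)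
  case (1 v u r v'' u'' r'')
  obtain v' u' r' where p': "p' = v' # u' # r'"
    using 1 assms(4) by (metis length_Suc_conv list.size(4))
  have len: "length (u' # r') < length p" using p' assms(4) by simp
  have v: "v = v'" "v' = v''" using assms(2,3) 1 p' unfolding exchange_def by blast+
  have A: "if u = u' then u # r \<bowtie> u # r'
      else \<exists>w s. sq v u w u' \<and> u # r \<bowtie> u # w # s \<and> u' # r' \<bowtie> u' # w # s"
    using assms(2) 1 p' unfolding exchange_def by blast
  have B: "if u' = u'' then u' # r' \<bowtie> u' # r''
      else \<exists>w s. sq v u' w u'' \<and> u' # r' \<bowtie> u' # w # s \<and> u'' # r'' \<bowtie> u'' # w # s"
    using assms(3) 1 p' v unfolding exchange_def by blast
  consider "u = u'" "u' = u''" | "u = u'" "u' \<noteq> u''" | "u \<noteq> u'" "u' = u''"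
    | "u \<noteq> u'" "u' \<noteq> u''" by blast
  then show ?case
  proof cases
    case 1 then show ?thesis using A B v moves.trans by auto
  next
    case 2 then show ?thesis using A B v by (auto intro: moves.trans)
  next
    case 3
    then obtain w s where "sq v u w u'" "u # r \<bowtie> u # w # s" "u' # r' \<bowtie> u' # w # s"
      using A by auto
    moreover from 3 have "u' # r' \<bowtie> u' # r''" using B by simp
    ultimately show ?thesis using 3 v moves.sym moves.trans by metis
  next
    case 4
    then obtain w s where A': "sq v u w u'" "u # r \<bowtie> u # w # s" "u' # r' \<bowtie> u' # w # s"
      using A by auto
    from 4 obtain w2 s2 where
      B': "sq v u' w2 u''" "u' # r' \<bowtie> u' # w2 # s2" "u'' # r'' \<bowtie> u'' # w2 # s2" using B by auto
    have "u' # w # s \<bowtie> u' # w2 # s2" using A'(3) B'(2) moves.sym moves.trans by blast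
    moreover have "length (u' # w # s) < length p" using moves_length[OF A'(3)] len by simp
    ultimately have "exchange (u' # w # s) (u' # w2 # s2)" using IH by blast
    then have X: "if w = w2 then w # s \<bowtie> w # s2
      else \<exists>t z. sq u' w t w2 \<and> w # s \<bowtie> w # t # z \<and> w2 # s2 \<bowtie> w2 # t # z"
      unfolding exchange_def by blast
    show ?thesis
    proof (cases "u = u''")
      case True
      then have "w2 = w" using sq_corner A'(1) B'(1) by blast
      then have "u # w # s \<bowtie> u # w # s2" using X moves.cons by auto
      then show ?thesis using A' B' True v \<open>w2 = w\<close> by (auto intro: moves.trans moves.sym)
    next
      case False
      then have "w \<noteq> w2" using sq_opposite A'(1) B'(1) by blast
      then obtain t z where t: "sq u' w t w2" "w # s \<bowtie> w # t # z" "w2 # s2 \<bowtie> w2 # t # z"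
        using X by auto
      have "sq u' v u w" "sq u' w2 u'' v" using A'(1) B'(1) sq_rotate sq_reflect by blast+
      then obtain q where q: "sq v u q u''" "sq w u q t" "sq w2 t q u''"
        using sq_cube[of u' v u w t w2 u''] t(1) by blast
      have "u # r \<bowtie> u # w # t # z" using A'(2) t(2) moves.cons moves.trans by blast
      also have "u # w # t # z \<bowtie> u # q # t # z"
        using moves.swap[of u w t q z] q(2) sq_rotate sq_reflect by blast
      finally have 1: "u # r \<bowtie> u # q # t # z" .
      have "u'' # r'' \<bowtie> u'' # w2 # t # z" using B'(3) t(3) moves.cons moves.trans by blast
      also have "u'' # w2 # t # z \<bowtie> u'' # q # t # z"
        using moves.swap[of u'' w2 t q z] q(3) sq_rotate by blast
      finally show ?thesis using 1 q(1) v False by auto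
    qed
  qed
qed

text \<open>The inner induction is on the derivation. The outer one, on length, serves the
  transitivity case, where tails of the middle path are compared.\<close>

lemma moves_exchange: "p \<bowtie> p' \<Longrightarrow> exchange p p'"
proof (induction "length p" arbitrary: p p' rule: less_induct)
  case less
  from less.prems show ?case using less.hyps
  proof (induction rule: moves.induct)
    case (refl p)
    then show ?case by (auto simp: exchange_def intro: moves.refl)
  next
    case (sym p q)
    then have "exchange p q" using moves_length by metis
    then show ?case unfolding exchange_def
      by (metis moves.sym sq_reflect)
  next
    case (trans p q r)
    have l: "length p = length q" "length q = length r" using trans.hyps moves_length by auto
    show ?case
    proof (rule exchange_trans)
      show "exchange p q" using trans by blast
      show "exchange q r" using trans l by metis
    qed (use trans l in blast)+
  next
    case (swap a b c e q)
    then show ?case using sq_distinct by (auto simp: exchange_def intro: moves.refl)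
  next
    case (cons p q x)
    then show ?case using moves_hd by (fastforce simp: exchange_def)
  qed
qed

lemma moves_cancel: "v # u # r \<bowtie> v' # u # r' \<Longrightarrow> u # r \<bowtie> u # r'"
  using moves_exchange[of "v # u # r" "v' # u # r'"] unfolding exchange_def by simp

lemma moves_square:
  assumes "v # u # r \<bowtie> v' # u' # r'" "u \<noteq> u'"
  obtains w s where "sq v u w u'" "u # r \<bowtie> u # w # s" "u' # r' \<bowtie> u' # w # s"
proof -
  have "\<exists>w s. sq v u w u' \<and> u # r \<bowtie> u # w # s \<and> u' # r' \<bowtie> u' # w # s"
    using moves_exchange[OF assms(1)] assms(2) unfolding exchange_def by auto
  then show thesis using that by blast
qed

section \<open>Reduced paths and the action of edges on them\<close>

definition backtracks :: "'a list \<Rightarrow> bool" where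
  "backtracks p \<longleftrightarrow> (\<exists>a b v w. p = a @ [v, w, v] @ b)"

definition reduced :: "'a list \<Rightarrow> bool" where
  "reduced p \<longleftrightarrow> (\<forall>q. p \<bowtie> q \<longrightarrow> \<not> backtracks q)"

lemma backtracks_Cons: "backtracks (x # p) \<longleftrightarrow> (\<exists>w r. p = w # x # r) \<or> backtracks p"
proof
  assume "backtracks (x # p)"
  then obtain a b v w where "x # p = a @ [v, w, v] @ b" unfolding backtracks_def by blast
  then show "(\<exists>w r. p = w # x # r) \<or> backtracks p"
    unfolding backtracks_def by (cases a) (simp, simp, blast)
next
  assume "(\<exists>w r. p = w # x # r) \<or> backtracks p"
  then show "backtracks (x # p)"
    unfolding backtracks_def by (metis append_Cons append_Nil)
qed

lemma reduced_cong: "p \<bowtie> q \<Longrightarrow> reduced p \<longleftrightarrow> reduced q"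
  unfolding reduced_def using moves.sym moves.trans by blast

lemma reduced_tl: "reduced (x # p) \<Longrightarrow> reduced p"
  unfolding reduced_def using moves.cons backtracks_Cons by blast

lemma reduced_single: "reduced [x]"
  unfolding reduced_def backtracks_def
proof (intro allI impI notI)
  fix q assume "[x] \<bowtie> q" "\<exists>a b v w. q = a @ [v, w, v] @ b"
  then show False using moves_length[of "[x]" q] by auto
qed

text \<open>Since the endpoint comes first, this says that some equivalent path arrives at its
  endpoint from \<open>y\<close>, so that moving on to \<open>y\<close> retracts the last
  step.\<close>

definition descends :: "'a list \<Rightarrow> 'a \<Rightarrow> bool" where
  "descends p y \<longleftrightarrow> (\<exists>r. p \<bowtie> hd p # y # r)"

lemma descends_cong: "p \<bowtie> q \<Longrightarrow> descends p y \<longleftrightarrow> descends q y"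
  unfolding descends_def using moves_hd moves.sym moves.trans by metis

text \<open>Take an equivalent path \<open>y # v' # r'\<close> with a backtrack. For
  \<open>v' = v\<close>, cancellation forces the backtrack to be at the head. Otherwise
  \<open>v\<close> and \<open>v'\<close> are the neighbours of \<open>y\<close> in a square with
  opposite corner \<open>w\<close>, and a backtrack deeper down is handled by induction on the tail
  through \<open>w\<close>.\<close>

lemma not_reduced_descends:
  assumes "reduced (v # r)" "\<not> reduced (y # v # r)"
  shows "descends (v # r) y"
  using assms
proof (induction "length r" arbitrary: v r y rule: less_induct)
  case less
  then obtain p' where p': "y # v # r \<bowtie> p'" "backtracks p'" unfolding reduced_def by blast
  have "length p' \<ge> 2" using moves_length[OF p'(1)] by simp
  then obtain y' v' r' where "p' = y' # v' # r'" by (cases p'; cases "tl p'") auto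
  then have p'eq: "p' = y # v' # r'" using moves_hd[OF p'(1)] by simp
  show ?case
  proof (cases "v' = v")
    case True
    then have r: "v # r \<bowtie> v # r'" using moves_cancel p' p'eq by blast
    then have "\<not> backtracks (v # r')" using less.prems(1) unfolding reduced_def by blast
    then obtain s where "r' = y # s" using p'(2) p'eq True by (auto simp: backtracks_Cons)
    then show ?thesis using r unfolding descends_def by auto
  next
    case False
    then obtain w s where w: "sq y v w v'" "v # r \<bowtie> v # w # s" "v' # r' \<bowtie> v' # w # s"
      using moves_square p'(1) p'eq by metis
    have red: "reduced (v # w # s)" using w(2) less.prems(1) reduced_cong by blast
    show ?thesis
    proof (cases "backtracks (v' # r')")
      case True
      then have "\<not> reduced (v' # w # s)" using w(3) moves.sym unfolding reduced_def by blast
      moreover have "length s < length r" using moves_length[OF w(2)] by simp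
      ultimately have "descends (w # s) v'" using less.hyps red reduced_tl by blast
      then obtain z where "w # s \<bowtie> w # v' # z" unfolding descends_def by auto
      then have "v # r \<bowtie> v # w # v' # z" using w(2) moves.cons moves.trans by blast
      also have "v # w # v' # z \<bowtie> v # y # v' # z"
        using moves.swap[of v w v' y z] w(1) sq_rotate by blast
      finally show ?thesis unfolding descends_def by auto
    next
      case False
      then obtain r'' where "r' = y # r''" using p'(2) p'eq by (auto simp: backtracks_Cons)
      then have "v' # y # r'' \<bowtie> v' # w # s" using w(3) by simp
      moreover have "y \<noteq> w" using sq_distinct[OF w(1)] by auto
      ultimately obtain t z where t: "sq v' y t w" "w # s \<bowtie> w # t # z"
        using moves_square by metis
      have "sq v' y v w" using w(1) sq_rotate sq_reflect by blast
      \<comment> \<open>A backtrack at the head produces a second square sharing three corners with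
        the first one, so \<open>t = v\<close>, and then \<open>v # w # s\<close> is equivalent to a
        path with a backtrack.\<close>
      then have "t = v" using t(1) sq_unique[of w v' y t v] sq_rotate sq_reflect by blast
      then have "v # w # s \<bowtie> v # w # v # z" using t(2) moves.cons by blast
      then show ?thesis using red unfolding reduced_def backtracks_def
        by (metis append_Cons append_Nil)
    qed
  qed
qed

text \<open>Edges act on classes of reduced paths (as in van der Waerden's construction of normal
  forms for free groups), and homotopic edge paths act in the same way.\<close>

definition act :: "'a \<Rightarrow> 'a list \<Rightarrow> 'a list" where
  "act y p = (if descends p y then y # (SOME r. p \<bowtie> hd p # y # r) else y # p)"

text \<open>Cancellation makes the result, up to moves, independent of the path chosen by
  \<open>SOME\<close>.\<close>

lemma act_descend:
  assumes "p \<bowtie> v # y # r" shows "act y p \<bowtie> y # r"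
proof -
  have v: "hd p = v" using moves_hd[OF assms] by simp
  then have d: "descends p y" using assms unfolding descends_def by auto
  have "p \<bowtie> v # y # (SOME r. p \<bowtie> hd p # y # r)"
    using someI[of "\<lambda>r. p \<bowtie> hd p # y # r" r] assms v by simp
  then have "y # (SOME r. p \<bowtie> hd p # y # r) \<bowtie> y # r"
    using assms moves_cancel moves.sym moves.trans by blast
  then show ?thesis using d by (simp add: act_def)
qed

lemma act_ascend: "\<not> descends p y \<Longrightarrow> act y p = y # p"
  by (simp add: act_def)

lemma hd_act [simp]: "hd (act y p) = y" and act_not_Nil [simp]: "act y p \<noteq> []"
  by (simp_all add: act_def)

lemma act_cong: assumes "p \<bowtie> q" shows "act y p \<bowtie> act y q"
proof (cases "descends p y")
  case True
  then obtain r where r: "p \<bowtie> hd p # y # r" unfolding descends_def by blast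
  then have "q \<bowtie> hd p # y # r" using assms moves.sym moves.trans by blast
  then show ?thesis using r act_descend moves.sym moves.trans by blast
next
  case False
  then show ?thesis using assms act_ascend descends_cong moves.cons by metis
qed

lemma reduced_act:
  assumes "reduced p" "p \<noteq> []" shows "reduced (act y p)"
proof (cases "descends p y")
  case True
  then obtain r where r: "p \<bowtie> hd p # y # r" unfolding descends_def by blast
  then have "reduced (y # r)" using assms reduced_cong reduced_tl by blast
  then show ?thesis using act_descend[OF r] reduced_cong by blast
next
  case False
  then show ?thesis using act_ascend not_reduced_descends assms by (metis list.exhaust)
qed

text \<open>After a descent to \<open>y\<close> the step back to the old endpoint cannot be another
  descent, because \<open>p\<close> would then be equivalent to a path with a backtrack. After an
  ascent it is a descent.\<close>

lemma act_backtrack: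
  assumes "reduced p" "p \<noteq> []" shows "act (hd p) (act y p) \<bowtie> p"
proof (cases "descends p y")
  case True
  then obtain r where r: "p \<bowtie> hd p # y # r" unfolding descends_def by blast
  have "\<not> descends (y # r) (hd p)"
  proof
    assume "descends (y # r) (hd p)"
    then obtain s where "y # r \<bowtie> y # hd p # s" unfolding descends_def by auto
    then have "p \<bowtie> hd p # y # hd p # s" using r moves.cons moves.trans by blast
    then show False using assms(1) unfolding reduced_def backtracks_def
      by (metis append_Cons append_Nil)
  qed
  then have "act (hd p) (y # r) = hd p # y # r" by (rule act_ascend)
  then show ?thesis using r act_cong[OF act_descend[OF r], of "hd p"] moves.sym moves.trans
    by metis
next
  case False
  have "y # p \<bowtie> y # hd p # tl p" using assms(2) moves.refl by simp
  then show ?thesis using act_descend[of "y # p" y "hd p" "tl p"] False act_ascend assms(2) by simp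
qed

text \<open>If \<open>a # r\<close> descended to \<open>b\<close>, a move across the square would
  let \<open>p\<close> descend to \<open>c\<close>. So both ways round the square end in
  \<open>b # a # r\<close>: one goes down and then up, the other up and then down.\<close>

lemma act_square_half:
  assumes "reduced p" "p \<noteq> []" "sq (hd p) a b c" "descends p a" "\<not> descends p c"
  shows "act b (act a p) \<bowtie> act b (act c p)"
proof -
  let ?v = "hd p"
  obtain r where r: "p \<bowtie> ?v # a # r" using assms(4) unfolding descends_def by blast
  have "\<not> descends (a # r) b"
  proof
    assume "descends (a # r) b"
    then obtain s where "a # r \<bowtie> a # b # s" unfolding descends_def by auto
    then have "p \<bowtie> ?v # a # b # s" using r moves.cons moves.trans by blast
    also have "?v # a # b # s \<bowtie> ?v # c # b # s" using assms(3) moves.swap by blast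
    finally show False using assms(5) unfolding descends_def by blast
  qed
  then have 1: "act b (act a p) \<bowtie> b # a # r"
    using act_cong[OF act_descend[OF r], of b] act_ascend by metis
  have "c # p \<bowtie> c # ?v # a # r" using r moves.cons by blast
  also have "c # ?v # a # r \<bowtie> c # b # a # r"
    using moves.swap[of c "?v" a b r] assms(3) sq_rotate by blast
  finally have "act b (c # p) \<bowtie> b # a # r" by (rule act_descend)
  then show ?thesis using 1 assms(5) act_ascend moves.sym moves.trans by metis
qed

text \<open>If \<open>p\<close> descends to both neighbours, it can be led through \<open>b\<close>,
  and both ways retract it to the same path. If it descends to neither, then no step is a descent,
  and the results differ by a move across the square.\<close>

lemma act_square:
  assumes "reduced p" "p \<noteq> []" "sq (hd p) a b c"
  shows "act b (act a p) \<bowtie> act b (act c p)"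
proof -
  let ?v = "hd p"
  have ac: "a \<noteq> c" using sq_distinct[OF assms(3)] by auto
  have sq': "sq ?v c b a" using assms(3) sq_reflect by blast
  consider "descends p a" "descends p c" | "descends p a" "\<not> descends p c"
    | "\<not> descends p a" "descends p c" | "\<not> descends p a" "\<not> descends p c" by blast
  then show ?thesis
  proof cases
    case 1
    then obtain r r' where r: "p \<bowtie> ?v # a # r" "p \<bowtie> ?v # c # r'" unfolding descends_def by blast
    then have "?v # a # r \<bowtie> ?v # c # r'" using moves.sym moves.trans by blast
    then obtain w s where w: "sq ?v a w c" "a # r \<bowtie> a # w # s" "c # r' \<bowtie> c # w # s"
      using moves_square ac by metis
    have "w = b" using w(1) assms(3) sq_unique[of c "?v" a w b] sq_rotate sq_reflect by blast
    then have "act b (act a p) \<bowtie> b # s" "act b (act c p) \<bowtie> b # s"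
      using w r act_descend moves.trans by metis+
    then show ?thesis using moves.sym moves.trans by blast
  next
    case 2 then show ?thesis using act_square_half assms by blast
  next
    case 3 then show ?thesis using act_square_half[OF assms(1,2) sq'] moves.sym by blast
  next
    case 4
    have no: "\<not> descends (a' # p) b" if "\<not> descends p c'" "sq ?v a' b c'" for a' c'
    proof
      assume "descends (a' # p) b"
      then obtain s where s: "a' # ?v # tl p \<bowtie> a' # b # s"
        using assms(2) unfolding descends_def by auto
      moreover have "?v \<noteq> b" using sq_distinct[OF that(2)] by auto
      ultimately obtain w z where w: "sq a' ?v w b" "?v # tl p \<bowtie> ?v # w # z"
        using moves_square by metis
      have "w = c'" using sq_unique[of b a' "?v" w c'] w(1) that(2) sq_rotate sq_reflect by blast
      then show False using w(2) that(1) assms(2) unfolding descends_def by auto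
    qed
    have "b # a # ?v # tl p \<bowtie> b # c # ?v # tl p"
      using moves.swap[of b a "?v" c "tl p"] assms(3) sq_rotate sq_reflect by blast
    then show ?thesis
      using no[OF 4(2) assms(3)] no[OF 4(1) sq'] 4 act_ascend assms(2) by simp
  qed
qed

section \<open>Development of edge paths by the action\<close>

lemma fold_act_cong: "p \<bowtie> q \<Longrightarrow> fold act zs p \<bowtie> fold act zs q"
  by (induction zs arbitrary: p q) (auto intro: act_cong)

lemma fold_act_reduced: "reduced p \<Longrightarrow> p \<noteq> [] \<Longrightarrow> reduced (fold act zs p) \<and> fold act zs p \<noteq> []"
  by (induction zs arbitrary: p) (simp_all add: reduced_act)

lemma hd_fold_act: "hd (fold act zs p) = last (hd p # zs)"
  by (induction zs arbitrary: p) auto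

text \<open>The input is listed in the order of travel and the output backwards, from its endpoint;
  hence the \<open>rev\<close> in \<open>develop_rev\<close>.\<close>

definition develop :: "'a list \<Rightarrow> 'a list" where
  "develop xs = fold act (tl xs) [hd xs]"

lemma develop_append: "xs \<noteq> [] \<Longrightarrow> develop (xs @ ys) = fold act ys (develop xs)"
  by (simp add: develop_def)

lemma develop_reduced: "reduced (develop xs)" "develop xs \<noteq> []"
  unfolding develop_def using fold_act_reduced[OF reduced_single] by auto

lemma hd_develop: "xs \<noteq> [] \<Longrightarrow> hd (develop xs) = last xs"
  unfolding develop_def by (cases xs) (auto simp: hd_fold_act)

lemma develop_backtrack: "develop (p @ [v, w, v] @ q) \<bowtie> develop (p @ [v] @ q)"
proof -
  let ?P = "develop (p @ [v])"
  have "hd ?P = v" using hd_develop[of "p @ [v]"] by simp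
  then have "act v (act w ?P) \<bowtie> ?P" using act_backtrack[of ?P w] develop_reduced by metis
  then have "fold act q (act v (act w ?P)) \<bowtie> fold act q ?P" by (rule fold_act_cong)
  then show ?thesis
    using develop_append[of "p @ [v]" "[w, v] @ q"] develop_append[of "p @ [v]" q] by simp
qed

lemma develop_square:
  assumes "sq a b c e"
  shows "develop (p @ [a, b, c] @ q) \<bowtie> develop (p @ [a, e, c] @ q)"
proof -
  let ?P = "develop (p @ [a])"
  have "hd ?P = a" using hd_develop[of "p @ [a]"] by simp
  then have "act c (act b ?P) \<bowtie> act c (act e ?P)"
    using act_square[of ?P b c e] develop_reduced assms by metis
  then have "fold act q (act c (act b ?P)) \<bowtie> fold act q (act c (act e ?P))" by (rule fold_act_cong)
  then show ?thesis
    using develop_append[of "p @ [a]" "[b, c] @ q"] develop_append[of "p @ [a]" "[e, c] @ q"] by simp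
qed

lemma act_reduced: "reduced (y # p) \<Longrightarrow> p \<noteq> [] \<Longrightarrow> act y p = y # p"
proof (rule act_ascend, rule notI)
  assume red: "reduced (y # p)" and "p \<noteq> []" "descends p y"
  then obtain r where "p \<bowtie> hd p # y # r" unfolding descends_def by blast
  then have "y # p \<bowtie> y # hd p # y # r" by (rule moves.cons)
  then show False using red unfolding reduced_def backtracks_def by (metis append_Cons append_Nil)
qed

lemma develop_rev: "reduced p \<Longrightarrow> p \<noteq> [] \<Longrightarrow> develop (rev p) = p"
proof (induction p)
  case (Cons x p)
  show ?case
  proof (cases "p = []")
    case True then show ?thesis by (simp add: develop_def)
  next
    case False
    then show ?thesis using Cons develop_append[of "rev p" "[x]"] act_reduced reduced_tl by auto
  qed
qed simp

text \<open>Undo the steps along \<open>q\<close> one at a time: by induction \<open>act y p\<close>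
  is equivalent to the tail of \<open>q\<close>, and stepping back from \<open>y\<close> to
  \<open>x\<close> recovers \<open>p\<close> from the former and \<open>q\<close> from the
  latter.\<close>

lemma fold_act_return:
  "reduced q \<Longrightarrow> q \<noteq> [] \<Longrightarrow> reduced p \<Longrightarrow> p \<noteq> [] \<Longrightarrow> hd p = hd q \<Longrightarrow>
   fold act (tl q) p \<bowtie> [last q] \<Longrightarrow> p \<bowtie> q"
proof (induction q arbitrary: p)
  case (Cons x q)
  show ?case
  proof (cases q)
    case Nil then show ?thesis using Cons by simp
  next
    case (Cons y r)
    have "fold act (tl q) (act y p) \<bowtie> [last q]" using Cons.prems Cons by simp
    then have "act y p \<bowtie> q"
      using Cons.IH[of "act y p"] Cons.prems Cons reduced_tl reduced_act by auto
    then have "act x (act y p) \<bowtie> act x q" by (rule act_cong)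
    moreover have "act x q = x # q" using Cons.prems(1) Cons act_reduced by auto
    moreover have "act x (act y p) \<bowtie> p" using act_backtrack[of p y] Cons.prems by simp
    ultimately show ?thesis using moves.sym moves.trans by metis
  qed
qed simp

text \<open>The walk that follows \<open>rev p\<close> and then \<open>q\<close> starts and ends at
  \<open>last q\<close>. If it develops to a constant path, then following \<open>q\<close> retracts
  \<open>p\<close> completely.\<close>

lemma reduced_moves:
  assumes "reduced p" "p \<noteq> []" "reduced q" "q \<noteq> []" "hd p = hd q" "last p = last q"
    and "develop (rev p @ tl q) \<bowtie> [last q]"
  shows "p \<bowtie> q"
proof (rule fold_act_return)
  show "fold act (tl q) p \<bowtie> [last q]"
    using assms develop_append[of "rev p" "tl q"] develop_rev by simp
qed (use assms in auto)

end

section \<open>Faces of a cube as intervals of sets\<close>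

definition flip :: "'b \<Rightarrow> 'b set \<Rightarrow> 'b set" where
  "flip i S = (if i \<in> S then S - {i} else insert i S)"

lemma mem_flip: "k \<in> flip i S \<longleftrightarrow> (k \<in> S \<longleftrightarrow> k \<noteq> i)"
  by (auto simp: flip_def)

lemma flip_commute: "flip i (flip j S) = flip j (flip i S)"
  by (auto simp: set_eq_iff mem_flip)

lemma flip_eq_iff: "flip i S = flip j S \<longleftrightarrow> i = j"
  by (auto simp: set_eq_iff mem_flip)

lemma flip_neq: "flip i S \<noteq> S"
  by (auto simp: set_eq_iff mem_flip)

lemma flip_subset: "i \<in> B \<Longrightarrow> S \<subseteq> B \<Longrightarrow> flip i S \<subseteq> B"
  by (auto simp: flip_def)

lemma interval_flip: "{T. S - {i} \<subseteq> T \<and> T \<subseteq> insert i S} = {S, flip i S}"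
  by (auto simp: flip_def)

lemma interval_flip2:
  "{T. S - {i, j} \<subseteq> T \<and> T \<subseteq> insert i (insert j S)} = {S, flip i S, flip j (flip i S), flip j S}"
proof (intro equalityI subsetI)
  fix T assume T: "T \<in> {T. S - {i, j} \<subseteq> T \<and> T \<subseteq> insert i (insert j S)}"
  then have k: "k \<in> T \<longleftrightarrow> k \<in> S" if "k \<noteq> i" "k \<noteq> j" for k using that by auto
  consider "i \<in> T \<longleftrightarrow> i \<in> S" "j \<in> T \<longleftrightarrow> j \<in> S" | "i \<in> T \<longleftrightarrow> i \<notin> S" "j \<in> T \<longleftrightarrow> j \<in> S"
    | "i \<in> T \<longleftrightarrow> i \<notin> S" "j \<in> T \<longleftrightarrow> j \<notin> S" | "i \<in> T \<longleftrightarrow> i \<in> S" "j \<in> T \<longleftrightarrow> j \<notin> S" by blast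
  then show "T \<in> {S, flip i S, flip j (flip i S), flip j S}"
  proof cases
    case 1 then have "T = S" using k unfolding set_eq_iff by metis
    then show ?thesis by simp
  next
    case 2 then have "T = flip i S" using k unfolding set_eq_iff mem_flip by metis
    then show ?thesis by simp
  next
    case 3
    show ?thesis
    proof (cases "i = j")
      case True then have "T = flip i S" using k 3 unfolding set_eq_iff mem_flip by metis
      then show ?thesis by simp
    next
      case False then have "T = flip j (flip i S)" using k 3 unfolding set_eq_iff mem_flip by metis
      then show ?thesis by simp
    qed
  next
    case 4 then have "T = flip j S" using k unfolding set_eq_iff mem_flip by metis
    then show ?thesis by simp
  qed
qed (auto simp: mem_flip flip_def split: if_splits)

text \<open>Both ends of the interval are among its two elements, and so is
  \<open>insert i A\<close> for \<open>i\<close> in \<open>B - A\<close>; hence \<open>B\<close>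
  exceeds \<open>A\<close> by one element.\<close>

lemma interval_pair:
  assumes "{S, T} = {U. A \<subseteq> U \<and> U \<subseteq> B}" "A \<subseteq> B" "S \<noteq> T"
  shows "\<exists>i\<in>B. T = flip i S"
proof -
  have AB: "A \<in> {S, T}" "B \<in> {S, T}" unfolding assms(1) using assms(2) by simp_all
  have "A \<noteq> B"
  proof
    assume "A = B"
    then have "S = A" "T = A" using assms(1) by auto
    then show False using assms(3) by simp
  qed
  then have e: "A = S \<and> B = T \<or> A = T \<and> B = S" using AB by auto
  obtain i where i: "i \<in> B" "i \<notin> A" using assms(2) \<open>A \<noteq> B\<close> by blast
  then have "insert i A \<in> {S, T}" unfolding assms(1) using assms(2) by blast
  then have "B = insert i A" using i e by auto
  then have "T = flip i S" using e i by (auto simp: flip_def)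
  then show ?thesis using i(1) by blast
qed

section \<open>Squares and cubes of a cube complex\<close>

lemma adjacent_sym: "(u, v) \<in> adjacent K \<Longrightarrow> (v, u) \<in> adjacent K"
  by (auto simp: adjacent_def insert_commute)

lemma adjacent_vertices: "(u, v) \<in> adjacent K \<Longrightarrow> u \<in> vertices K \<and> v \<in> vertices K"
  by (auto simp: adjacent_def)

lemma cube_chart:
  assumes "is_cube K n Q"
  obtains \<phi> where "bij_betw \<phi> (Pow {..<n}) Q"
    "{R \<in> K. R \<subseteq> Q} = {\<phi> ` {S. A \<subseteq> S \<and> S \<subseteq> B} | A B. A \<subseteq> B \<and> B \<subseteq> {..<n}}"
  using assms[unfolded is_cube_def] by (elim exE conjE) (rule that)

lemma cube_card:
  assumes "is_cube K n Q" shows "card Q = 2 ^ n" "finite Q"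
proof -
  obtain \<phi> where \<phi>: "bij_betw \<phi> (Pow {..<n}) Q" by (rule cube_chart[OF assms])
  show "card Q = 2 ^ n" using bij_betw_same_card[OF \<phi>] by (simp add: card_Pow)
  show "finite Q" using bij_betw_finite[OF \<phi>] by simp
qed

definition sq :: "'a set set \<Rightarrow> 'a \<Rightarrow> 'a \<Rightarrow> 'a \<Rightarrow> 'a \<Rightarrow> bool" where
  "sq K a b c e \<longleftrightarrow> {a, b, c, e} \<in> K \<and> distinct [a, b, c, e] \<and>
     (a, b) \<in> adjacent K \<and> (b, c) \<in> adjacent K \<and> (c, e) \<in> adjacent K \<and> (e, a) \<in> adjacent K"

lemma sq_rotate: "sq K a b c e \<Longrightarrow> sq K b c e a"
  unfolding sq_def by (auto simp: insert_commute)

lemma sq_reflect: "sq K a b c e \<Longrightarrow> sq K a e c b"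
  unfolding sq_def by (auto simp: insert_commute adjacent_sym)

context
  fixes K :: "'a set set" and n :: nat and Q :: "'a set" and \<phi> :: "nat set \<Rightarrow> 'a"
  assumes bij: "bij_betw \<phi> (Pow {..<n}) Q"
    and faces: "{R \<in> K. R \<subseteq> Q} = {\<phi> ` {S. A \<subseteq> S \<and> S \<subseteq> B} | A B. A \<subseteq> B \<and> B \<subseteq> {..<n}}"
begin

lemma chart_face: "A \<subseteq> B \<Longrightarrow> B \<subseteq> {..<n} \<Longrightarrow> \<phi> ` {S. A \<subseteq> S \<and> S \<subseteq> B} \<in> K"
  using faces by blast

lemma chart_faceE:
  assumes "R \<in> K" "R \<subseteq> Q"
  obtains A B where "R = \<phi> ` {S. A \<subseteq> S \<and> S \<subseteq> B}" "A \<subseteq> B" "B \<subseteq> {..<n}"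
proof -
  have "R \<in> {R \<in> K. R \<subseteq> Q}" using assms by simp
  then show thesis unfolding faces by (elim CollectE exE conjE) (rule that)
qed

lemma chart_eq_iff: "S \<subseteq> {..<n} \<Longrightarrow> T \<subseteq> {..<n} \<Longrightarrow> \<phi> S = \<phi> T \<longleftrightarrow> S = T"
  using bij unfolding bij_betw_def inj_on_def by blast

lemma chart_adjacent_flip:
  assumes "S \<subseteq> {..<n}" "i < n" shows "(\<phi> S, \<phi> (flip i S)) \<in> adjacent K"
proof -
  have "\<phi> ` {S, flip i S} \<in> K"
    using chart_face[of "S - {i}" "insert i S"] assms unfolding interval_flip by auto
  moreover have "flip i S \<subseteq> {..<n}" using flip_subset assms by (metis lessThan_iff)
  then have "\<phi> S \<noteq> \<phi> (flip i S)" using chart_eq_iff assms(1) flip_neq by metis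
  ultimately show ?thesis unfolding adjacent_def by simp
qed

lemma chart_adjacentD:
  assumes "S \<subseteq> {..<n}" "T \<subseteq> {..<n}" "(\<phi> S, \<phi> T) \<in> adjacent K"
  shows "\<exists>i<n. T = flip i S"
proof -
  have ST: "S \<noteq> T" and K: "{\<phi> S, \<phi> T} \<in> K" using assms(3) unfolding adjacent_def by auto
  have "{\<phi> S, \<phi> T} \<subseteq> Q" using bij assms(1,2) unfolding bij_betw_def by blast
  then obtain A B where AB: "{\<phi> S, \<phi> T} = \<phi> ` {S. A \<subseteq> S \<and> S \<subseteq> B}" "A \<subseteq> B" "B \<subseteq> {..<n}"
    by (rule chart_faceE[OF K])
  have "inj_on \<phi> (Pow {..<n})" using bij unfolding bij_betw_def by blast
  moreover have "{S, T} \<subseteq> Pow {..<n}" using assms by blast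
  moreover have "{S. A \<subseteq> S \<and> S \<subseteq> B} \<subseteq> Pow {..<n}" using AB by blast
  moreover have "\<phi> ` {S, T} = \<phi> ` {S. A \<subseteq> S \<and> S \<subseteq> B}" using AB(1) by simp
  ultimately have I: "{S, T} = {S. A \<subseteq> S \<and> S \<subseteq> B}"
    by (rule iffD1[OF inj_on_image_eq_iff])
  show ?thesis using interval_pair[OF I AB(2) ST] AB(3) by blast
qed

lemma chart_neighbours:
  assumes "S \<subseteq> {..<n}"
  shows "{w \<in> Q. (\<phi> S, w) \<in> adjacent K} = (\<lambda>i. \<phi> (flip i S)) ` {..<n}"
proof (intro equalityI subsetI)
  fix w assume w: "w \<in> {w \<in> Q. (\<phi> S, w) \<in> adjacent K}"
  then obtain T where "T \<subseteq> {..<n}" "w = \<phi> T" using bij unfolding bij_betw_def by blast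
  then show "w \<in> (\<lambda>i. \<phi> (flip i S)) ` {..<n}" using chart_adjacentD[OF assms] w by blast
next
  fix w assume "w \<in> (\<lambda>i. \<phi> (flip i S)) ` {..<n}"
  then obtain i where "i < n" "w = \<phi> (flip i S)" by blast
  then show "w \<in> {w \<in> Q. (\<phi> S, w) \<in> adjacent K}"
    using chart_adjacent_flip[OF assms] bij flip_subset[of i "{..<n}" S] assms
    unfolding bij_betw_def by blast
qed

text \<open>Recovers the dimension of a cube from its edges at one vertex, independently of the
  chart.\<close>

lemma chart_degree:
  assumes "v \<in> Q" shows "card {w \<in> Q. (v, w) \<in> adjacent K} = n"
proof -
  obtain S where S: "S \<subseteq> {..<n}" "v = \<phi> S" using assms bij unfolding bij_betw_def by blast
  have "inj_on (\<lambda>i. \<phi> (flip i S)) {..<n}"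
  proof (rule inj_onI)
    fix i j assume "i \<in> {..<n}" "j \<in> {..<n}" "\<phi> (flip i S) = \<phi> (flip j S)"
    then have "flip i S = flip j S" using chart_eq_iff flip_subset[OF _ S(1)] by simp
    then show "i = j" by (simp add: flip_eq_iff)
  qed
  then show ?thesis using chart_neighbours[OF S(1)] S(2) by (simp add: card_image)
qed

lemma chart_square:
  assumes "S \<subseteq> {..<n}" "i < n" "j < n" "i \<noteq> j"
  shows "sq K (\<phi> S) (\<phi> (flip i S)) (\<phi> (flip j (flip i S))) (\<phi> (flip j S))"
proof -
  have sub: "flip i S \<subseteq> {..<n}" "flip j S \<subseteq> {..<n}" "flip j (flip i S) \<subseteq> {..<n}"
    using assms flip_subset by (metis lessThan_iff)+
  have "\<phi> ` {S, flip i S, flip j (flip i S), flip j S} \<in> K"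
    using chart_face[of "S - {i, j}" "insert i (insert j S)"] assms
    unfolding interval_flip2 by auto
  moreover have "distinct (map \<phi> [S, flip i S, flip j (flip i S), flip j S])"
    unfolding distinct_map
  proof
    have "S \<noteq> flip j (flip i S)" using mem_flip[of i j "flip i S"] mem_flip[of i i S] assms(4) by metis
    moreover have "flip j (flip i S) \<noteq> flip j S" using flip_commute flip_neq by metis
    ultimately show "distinct [S, flip i S, flip j (flip i S), flip j S]"
      using assms(4) flip_neq by (simp add: flip_eq_iff flip_neq[symmetric])
    show "inj_on \<phi> (set [S, flip i S, flip j (flip i S), flip j S])"
      by (rule inj_on_subset[OF bij_betw_imp_inj_on[OF bij]]) (use sub assms(1) in simp)
  qed
  moreover have "(\<phi> (flip j (flip i S)), \<phi> (flip j S)) \<in> adjacent K"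
    using chart_adjacent_flip[OF sub(2) assms(2)] flip_commute adjacent_sym by metis
  ultimately show ?thesis unfolding sq_def
    using chart_adjacent_flip[OF assms(1,2)] chart_adjacent_flip[OF assms(1,3)]
      chart_adjacent_flip[OF sub(1) assms(3)] adjacent_sym by auto
qed

end

lemma cube_degree:
  assumes "is_cube K n Q" "v \<in> Q" shows "card {w \<in> Q. (v, w) \<in> adjacent K} = n"
  by (rule cube_chart[OF assms(1)]) (rule chart_degree[OF _ _ assms(2)])

section \<open>Squares and flag links in a CAT(0) cube complex\<close>

locale cat0_complex =
  fixes K :: "'a set set"
  assumes cat0: "CAT0_cube_complex K"
begin

lemma cube: "Q \<in> K \<Longrightarrow> \<exists>n. is_cube K n Q"
  using cat0 unfolding CAT0_cube_complex_def cube_complex_def by blast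

lemma Int_cube: "Q \<in> K \<Longrightarrow> R \<in> K \<Longrightarrow> Q \<inter> R \<noteq> {} \<Longrightarrow> Q \<inter> R \<in> K"
  using cat0 unfolding CAT0_cube_complex_def cube_complex_def by blast

text \<open>Two squares with three common corners and different fourth ones would meet in three
  vertices, but the intersection is a cube, and the number of its vertices is a power of
  two.\<close>

lemma sq_unique: assumes "sq K a b c e" "sq K a b c e'" shows "e = e'"
proof (rule ccontr)
  assume "e \<noteq> e'"
  then have "{a, b, c, e} \<inter> {a, b, c, e'} = {a, b, c}" using assms unfolding sq_def by auto
  then have "{a, b, c} \<in> K" using Int_cube[of "{a, b, c, e}" "{a, b, c, e'}"] assms unfolding sq_def by auto
  then obtain n where "is_cube K n {a, b, c}" using cube by blast
  then have "2 ^ n = card {a, b, c}" using cube_card by metis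
  also have "\<dots> = 3" using assms unfolding sq_def by simp
  finally have n: "(2::nat) ^ n = 3" .
  show False
  proof (cases n)
    case 0 then show False using n by simp
  next
    case (Suc k)
    then have "2 * (2::nat) ^ k = 3" using n by simp
    then show False by presburger
  qed
qed

lemma link_square: assumes "sq K u v x w" shows "{v, w} \<in> link K u"
proof -
  let ?Q = "{u, v, x, w}" let ?N = "{z \<in> ?Q. (u, z) \<in> adjacent K}"
  have Q: "?Q \<in> K" "card ?Q = 4" using assms unfolding sq_def by auto
  then obtain n where n: "is_cube K n ?Q" using cube by blast
  have "(2::nat) ^ n = 2 ^ 2" using cube_card(1)[OF n] Q by simp
  then have "n = 2" using power_inject_exp[of "2::nat" n 2] by simp
  then have "card ?N = 2" using cube_degree[OF n] by simp
  moreover have "{v, w} \<subseteq> ?N" "card {v, w} = 2" using assms adjacent_sym unfolding sq_def by auto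
  ultimately have "{v, w} = ?N" by (intro card_subset_eq) auto
  then show ?thesis using Q(1) unfolding link_def by blast
qed

lemma link_edge: assumes "(u, v) \<in> adjacent K" shows "{v} \<in> link K u"
proof -
  have "{v} = {w \<in> {u, v}. (u, w) \<in> adjacent K}" using assms unfolding adjacent_def by auto
  moreover have "{u, v} \<in> K" using assms unfolding adjacent_def by auto
  ultimately show ?thesis unfolding link_def by blast
qed

text \<open>Edges at \<open>u\<close> that pairwise span squares form a clique in the link, which
  flagness fills by a cube; counting the edges of this cube at \<open>u\<close> gives its
  dimension.\<close>

lemma flag_cube:
  assumes "finite T" "T \<noteq> {}" "\<And>v. v \<in> T \<Longrightarrow> (u, v) \<in> adjacent K"
    and "\<And>v w. v \<in> T \<Longrightarrow> w \<in> T \<Longrightarrow> v \<noteq> w \<Longrightarrow> \<exists>x. sq K u v x w"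
  obtains Q where "Q \<in> K" "u \<in> Q" "{w \<in> Q. (u, w) \<in> adjacent K} = T" "is_cube K (card T) Q"
proof -
  have "\<forall>x\<in>T. \<forall>y\<in>T. {x, y} \<in> link K u"
    using assms(3,4) link_square link_edge by (metis insert_absorb2)
  moreover obtain v where "v \<in> T" using assms(2) by blast
  then have "u \<in> vertices K" using assms(3) adjacent_vertices by metis
  ultimately have "T \<in> link K u"
    using cat0 assms(1,2) unfolding CAT0_cube_complex_def flag_complex_def by blast
  then obtain Q where Q: "Q \<in> K" "u \<in> Q" "{w \<in> Q. (u, w) \<in> adjacent K} = T"
    unfolding link_def by blast
  moreover obtain n where n: "is_cube K n Q" using cube Q by blast
  ultimately show thesis using that cube_degree[OF n Q(2)] by metis
qed

text \<open>The flag condition gives a 3-cube with edges from \<open>u\<close> to \<open>v\<close>,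
  \<open>w\<close> and \<open>w'\<close>. By uniqueness of squares the three given ones are among
  its faces, and \<open>q\<close> is its corner opposite \<open>u\<close>.\<close>

lemma sq_cube:
  assumes "sq K u v x w" "sq K u w t w'" "sq K u w' y v"
  shows "\<exists>q. sq K v x q y \<and> sq K w x q t \<and> sq K w' t q y"
proof -
  let ?T = "{v, w, w'}"
  have dist: "v \<noteq> w" "w \<noteq> w'" "w' \<noteq> v" using assms unfolding sq_def by auto
  have s: "sq K u v x w" "sq K u w x v" "sq K u w t w'" "sq K u w' t w" "sq K u w' y v" "sq K u v y w'"
    using assms sq_reflect[OF assms(1)] sq_reflect[OF assms(2)] sq_reflect[OF assms(3)] by simp_all
  have sqT: "\<exists>z. sq K u a z b" if "a \<in> ?T" "b \<in> ?T" "a \<noteq> b" for a b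
    using that by (elim insertE emptyE; hypsubst) (use s in blast)+
  have adjT: "(u, a) \<in> adjacent K" if "a \<in> ?T" for a
    using that s unfolding sq_def by (elim insertE emptyE) simp_all
  have fin: "finite ?T" "?T \<noteq> {}" by simp_all
  obtain Q where Q: "Q \<in> K" "u \<in> Q" "{w \<in> Q. (u, w) \<in> adjacent K} = ?T" "is_cube K (card ?T) Q"
    by (rule flag_cube[OF fin adjT sqT])
  moreover have "card ?T = 3" using dist by simp
  ultimately have "is_cube K 3 Q" by simp
  then obtain \<phi> where \<phi>: "bij_betw \<phi> (Pow {..<3::nat}) Q"
    "{R \<in> K. R \<subseteq> Q} = {\<phi> ` {S. A \<subseteq> S \<and> S \<subseteq> B} | A B. A \<subseteq> B \<and> B \<subseteq> {..<3}}"
    by (rule cube_chart)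
  obtain S where S: "S \<subseteq> {..<3}" "u = \<phi> S" using Q(2) \<phi>(1) unfolding bij_betw_def by blast
  have T: "?T = (\<lambda>i. \<phi> (flip i S)) ` {..<3}" using chart_neighbours[OF \<phi> S(1)] Q(3) S(2) by simp
  have "\<exists>i<3. a = \<phi> (flip i S)" if "a \<in> ?T" for a using that unfolding T by (elim imageE) auto
  from this[of v] this[of w] this[of w'] obtain i j k where ijk: "i < 3" "v = \<phi> (flip i S)"
    "j < 3" "w = \<phi> (flip j S)" "k < 3" "w' = \<phi> (flip k S)" by auto
  have ne: "i \<noteq> j" "j \<noteq> k" "k \<noteq> i" using ijk dist by auto
  note square = chart_square[OF \<phi>]
  have sub: "flip l S \<subseteq> {..<3}" if "l < 3" for l using S(1) that by (intro flip_subset) auto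
  \<comment> \<open>Three rotations put the unknown corner last, as in
    \<open>sq_unique\<close>.\<close>
  have corner: "x' = z" if "sq K u a x' b" "sq K u a z b" for a b x' z
    by (rule sq_unique[OF sq_rotate[OF sq_rotate[OF sq_rotate[OF that(1)]]]
        sq_rotate[OF sq_rotate[OF sq_rotate[OF that(2)]]]])
  have "x = \<phi> (flip j (flip i S))"
    using corner assms(1) square[OF S(1) ijk(1) ijk(3) ne(1)] ijk S(2) by simp
  moreover have "t = \<phi> (flip k (flip j S))"
    using corner assms(2) square[OF S(1) ijk(3) ijk(5) ne(2)] ijk S(2) by simp
  moreover have "y = \<phi> (flip i (flip k S))"
    using corner assms(3) square[OF S(1) ijk(5) ijk(1) ne(3)] ijk S(2) by simp
  ultimately show ?thesis
    using square[OF sub[OF ijk(1)] ijk(3) ijk(5) ne(2)] square[OF sub[OF ijk(3)] ijk(1) ijk(5) ne(3)[symmetric]]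
      square[OF sub[OF ijk(5)] ijk(3) ijk(1) ne(1)[symmetric]] ijk
    by (intro exI[of _ "\<phi> (flip k (flip j (flip i S)))"]) (simp add: flip_commute)
qed

sublocale square_moves "\<lambda>x y. (x, y) \<in> adjacent K" "sq K"
proof
  show "(x, y) \<in> adjacent K \<Longrightarrow> (y, x) \<in> adjacent K" for x y by (rule adjacent_sym)
  show "sq K a b c e \<Longrightarrow> (a, b) \<in> adjacent K \<and> (b, c) \<in> adjacent K \<and> (c, e) \<in> adjacent K \<and>
    (e, a) \<in> adjacent K" for a b c e by (simp add: sq_def)
  show "sq K a b c e \<Longrightarrow> distinct [a, b, c, e]" for a b c e by (simp only: sq_def)
  show "sq K a b c e \<Longrightarrow> sq K b c e a" for a b c e by (rule sq_rotate)
  show "sq K a b c e \<Longrightarrow> sq K a e c b" for a b c e by (rule sq_reflect)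
  show "sq K a b c e \<Longrightarrow> sq K a b c e' \<Longrightarrow> e = e'" for a b c e e' by (rule sq_unique)
  show "sq K u v x w \<Longrightarrow> sq K u w t w' \<Longrightarrow> sq K u w' y v \<Longrightarrow>
      \<exists>q. sq K v x q y \<and> sq K w x q t \<and> sq K w' t q y" for u v x w t w' y by (rule sq_cube)
qed

notation moves (infix "\<bowtie>" 50)

sublocale connected_simple_graph "vertices K" "adjacent K"
proof
  show "simple_graph (vertices K) (adjacent K)"
    unfolding simple_graph_def
  proof (intro conjI)
    show "adjacent K \<subseteq> vertices K \<times> vertices K"
      by (rule subrelI) (drule adjacent_vertices, simp only: mem_Sigma_iff)
    show "sym (adjacent K)" by (rule symI) (rule adjacent_sym)
    show "irrefl (adjacent K)" by (simp add: irrefl_def adjacent_def)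
  qed
  show "connected_graph (vertices K) (adjacent K)"
    using cat0 unfolding CAT0_cube_complex_def simply_connected_complex_def by blast
qed

section \<open>Reduced edge paths as geodesics\<close>

lemma homotopy_develop: "elementary_homotopy K p q \<Longrightarrow> develop p \<bowtie> develop q"
proof (induction rule: elementary_homotopy.induct)
  case (backtrack v w p q)
  show ?case by (rule develop_backtrack)
next
  case (square a b c e p q)
  then have "sq K a b c e"
    unfolding sq_def using adjacent_sym[of a e K] adjacent_sym[of e c K] by simp
  then show ?case by (rule develop_square)
qed

text \<open>This is where null homotopies of closed paths enter: the development is constant along
  them up to moves.\<close>

lemma closed_develop:
  assumes "edge_path K p" "hd p = last p" shows "develop p \<bowtie> [hd p]"
proof -
  have "equivclp (elementary_homotopy K) p [hd p]"
    using cat0 assms unfolding CAT0_cube_complex_def simply_connected_complex_def by blast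
  then have "develop p \<bowtie> develop [hd p]"
  proof (induction rule: equivclp_induct)
    case base show ?case by (rule moves.refl)
  next
    case (step y z)
    then show ?case using homotopy_develop moves.sym moves.trans by metis
  qed
  then show ?thesis by (simp add: develop_def)
qed

lemma edge_path_rev: "edge_path K p \<Longrightarrow> edge_path K (rev p)"
proof -
  have "(\<lambda>x y. (y, x) \<in> adjacent K) = (\<lambda>x y. (x, y) \<in> adjacent K)"
    using edge_sym by (intro ext) blast
  from arg_cong[of _ _ "\<lambda>r. successively r p", OF this]
  show "edge_path K p \<Longrightarrow> edge_path K (rev p)" unfolding edge_path_def by (simp add: successively_rev)
qed

lemma edge_path_moves: assumes "p \<bowtie> q" "edge_path K p" shows "edge_path K q"
\<comment> \<open>A path with a single vertex has no edge to witness that the vertex belongs to the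
  complex.\<close>
proof (cases "length q = 1")
  case True
  then obtain x y where "q = [x]" "p = [y]" using moves_length[OF assms(1)]
    by (auto simp: length_Suc_conv)
  then show ?thesis using assms moves_hd by fastforce
next
  case False
  have s: "successively (\<lambda>x y. (x, y) \<in> adjacent K) q" "q \<noteq> []"
    using assms moves_successively moves_Nil unfolding edge_path_def by blast+
  have "set q \<subseteq> vertices K"
  proof
    fix x assume "x \<in> set q"
    then obtain i where i: "i < length q" "x = q ! i" by (metis in_set_conv_nth)
    show "x \<in> vertices K"
    proof (cases i)
      case 0
      have "Suc 0 < length q" using s(2) False by (metis One_nat_def Suc_lessI length_greater_0_conv)
      then have "(q ! 0, q ! Suc 0) \<in> adjacent K" using s(1) by (simp add: successively_conv_nth)
      then show ?thesis using edge_in(1) i(2) 0 by metis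
    next
      case (Suc k)
      then have "(q ! k, q ! Suc k) \<in> adjacent K"
        using s i by (auto simp: successively_conv_nth)
      then show ?thesis using edge_in(2) i(2) Suc by metis
    qed
  qed
  then show ?thesis using s unfolding edge_path_def by blast
qed

lemma edge_path_Cons:
  "p \<noteq> [] \<Longrightarrow> edge_path K (v # p) \<longleftrightarrow> (v, hd p) \<in> adjacent K \<and> edge_path K p"
  unfolding edge_path_def using edge_in(1)[of v "hd p"]
  by (auto simp: successively_Cons simp del: Union_iff)

lemma reduced_paths_equiv:
  assumes "edge_path K p" "reduced p" "edge_path K q" "reduced q" "hd p = hd q" "last p = last q"
  shows "p \<bowtie> q"
proof (rule reduced_moves)
  let ?c = "rev p @ tl q"
  have ne: "p \<noteq> []" "q \<noteq> []" using assms unfolding edge_path_def by auto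
  have "tl q = [] \<or> edge_path K (tl q) \<and> (hd q, hd (tl q)) \<in> adjacent K"
    using assms(3) edge_path_Cons[of "tl q" "hd q"] ne(2) by (cases q) auto
  then have "edge_path K ?c"
    using edge_path_rev[OF assms(1)] assms(5) ne
    unfolding edge_path_def by (auto simp: successively_append_iff last_rev)
  moreover have "hd ?c = last q" using ne assms(6) by (simp add: hd_rev)
  moreover have "last ?c = last q"
    using ne assms(5) by (cases q) (auto simp: last_rev)
  ultimately show "develop ?c \<bowtie> [last q]" using closed_develop by metis
qed (use assms in \<open>auto simp: edge_path_def\<close>)

lemma edge_path_relpow: "edge_path K p \<Longrightarrow> (hd p, last p) \<in> adjacent K ^^ (length p - 1)"
proof (induction p)
  case (Cons x p)
  show ?case
  proof (cases "p = []")
    case False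
    then have "(x, hd p) \<in> adjacent K" "(hd p, last p) \<in> adjacent K ^^ (length p - 1)"
      using Cons edge_path_Cons by auto
    moreover have "length p = Suc (length p - 1)" using False by simp
    ultimately show ?thesis using False relpow_Suc_I2 by (metis One_nat_def diff_Suc_1 last_ConsR length_Cons list.sel(1))
  qed simp
qed (simp add: edge_path_def)

lemma edge_path_dist: assumes "edge_path K p" shows "dist (hd p) (last p) < length p"
proof -
  have "length p > 0" using assms unfolding edge_path_def by simp
  then show ?thesis using graph_dist_le[OF edge_path_relpow[OF assms]] by linarith
qed

lemma relpow_edge_path:
  "(x, y) \<in> adjacent K ^^ n \<Longrightarrow> x \<in> vertices K \<Longrightarrow>
   \<exists>p. edge_path K p \<and> hd p = x \<and> last p = y \<and> length p = Suc n"
proof (induction n arbitrary: x)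
  case 0
  then show ?case by (intro exI[of _ "[x]"]) (auto simp: edge_path_def)
next
  case (Suc n)
  then obtain z where z: "(x, z) \<in> adjacent K" "(z, y) \<in> adjacent K ^^ n"
    by (metis relpow_Suc_D2)
  then obtain p where "edge_path K p" "hd p = z" "last p = y" "length p = Suc n"
    using Suc.IH[OF z(2) edge_in(2)[OF z(1)]] by (elim exE conjE)
  then show ?case using z edge_path_Cons[of p x]
    by (intro exI[of _ "x # p"]) (auto simp: edge_path_def)
qed

lemma geodesic_exists:
  assumes "x \<in> vertices K" "z \<in> vertices K"
  obtains p where "edge_path K p" "hd p = x" "last p = z" "length p = Suc (dist x z)"
  using relpow_edge_path dist_relpow assms by blast

text \<open>A backtrack in an equivalent path could be cut out, leaving a shorter path with the same
  ends.\<close>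

lemma reduced_geodesic:
  assumes "edge_path K p" "length p = Suc (dist (hd p) (last p))" shows "reduced p"
  unfolding reduced_def
proof (intro allI impI notI)
  fix q assume q: "p \<bowtie> q" "backtracks q"
  then obtain a b v w where eq: "q = a @ [v, w, v] @ b" unfolding backtracks_def by blast
  have "edge_path K q" using edge_path_moves assms q by blast
  then have "edge_path K (a @ [v] @ b)"
    unfolding edge_path_def eq by (auto simp: successively_append_iff successively_Cons)
  moreover have "hd (a @ [v] @ b) = hd p" "last (a @ [v] @ b) = last p"
    using moves_hd[OF q(1)] moves_last[OF q(1)] unfolding eq by (auto simp: hd_append)
  moreover have "length (a @ [v] @ b) < length p" using moves_length[OF q(1)] unfolding eq by simp
  ultimately show False using edge_path_dist[of "a @ [v] @ b"] assms(2) by simp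
qed

text \<open>A geodesic with the same ends is reduced too, hence equivalent to \<open>p\<close>, and
  moves preserve length.\<close>

lemma geodesic_reduced:
  assumes "edge_path K p" "reduced p" shows "length p = Suc (dist (hd p) (last p))"
proof -
  have "hd p \<in> vertices K" "last p \<in> vertices K"
    using assms(1) hd_in_set[of p] last_in_set[of p] unfolding edge_path_def by (auto simp del: Union_iff)
  then obtain q where q: "edge_path K q" "hd q = hd p" "last q = last p"
    "length q = Suc (dist (hd p) (last p))" using geodesic_exists by metis
  then have "reduced q" using reduced_geodesic by simp
  then have "p \<bowtie> q" using reduced_paths_equiv assms q by simp
  then show ?thesis using moves_length q by simp
qed

text \<open>Prolong a geodesic \<open>p\<close> from \<open>u\<close> to \<open>z\<close> by
  \<open>v\<close>. Either the result is reduced and so a geodesic, or \<open>p\<close> can be led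
  through \<open>v\<close>; in both cases the distances differ.\<close>

lemma adjacent_dist_neq:
  assumes "(u, v) \<in> adjacent K" "z \<in> vertices K" shows "dist u z \<noteq> dist v z"
proof
  assume eq: "dist u z = dist v z"
  obtain p where p: "edge_path K p" "hd p = u" "last p = z" "length p = Suc (dist u z)"
    using geodesic_exists[OF edge_in(1)[OF assms(1)] assms(2)] by blast
  then have red: "reduced p" using reduced_geodesic by simp
  have ne: "p \<noteq> []" using p by auto
  have vp: "edge_path K (v # p)" using p adjacent_sym[OF assms(1)] edge_path_Cons[OF ne] by simp
  show False
  proof (cases "reduced (v # p)")
    case True
    then show ?thesis using geodesic_reduced[OF vp] p eq ne by simp
  next
    case False
    then have "descends p v" using not_reduced_descends[of "hd p" "tl p"] red ne by simp
    then obtain r where r: "p \<bowtie> u # v # r" using p unfolding descends_def by blast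
    then have "edge_path K (v # r)" using edge_path_moves[OF r p(1)] edge_path_Cons[of "v # r" u] by simp
    then have "dist v (last (v # r)) < length (v # r)" using edge_path_dist by fastforce
    then show ?thesis using moves_last[OF r] moves_length[OF r] p eq by simp
  qed
qed

text \<open>Geodesics from \<open>u\<close> and \<open>u'\<close> to \<open>z\<close>, both
  prolonged to \<open>v\<close>, are reduced with the same ends and hence equivalent; comparing
  their first steps produces the square.\<close>

lemma quadrangle_square:
  assumes "z \<in> vertices K" "(v, u) \<in> adjacent K" "(v, u') \<in> adjacent K" "u \<noteq> u'"
    and "dist v z = Suc (dist u z)" "dist v z = Suc (dist u' z)"
  shows "\<exists>w. sq K v u w u' \<and> dist u z = Suc (dist w z)"
proof -
  have geo: "\<exists>p. edge_path K (v # x # p) \<and> reduced (v # x # p) \<and> last (x # p) = z \<and>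
      length (x # p) = Suc (dist x z)"
    if x: "(v, x) \<in> adjacent K" "dist v z = Suc (dist x z)" for x
  proof -
    obtain p where p: "edge_path K p" "hd p = x" "last p = z" "length p = Suc (dist x z)"
      using geodesic_exists[OF edge_in(2)[OF x(1)] assms(1)] by blast
    have ne: "p \<noteq> []" using p by auto
    then have vp: "edge_path K (v # p)" using p x edge_path_Cons by simp
    then have red: "reduced (v # p)" using reduced_geodesic[OF vp] p x ne by simp
    obtain p0 where p0: "p = x # p0" using ne p(2) by (cases p) auto
    show ?thesis using p(3,4) vp red unfolding p0 by blast
  qed
  obtain p where p: "edge_path K (v # u # p)" "reduced (v # u # p)" "last (u # p) = z"
    "length (u # p) = Suc (dist u z)" using geo assms(2,5) by blast
  obtain p' where p': "edge_path K (v # u' # p')" "reduced (v # u' # p')" "last (u' # p') = z"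
    using geo assms(3,6) by blast
  have "v # u # p \<bowtie> v # u' # p'" using reduced_paths_equiv p p' by simp
  then obtain w s where w: "sq K v u w u'" "u # p \<bowtie> u # w # s"
    using moves_square assms(4) by metis
  have "edge_path K (w # s)"
    using edge_path_moves[OF w(2)] p(1) edge_path_Cons[of "u # p" v] edge_path_Cons[of "w # s" u] by simp
  then have "dist w z < length (w # s)" "w \<in> vertices K"
    using edge_path_dist[of "w # s"] moves_last[OF w(2)] p(3) unfolding edge_path_def by auto
  then have "dist w z < dist u z" using moves_length[OF w(2)] p(4) by simp
  moreover have "dist u z \<le> 1 + dist w z"
    using dist_triangle[OF edge_in(2)[OF assms(2)] \<open>w \<in> vertices K\<close> assms(1)] dist_edge[of u w] w(1)
    unfolding sq_def by simp
  ultimately show ?thesis using w(1) by (intro exI[of _ w]) simp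
qed

text \<open>Neighbours differ in their distance from \<open>a\<close>, so \<open>c\<close> is at
  distance two. The quadrangle condition at \<open>c\<close> with target \<open>a\<close> gives a
  square whose fourth corner is at distance zero from \<open>a\<close>.\<close>

lemma four_cycle_square:
  assumes "(a, b) \<in> adjacent K" "(b, c) \<in> adjacent K" "(c, e) \<in> adjacent K" "(e, a) \<in> adjacent K"
    and "a \<noteq> c" "b \<noteq> e"
  shows "sq K a b c e"
proof -
  have V: "a \<in> vertices K" "b \<in> vertices K" "c \<in> vertices K" "e \<in> vertices K"
    using edge_in assms by metis+
  have 1: "dist b a = 1" "dist e a = 1" "dist c b = 1" using dist_edge[OF adjacent_sym[OF assms(1)]] dist_edge[OF assms(4)]
      dist_edge[OF adjacent_sym[OF assms(2)]] by simp_all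
  have "dist c a \<le> 2" using dist_triangle[OF V(3,2,1)] 1 by simp
  moreover have "dist c a \<noteq> 1" using adjacent_dist_neq[OF assms(2) V(1)] 1 by simp
  moreover have "dist c a \<noteq> 0" using dist_eq_0 V assms(5) by simp
  ultimately have "dist c a = 2" by simp
  then obtain w where w: "sq K c b w e" "dist b a = Suc (dist w a)"
    using quadrangle_square[OF V(1) adjacent_sym[OF assms(2)] assms(3,6)] 1 by auto
  have "w \<in> vertices K" using w(1) edge_in unfolding sq_def by metis
  then have "w = a" using w(2) 1 dist_eq_0 V by simp
  then show ?thesis using w(1) sq_rotate sq_reflect by blast
qed

sublocale quadrangle_graph "vertices K" "adjacent K"
proof
  show "(u, v) \<in> adjacent K \<Longrightarrow> z \<in> vertices K \<Longrightarrow> dist z u \<noteq> dist z v" for u v z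
    using adjacent_dist_neq dist_commute by metis
next
  fix z v u u' assume a: "z \<in> vertices K" "(v, u) \<in> adjacent K" "(v, u') \<in> adjacent K" "u \<noteq> u'"
    "dist z v = Suc (dist z u)" "dist z v = Suc (dist z u')"
  then obtain w where "sq K v u w u'" "dist u z = Suc (dist w z)"
    using quadrangle_square[OF a(1-4)] dist_commute[of z] by auto
  then show "\<exists>w. (u, w) \<in> adjacent K \<and> (u', w) \<in> adjacent K \<and> dist z u = Suc (dist z w)"
    using adjacent_sym[of w u' K] dist_commute[of z] unfolding sq_def by auto
next
  fix u x y w u' assume a: "(u, x) \<in> adjacent K" "(u, y) \<in> adjacent K" "(u, w) \<in> adjacent K"
    "(u', x) \<in> adjacent K" "(u', y) \<in> adjacent K" "(u', w) \<in> adjacent K" "x \<noteq> y" "y \<noteq> w" "x \<noteq> w"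
  show "u = u'"
  proof (rule ccontr)
    assume "u \<noteq> u'"
    \<comment> \<open>Two 4-cycles through the path \<open>u\<close>, \<open>x\<close>,
      \<open>u'\<close> bound squares that share three corners, which forces
      \<open>y = w\<close>.\<close>
    then have "sq K u x u' y" "sq K u x u' w"
      using four_cycle_square[OF a(1) adjacent_sym[OF a(4)] a(5) adjacent_sym[OF a(2)]]
        four_cycle_square[OF a(1) adjacent_sym[OF a(4)] a(6) adjacent_sym[OF a(3)]] a(7,9) by simp_all
    then show False using sq_unique a(8) by metis
  qed
qed

text \<open>Any two neighbours of \<open>x\<close> on geodesics to \<open>z\<close> span a square by
  the quadrangle condition, so finitely many of them span a cube whose dimension is their
  number.\<close>

lemma interval_neighbours_card:
  assumes N: "\<And>Q n. Q \<in> K \<Longrightarrow> is_cube K n Q \<Longrightarrow> n \<le> N"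
    and xz: "x \<in> vertices K" "z \<in> vertices K"
    and T: "T \<subseteq> {u. (x, u) \<in> adjacent K \<and> between x u z}"
  shows "finite T \<and> card T \<le> N"
proof -
  have fin: "card S \<le> N" if S: "finite S" "S \<subseteq> T" for S
  proof (cases "S = {}")
    case False
    have adj: "(x, u) \<in> adjacent K" "dist x z = Suc (dist u z)" "u \<in> vertices K" if "u \<in> S" for u
      using that S T dist_edge[of x u] edge_in(2)[of x u] by auto
    have sqr: "\<exists>w. sq K x u w u'" if "u \<in> S" "u' \<in> S" "u \<noteq> u'" for u u'
      using quadrangle_square[OF xz(2) adj(1)[OF that(1)] adj(1)[OF that(2)] that(3)]
        adj(2)[OF that(1)] adj(2)[OF that(2)] by blast
    obtain Q where "Q \<in> K" "is_cube K (card S) Q"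
      using flag_cube[OF S(1) False adj(1) sqr] by blast
    then show ?thesis using N by blast
  qed simp
  then have "finite T" using infinite_arbitrarily_large[of T "Suc N"] by fastforce
  then show ?thesis using fin by blast
qed

end

text \<open>The path goes up first and does not end higher than it starts, so it has to turn down
  somewhere. Such peaks are what \<open>null_homotopic\<close> removes.\<close>

lemma list_peak:
  fixes f :: "'a \<Rightarrow> nat"
  assumes "successively (\<lambda>x y. f y = Suc (f x) \<or> f x = Suc (f y)) (a # b # q)"
    and "f b = Suc (f a)" "f (last (b # q)) \<le> f a"
  shows "\<exists>p1 u v w p2. a # b # q = p1 @ [u, v, w] @ p2 \<and> f v = Suc (f u) \<and> f v = Suc (f w)"
  using assms
proof (induction q arbitrary: a b)
  case (Cons c q)
  show ?case
  proof (cases "f b = Suc (f c)")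
    case True
    then show ?thesis using Cons.prems by (intro exI[of _ "[]"]) auto
  next
    case False
    then have c: "f c = Suc (f b)" using Cons.prems(1) by simp
    have "f (last (c # q)) \<le> f b" using Cons.prems by (auto split: if_splits)
    then obtain p1 u v w p2 where "b # c # q = p1 @ [u, v, w] @ p2" "f v = Suc (f u)" "f v = Suc (f w)"
      using Cons.IH[of b c] Cons.prems(1) c by auto
    then show ?thesis by (intro exI[of _ "a # p1"]) auto
  qed
qed simp

section \<open>The cube complex of a discrete median algebra\<close>

text \<open>A discrete median algebra is encoded by the set \<open>\<sigma> x\<close> of walls that separate a point \<open>x\<close> from a
  base point.  Cubes then become intervals in a power set.\<close>

locale median_algebra =
  fixes M :: "'a set" and \<sigma> :: "'a \<Rightarrow> 'b set"
  assumes inj: "inj_on \<sigma> M"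
    and finite_diff: "x \<in> M \<Longrightarrow> y \<in> M \<Longrightarrow> finite (\<sigma> x - \<sigma> y)"
    and majority: "x \<in> M \<Longrightarrow> y \<in> M \<Longrightarrow> z \<in> M \<Longrightarrow>
      \<exists>m\<in>M. \<sigma> m = \<sigma> x \<inter> \<sigma> y \<union> \<sigma> y \<inter> \<sigma> z \<union> \<sigma> x \<inter> \<sigma> z"
    and flip_towards: "x \<in> M \<Longrightarrow> y \<in> M \<Longrightarrow> x \<noteq> y \<Longrightarrow>
      \<exists>z\<in>M. \<exists>i. (i \<in> \<sigma> x \<longleftrightarrow> i \<notin> \<sigma> y) \<and> \<sigma> z = flip i (\<sigma> x)"
begin

definition cubes :: "'a set set" where
  "cubes = {Y. Y \<subseteq> M \<and> (\<exists>A B. A \<subseteq> B \<and> finite (B - A) \<and> \<sigma> ` Y = {S. A \<subseteq> S \<and> S \<subseteq> B})}"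

definition diff :: "'a \<Rightarrow> 'a \<Rightarrow> 'b set" where
  "diff x y = {i. i \<in> \<sigma> x \<longleftrightarrow> i \<notin> \<sigma> y}"

lemma finite_diff': "x \<in> M \<Longrightarrow> y \<in> M \<Longrightarrow> finite (diff x y)"
  using finite_diff[of x y] finite_diff[of y x]
  by (rule_tac finite_subset[of _ "(\<sigma> x - \<sigma> y) \<union> (\<sigma> y - \<sigma> x)"]) (auto simp: diff_def)

lemma diff_flip: "\<sigma> z = flip i (\<sigma> y) \<Longrightarrow> diff x z = flip i (diff x y)"
  by (auto simp: diff_def set_eq_iff mem_flip)

lemma cubesI:
  "Y \<subseteq> M \<Longrightarrow> A \<subseteq> B \<Longrightarrow> finite (B - A) \<Longrightarrow> \<sigma> ` Y = {S. A \<subseteq> S \<and> S \<subseteq> B} \<Longrightarrow> Y \<in> cubes"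
  unfolding cubes_def by blast

lemma cubesE:
  assumes "Y \<in> cubes"
  obtains A B where "Y \<subseteq> M" "A \<subseteq> B" "finite (B - A)" "\<sigma> ` Y = {S. A \<subseteq> S \<and> S \<subseteq> B}"
  using assms unfolding cubes_def by (elim CollectE conjE exE) (rule that)

lemma vertices_cubes: "vertices cubes = M"
proof
  show "vertices cubes \<subseteq> M" unfolding cubes_def by blast
  have "{x} \<in> cubes" if "x \<in> M" for x
    using that by (intro cubesI[of _ "\<sigma> x" "\<sigma> x"]) auto
  then show "M \<subseteq> vertices cubes" by blast
qed

lemma adjacent_cubes_iff:
  "(x, y) \<in> adjacent cubes \<longleftrightarrow> x \<in> M \<and> y \<in> M \<and> (\<exists>i. \<sigma> y = flip i (\<sigma> x))"
proof
  assume "(x, y) \<in> adjacent cubes"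
  then have xy: "x \<noteq> y" "{x, y} \<in> cubes" by (auto simp: adjacent_def)
  obtain A B where AB: "{x, y} \<subseteq> M" "A \<subseteq> B" "\<sigma> ` {x, y} = {S. A \<subseteq> S \<and> S \<subseteq> B}"
    by (rule cubesE[OF xy(2)])
  then have "\<sigma> x \<noteq> \<sigma> y" using inj xy(1) by (auto simp: inj_on_def)
  moreover have "{\<sigma> x, \<sigma> y} = {S. A \<subseteq> S \<and> S \<subseteq> B}" using AB(3) by simp
  ultimately have "\<exists>i. \<sigma> y = flip i (\<sigma> x)" using interval_pair AB(2) by metis
  then show "x \<in> M \<and> y \<in> M \<and> (\<exists>i. \<sigma> y = flip i (\<sigma> x))" using AB(1) by simp
next
  assume "x \<in> M \<and> y \<in> M \<and> (\<exists>i. \<sigma> y = flip i (\<sigma> x))"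
  then obtain i where i: "x \<in> M" "y \<in> M" "\<sigma> y = flip i (\<sigma> x)" by blast
  have "{x, y} \<in> cubes"
  proof (rule cubesI)
    show "\<sigma> ` {x, y} = {S. \<sigma> x - {i} \<subseteq> S \<and> S \<subseteq> insert i (\<sigma> x)}"
      unfolding interval_flip using i by simp
    show "finite (insert i (\<sigma> x) - (\<sigma> x - {i}))" by (rule finite_subset[of _ "{i}"]) auto
  qed (use i in auto)
  moreover have "x \<noteq> y" using i flip_neq by metis
  ultimately show "(x, y) \<in> adjacent cubes" unfolding adjacent_def by simp
qed

lemma chart:
  assumes Y: "Y \<subseteq> M" "A \<subseteq> B" "finite (B - A)" "\<sigma> ` Y = {S. A \<subseteq> S \<and> S \<subseteq> B}"
  shows "is_cube cubes (card (B - A)) Y"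
proof -
  define n where "n = card (B - A)"
  obtain e where e: "bij_betw e {..<n} (B - A)"
    using ex_bij_betw_nat_finite[OF Y(3)] unfolding n_def atLeast0LessThan by blast
  \<comment> \<open>\<open>\<psi>\<close> identifies the subsets of \<open>{..<n}\<close> with the
    interval from \<open>A\<close> to \<open>B\<close> and respects inclusion, so it carries faces
    to subintervals; \<open>\<phi>\<close> transports it back along \<open>\<sigma>\<close>.\<close>
  define \<psi> where "\<psi> S = A \<union> e ` S" for S
  have e_in: "e i \<in> B" "e i \<notin> A" if "i < n" for i using e that unfolding bij_betw_def by auto
  have e_inj: "i = j" if "e i = e j" "i < n" "j < n" for i j
    using e that unfolding bij_betw_def inj_on_def by auto
  have mono: "\<psi> S \<subseteq> \<psi> T \<longleftrightarrow> S \<subseteq> T" if ST: "S \<subseteq> {..<n}" "T \<subseteq> {..<n}" for S T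
  proof
    assume sub: "\<psi> S \<subseteq> \<psi> T"
    show "S \<subseteq> T"
    proof
      fix i assume i: "i \<in> S"
      then have "i < n" using ST by auto
      then have "e i \<in> e ` T" using sub e_in(2) i unfolding \<psi>_def by blast
      then obtain j where "j \<in> T" "e i = e j" by blast
      then show "i \<in> T" using e_inj[of i j] ST \<open>i < n\<close> by auto
    qed
  qed (auto simp: \<psi>_def)
  have range: "A \<subseteq> \<psi> S" "\<psi> S \<subseteq> B" if "S \<subseteq> {..<n}" for S
    using that e_in Y(2) unfolding \<psi>_def by auto
  have surj: "\<exists>S\<subseteq>{..<n}. U = \<psi> S" if "A \<subseteq> U" "U \<subseteq> B" for U
  proof (intro exI conjI)
    have "B - A = e ` {..<n}" using e unfolding bij_betw_def by simp
    then show "U = \<psi> {i. i < n \<and> e i \<in> U}" using that unfolding \<psi>_def by auto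
  qed auto
  have im: "\<psi> ` {S. C \<subseteq> S \<and> S \<subseteq> D} = {U. \<psi> C \<subseteq> U \<and> U \<subseteq> \<psi> D}" if "C \<subseteq> D" "D \<subseteq> {..<n}" for C D
  proof (intro equalityI subsetI)
    fix U assume "U \<in> \<psi> ` {S. C \<subseteq> S \<and> S \<subseteq> D}"
    then show "U \<in> {U. \<psi> C \<subseteq> U \<and> U \<subseteq> \<psi> D}" unfolding \<psi>_def by auto
  next
    fix U assume U: "U \<in> {U. \<psi> C \<subseteq> U \<and> U \<subseteq> \<psi> D}"
    have "C \<subseteq> {..<n}" using that by blast
    then have "A \<subseteq> U" "U \<subseteq> B" using U range(1)[of C] range(2)[of D] that(2) by blast+
    then obtain S where S: "S \<subseteq> {..<n}" "U = \<psi> S" using surj by blast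
    then have "C \<subseteq> S" "S \<subseteq> D" using U mono that by auto
    then show "U \<in> \<psi> ` {S. C \<subseteq> S \<and> S \<subseteq> D}" using S by blast
  qed
  have bij_\<psi>: "bij_betw \<psi> (Pow {..<n}) (\<sigma> ` Y)"
    unfolding bij_betw_def
  proof
    show "inj_on \<psi> (Pow {..<n})"
    proof (rule inj_onI)
      fix S T assume "S \<in> Pow {..<n}" "T \<in> Pow {..<n}" "\<psi> S = \<psi> T"
      then show "S = T" using mono[of S T] mono[of T S] by auto
    qed
    show "\<psi> ` Pow {..<n} = \<sigma> ` Y" unfolding Y(4)
    proof (intro equalityI subsetI)
      fix U assume "U \<in> {S. A \<subseteq> S \<and> S \<subseteq> B}"
      then obtain S where "S \<subseteq> {..<n}" "U = \<psi> S" using surj[of U] by auto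
      then show "U \<in> \<psi> ` Pow {..<n}" by blast
    qed (use range in auto)
  qed
  have inj_Y: "inj_on \<sigma> Y" using inj Y(1) inj_on_subset by blast
  define \<phi> where "\<phi> = inv_into Y \<sigma> \<circ> \<psi>"
  have bij_\<phi>: "bij_betw \<phi> (Pow {..<n}) Y"
    unfolding \<phi>_def using bij_\<psi> bij_betw_inv_into[OF inj_on_imp_bij_betw[OF inj_Y]]
    by (rule bij_betw_trans)
  have \<sigma>\<phi>: "\<sigma> (\<phi> S) = \<psi> S" if "S \<subseteq> {..<n}" for S
    using that bij_\<psi> unfolding \<phi>_def bij_betw_def by (auto intro!: f_inv_into_f)
  have face: "\<phi> ` {S. C \<subseteq> S \<and> S \<subseteq> D} \<subseteq> Y"
    "\<sigma> ` \<phi> ` {S. C \<subseteq> S \<and> S \<subseteq> D} = {U. \<psi> C \<subseteq> U \<and> U \<subseteq> \<psi> D}" if "C \<subseteq> D" "D \<subseteq> {..<n}" for C D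
  proof -
    have "{S. C \<subseteq> S \<and> S \<subseteq> D} \<subseteq> Pow {..<n}" using that by auto
    then show "\<phi> ` {S. C \<subseteq> S \<and> S \<subseteq> D} \<subseteq> Y" using bij_\<phi> unfolding bij_betw_def by blast
    have "\<sigma> ` \<phi> ` {S. C \<subseteq> S \<and> S \<subseteq> D} = \<psi> ` {S. C \<subseteq> S \<and> S \<subseteq> D}"
      unfolding image_image using \<sigma>\<phi> that by (intro image_cong) auto
    then show "\<sigma> ` \<phi> ` {S. C \<subseteq> S \<and> S \<subseteq> D} = {U. \<psi> C \<subseteq> U \<and> U \<subseteq> \<psi> D}" using im that by simp
  qed
  have "{R \<in> cubes. R \<subseteq> Y} = {\<phi> ` {S. C \<subseteq> S \<and> S \<subseteq> D} | C D. C \<subseteq> D \<and> D \<subseteq> {..<n}}"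
  proof (intro equalityI subsetI)
    fix R assume "R \<in> {R \<in> cubes. R \<subseteq> Y}"
    then have R: "R \<in> cubes" "R \<subseteq> Y" by auto
    obtain C' D' where CD': "C' \<subseteq> D'" "\<sigma> ` R = {S. C' \<subseteq> S \<and> S \<subseteq> D'}" by (rule cubesE[OF R(1)])
    have "C' \<in> \<sigma> ` R" "D' \<in> \<sigma> ` R" unfolding CD'(2) using CD'(1) by simp_all
    then have "C' \<in> \<sigma> ` Y" "D' \<in> \<sigma> ` Y" using R(2) by blast+
    then have "A \<subseteq> C'" "D' \<subseteq> B" unfolding Y(4) by simp_all
    then have "C' \<subseteq> B" "A \<subseteq> D'" using CD'(1) by blast+
    obtain C where C: "C \<subseteq> {..<n}" "C' = \<psi> C" using surj[OF \<open>A \<subseteq> C'\<close> \<open>C' \<subseteq> B\<close>] by blast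
    obtain D where D: "D \<subseteq> {..<n}" "D' = \<psi> D" using surj[OF \<open>A \<subseteq> D'\<close> \<open>D' \<subseteq> B\<close>] by blast
    note CD = C(1) D(1) C(2) D(2)
    have sub: "C \<subseteq> D" using mono[OF CD(1,2)] CD'(1) CD(3,4) by simp
    have "\<sigma> ` R = \<sigma> ` \<phi> ` {S. C \<subseteq> S \<and> S \<subseteq> D}" using face(2)[OF sub CD(2)] CD CD' by simp
    then have "R = \<phi> ` {S. C \<subseteq> S \<and> S \<subseteq> D}"
      using inj_on_image_eq_iff[OF inj_Y R(2) face(1)[OF sub CD(2)]] by simp
    then show "R \<in> {\<phi> ` {S. C \<subseteq> S \<and> S \<subseteq> D} | C D. C \<subseteq> D \<and> D \<subseteq> {..<n}}" using sub CD(2) by blast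
  next
    fix R assume "R \<in> {\<phi> ` {S. C \<subseteq> S \<and> S \<subseteq> D} | C D. C \<subseteq> D \<and> D \<subseteq> {..<n}}"
    then obtain C D where R: "R = \<phi> ` {S. C \<subseteq> S \<and> S \<subseteq> D}" "C \<subseteq> D" "D \<subseteq> {..<n}"
      by (elim CollectE exE conjE)
    have "R \<in> cubes"
    proof (rule cubesI)
      show "\<sigma> ` R = {U. \<psi> C \<subseteq> U \<and> U \<subseteq> \<psi> D}" using face(2)[OF R(2,3)] R(1) by simp
      show "R \<subseteq> M" using face(1)[OF R(2,3)] R(1) Y(1) by blast
      show "\<psi> C \<subseteq> \<psi> D" using R(2) unfolding \<psi>_def by blast
      show "finite (\<psi> D - \<psi> C)"
      proof (rule finite_subset)
        show "\<psi> D - \<psi> C \<subseteq> e ` D" unfolding \<psi>_def by blast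
        show "finite (e ` D)" using R(3) finite_subset by blast
      qed
    qed
    then show "R \<in> {R \<in> cubes. R \<subseteq> Y}" using face(1)[OF R(2,3)] R(1) by simp
  qed
  then show ?thesis unfolding is_cube_def n_def[symmetric] using bij_\<phi> by (intro exI conjI)
qed

lemma cube_complex_cubes: "cube_complex cubes"
  unfolding cube_complex_def
proof (intro conjI ballI impI)
  fix Q assume "Q \<in> cubes"
  then show "\<exists>n. is_cube cubes n Q"
    by (rule cubesE) (rule exI, rule chart)
next
  fix Q R assume QR: "Q \<in> cubes" "R \<in> cubes" "Q \<inter> R \<noteq> {}"
  obtain A B where Q: "Q \<subseteq> M" "A \<subseteq> B" "finite (B - A)" "\<sigma> ` Q = {S. A \<subseteq> S \<and> S \<subseteq> B}"
    by (rule cubesE[OF QR(1)])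
  obtain C D where R: "R \<subseteq> M" "C \<subseteq> D" "finite (D - C)" "\<sigma> ` R = {S. C \<subseteq> S \<and> S \<subseteq> D}"
    by (rule cubesE[OF QR(2)])
  have im: "\<sigma> ` (Q \<inter> R) = {S. A \<union> C \<subseteq> S \<and> S \<subseteq> B \<inter> D}"
    unfolding inj_on_image_Int[OF inj Q(1) R(1)] Q(4) R(4) by blast
  show "Q \<inter> R \<in> cubes"
  proof (rule cubesI)
    have "\<sigma> ` (Q \<inter> R) \<noteq> {}" using QR(3) by simp
    then show "A \<union> C \<subseteq> B \<inter> D" unfolding im by blast
    show "finite (B \<inter> D - (A \<union> C))" by (rule finite_subset[OF _ Q(3)]) blast
  qed (use Q(1) im in auto)
qed

text \<open>The edge from \<open>v\<close> to \<open>t\<close> in \<open>T\<close> crosses the wall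
  \<open>\<iota> t\<close>. The required cube exists once every subset \<open>J\<close> of these
  walls can be crossed from \<open>v\<close> within \<open>M\<close>. For at most two walls this
  follows from the hypothesis on pairs; for more, take the majority of three points that each cross
  one wall fewer.\<close>

lemma flag_link:
  assumes "v \<in> M" shows "flag_complex (link cubes v)"
  unfolding flag_complex_def
proof (intro allI impI)
  fix T assume T: "finite T \<and> T \<noteq> {} \<and> (\<forall>x\<in>T. \<forall>y\<in>T. {x, y} \<in> link cubes v)"
  have pair: "\<exists>Q\<in>cubes. v \<in> Q \<and> {x, y} = {w \<in> Q. (v, w) \<in> adjacent cubes}" if "x \<in> T" "y \<in> T" for x y
    using T that unfolding link_def by blast
  have adj: "(v, t) \<in> adjacent cubes" if "t \<in> T" for t using pair[OF that that] by blast
  then have "\<forall>t\<in>T. \<exists>i. \<sigma> t = flip i (\<sigma> v)" and TM: "T \<subseteq> M" using adjacent_cubes_iff by blast+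
  then obtain \<iota> where \<iota>: "\<And>t. t \<in> T \<Longrightarrow> \<sigma> t = flip (\<iota> t) (\<sigma> v)" by metis
  define toggle where "toggle J = {k. k \<in> \<sigma> v \<longleftrightarrow> k \<notin> J}" for J
  have small: "toggle J \<in> \<sigma> ` M" if ij: "i \<in> \<iota> ` T" "j \<in> \<iota> ` T" "J = {i, j}" for i j J
  proof -
    obtain s t where st: "s \<in> T" "i = \<iota> s" "t \<in> T" "j = \<iota> t" using ij by blast
    obtain Q where Q: "Q \<in> cubes" "v \<in> Q" "{s, t} = {w \<in> Q. (v, w) \<in> adjacent cubes}"
      using pair[OF st(1,3)] by blast
    obtain A B where AB: "Q \<subseteq> M" "\<sigma> ` Q = {S. A \<subseteq> S \<and> S \<subseteq> B}" by (rule cubesE[OF Q(1)])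
    have "{s, t} \<subseteq> Q" unfolding Q(3) by blast
    then have "{\<sigma> v, \<sigma> s, \<sigma> t} \<subseteq> \<sigma> ` Q" using Q(2) by blast
    then have "A \<subseteq> \<sigma> v" "\<sigma> v \<subseteq> B" "A \<subseteq> flip i (\<sigma> v)" "flip i (\<sigma> v) \<subseteq> B"
      "A \<subseteq> flip j (\<sigma> v)" "flip j (\<sigma> v) \<subseteq> B"
      unfolding AB(2) using \<iota> st by auto
    then have "A \<subseteq> toggle J" "toggle J \<subseteq> B"
      unfolding toggle_def subset_iff mem_flip mem_Collect_eq ij(3) insert_iff empty_iff by metis+
    then have "toggle J \<in> \<sigma> ` Q" unfolding AB(2) by simp
    then show ?thesis using AB(1) by blast
  qed
  have toggle: "toggle J \<in> \<sigma> ` M" if "J \<subseteq> \<iota> ` T" for J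
    using that
  proof (induction "card J" arbitrary: J rule: less_induct)
    case less
    have finJ: "finite J" using less.prems T finite_subset by blast
    show ?case
    \<comment> \<open>As \<open>i = j\<close> is allowed, this covers the sets with one or two
      elements.\<close>
    proof (cases "\<exists>i j. J \<subseteq> {i, j} \<and> i \<in> J \<and> j \<in> J")
      case True
      then obtain i j where "J = {i, j}" "i \<in> J" "j \<in> J" by blast
      then show ?thesis using small[of i j J] less.prems by auto
    next
      case False
      show ?thesis
      proof (cases "J = {}")
        case True
        then have "toggle J = \<sigma> v" unfolding toggle_def by auto
        then show ?thesis using assms by simp
      next
        case nonempty: False
        then obtain i where i: "i \<in> J" by blast
        obtain j where j: "j \<in> J" "j \<noteq> i" using False i by blast
        obtain k where k: "k \<in> J" "k \<noteq> i" "k \<noteq> j" using False i j by blast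
        have rem: "toggle (J - {l}) \<in> \<sigma> ` M" if "l \<in> J" for l
          using less.hyps[OF card_Diff1_less[OF finJ that]] less.prems by blast
        obtain x y z where xyz: "x \<in> M" "y \<in> M" "z \<in> M" "toggle (J - {i}) = \<sigma> x"
          "toggle (J - {j}) = \<sigma> y" "toggle (J - {k}) = \<sigma> z"
          using rem[OF i] rem[OF j(1)] rem[OF k(1)] by blast
        obtain m where m: "m \<in> M" "\<sigma> m = \<sigma> x \<inter> \<sigma> y \<union> \<sigma> y \<inter> \<sigma> z \<union> \<sigma> x \<inter> \<sigma> z"
          using majority xyz(1-3) by blast
        \<comment> \<open>A wall in \<open>J\<close> is missing from at most one of the three
          smaller sets, so the majority crosses it; a wall outside \<open>J\<close> is crossed by
          none of the three points.\<close>
        have "toggle J = \<sigma> m"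
          unfolding m(2) xyz(4-6)[symmetric] toggle_def set_eq_iff Un_iff Int_iff mem_Collect_eq
            Diff_iff singleton_iff using j k by metis
        then show ?thesis using m(1) by simp
      qed
    qed
  qed
  define Q where "Q = {y \<in> M. \<sigma> v - \<iota> ` T \<subseteq> \<sigma> y \<and> \<sigma> y \<subseteq> \<sigma> v \<union> \<iota> ` T}"
  have QM: "Q \<subseteq> M" unfolding Q_def by blast
  have "Q \<in> cubes"
  proof (rule cubesI[OF QM])
    show "\<sigma> ` Q = {S. \<sigma> v - \<iota> ` T \<subseteq> S \<and> S \<subseteq> \<sigma> v \<union> \<iota> ` T}"
    proof (intro equalityI subsetI)
      fix S assume S: "S \<in> {S. \<sigma> v - \<iota> ` T \<subseteq> S \<and> S \<subseteq> \<sigma> v \<union> \<iota> ` T}"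
      define J where "J = {k. k \<in> \<sigma> v \<longleftrightarrow> k \<notin> S}"
      have "J \<subseteq> \<iota> ` T" using S unfolding J_def by blast
      then have "toggle J \<in> \<sigma> ` M" by (rule toggle)
      moreover have "toggle J = S" unfolding toggle_def J_def by blast
      ultimately obtain y where "y \<in> M" "\<sigma> y = S" by blast
      then show "S \<in> \<sigma> ` Q" using S unfolding Q_def by blast
    qed (auto simp: Q_def)
    show "finite (\<sigma> v \<union> \<iota> ` T - (\<sigma> v - \<iota> ` T))"
      by (rule finite_subset[of _ "\<iota> ` T"]) (use T in auto)
  qed blast
  moreover have "v \<in> Q" using assms unfolding Q_def by blast
  moreover have "T = {w \<in> Q. (v, w) \<in> adjacent cubes}"
  proof (intro equalityI subsetI)
    fix t assume t: "t \<in> T"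
    have "t \<in> Q" using \<iota>[OF t] t TM unfolding Q_def by (auto simp: mem_flip)
    then show "t \<in> {w \<in> Q. (v, w) \<in> adjacent cubes}" using adj[OF t] by simp
  next
    fix w assume w: "w \<in> {w \<in> Q. (v, w) \<in> adjacent cubes}"
    then obtain i where i: "\<sigma> w = flip i (\<sigma> v)" using adjacent_cubes_iff by blast
    have "\<sigma> v - \<iota> ` T \<subseteq> \<sigma> w" "\<sigma> w \<subseteq> \<sigma> v \<union> \<iota> ` T" using w unfolding Q_def by auto
    then have "i \<in> \<iota> ` T" using i mem_flip[of i i "\<sigma> v"] by blast
    then obtain t where t: "t \<in> T" "i = \<iota> t" by blast
    then have "\<sigma> w = \<sigma> t" using \<iota> i by simp
    then have "w = t" using inj w QM t TM unfolding inj_on_def by blast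
    then show "w \<in> T" using t by simp
  qed
  ultimately show "T \<in> link cubes v" unfolding link_def by blast
qed

lemma connected_cubes: "connected_graph (vertices cubes) (adjacent cubes)"
  unfolding connected_graph_def vertices_cubes
proof clarify
  fix x y assume "x \<in> M" "y \<in> M"
  then show "(x, y) \<in> (adjacent cubes)\<^sup>*"
  proof (induction "card (diff y x)" arbitrary: x rule: less_induct)
    case less
    show ?case
    proof (cases "x = y")
      case False
      then obtain z i where z: "z \<in> M" "i \<in> \<sigma> x \<longleftrightarrow> i \<notin> \<sigma> y" "\<sigma> z = flip i (\<sigma> x)"
        using flip_towards[OF less.prems] by blast
      have "i \<in> diff y x" using z(2) unfolding diff_def by auto
      then have "diff y z = diff y x - {i}" using diff_flip[OF z(3), of y] by (simp add: flip_def)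
      then have "card (diff y z) < card (diff y x)"
        using card_Diff1_less[OF finite_diff'[OF less.prems(2,1)] \<open>i \<in> diff y x\<close>] by simp
      then have "(z, y) \<in> (adjacent cubes)\<^sup>*" using less.hyps z(1) less.prems(2) by blast
      moreover have "(x, z) \<in> adjacent cubes" using z less.prems adjacent_cubes_iff by blast
      ultimately show ?thesis by (rule converse_rtrancl_into_rtrancl[rotated])
    qed simp
  qed
qed

lemma card_diff_flip:
  assumes "x \<in> M" "y \<in> M" "z \<in> M" "\<sigma> z = flip i (\<sigma> y)"
  shows "if i \<in> diff x y then card (diff x y) = Suc (card (diff x z))
         else card (diff x z) = Suc (card (diff x y))"
proof (cases "i \<in> diff x y")
  case True
  then have "diff x z = diff x y - {i}" using diff_flip[OF assms(4), of x] by (simp add: flip_def)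
  then show ?thesis using True card.remove[OF finite_diff'[OF assms(1,2)] True] by simp
next
  case False
  then show ?thesis
    using diff_flip[OF assms(4), of x] finite_diff'[OF assms(1,2)] by (simp add: flip_def)
qed

text \<open>The height of a vertex is the number of walls between it and the base point
  \<open>o'\<close>. A loop with more than one vertex has a peak \<open>b\<close> between lower
  vertices \<open>a\<close> and \<open>c\<close>. If these coincide, the peak is a backtrack;
  otherwise it is pushed across the square whose fourth corner \<open>e\<close> is the median of
  \<open>a\<close>, \<open>c\<close> and \<open>o'\<close>. Both moves lower the total
  height.\<close>

lemma null_homotopic:
  assumes "edge_path cubes p" "hd p = o'" "last p = o'"
  shows "equivclp (elementary_homotopy cubes) p [o']"
  using assms
proof (induction "\<Sum>x\<leftarrow>p. card (diff o' x)" arbitrary: p rule: less_induct)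
  case less
  let ?f = "\<lambda>x. card (diff o' x)"
  have p: "p \<noteq> []" "set p \<subseteq> M" "successively (\<lambda>u v. (u, v) \<in> adjacent cubes) p"
    using less.prems(1) unfolding edge_path_def vertices_cubes by auto
  have oM: "o' \<in> M" using p less.prems(2) by (metis hd_in_set subsetD)
  have edge: "?f v = Suc (?f u) \<or> ?f u = Suc (?f v)" if uv: "(u, v) \<in> adjacent cubes" for u v
  proof -
    obtain i where "u \<in> M" "v \<in> M" "\<sigma> v = flip i (\<sigma> u)" using uv adjacent_cubes_iff by blast
    then show ?thesis using card_diff_flip[OF oM, of u v i] by presburger
  qed
  have f0: "?f o' = 0" unfolding diff_def by simp
  show ?case
  proof (cases "\<exists>b q. p = o' # b # q")
    case False
    then have "p = [o']" using p(1) less.prems(2) by (cases p; cases "tl p") auto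
    then show ?thesis by simp
  next
    case True
    then obtain b0 q where bq: "p = o' # b0 # q" by blast
    have "?f b0 = Suc (?f o')" using edge[of o' b0] p(3) bq f0 by simp
    moreover have "successively (\<lambda>x y. ?f y = Suc (?f x) \<or> ?f x = Suc (?f y)) (o' # b0 # q)"
      using p(3) unfolding bq by (rule successively_mono) (use edge in blast)
    moreover have "?f (last (b0 # q)) \<le> ?f o'" using less.prems(3) bq f0 by simp
    ultimately obtain p1 a b c p2 where abc: "o' # b0 # q = p1 @ [a, b, c] @ p2"
      "?f b = Suc (?f a)" "?f b = Suc (?f c)"
      using list_peak[of ?f o' b0 q] by blast
    have peq: "p = p1 @ [a, b, c] @ p2" using abc(1) bq by simp
    have M: "a \<in> M" "b \<in> M" "c \<in> M" using p(2) unfolding peq by auto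
    have ab: "(b, a) \<in> adjacent cubes" and bc: "(b, c) \<in> adjacent cubes"
      using p(3) unfolding peq by (auto simp: successively_append_iff adjacent_sym)
    obtain i where i: "\<sigma> a = flip i (\<sigma> b)" using ab adjacent_cubes_iff by blast
    obtain j where j: "\<sigma> c = flip j (\<sigma> b)" using bc adjacent_cubes_iff by blast
    have idiff: "i \<in> diff o' b" using card_diff_flip[OF oM M(2,1) i] abc(2) by presburger
    have jdiff: "j \<in> diff o' b" using card_diff_flip[OF oM M(2,3) j] abc(3) by presburger
    have ends: "hd (p1 @ [a] @ r @ [c] @ p2) = o'" "last (p1 @ [a] @ r @ [c] @ p2) = o'" for r
      using less.prems(2,3) unfolding peq by (auto simp: hd_append)
    show ?thesis
    proof (cases "i = j")
      case True
      then have ac: "a = c" using i j inj M by (simp add: inj_on_def)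
      let ?p' = "p1 @ [a] @ p2"
      have "elementary_homotopy cubes p ?p'"
        unfolding peq ac using bc adjacent_sym elementary_homotopy.backtrack by metis
      moreover have "equivclp (elementary_homotopy cubes) ?p' [o']"
      proof (rule less.hyps)
        show "edge_path cubes ?p'" using p unfolding peq edge_path_def vertices_cubes ac
          by (auto simp: successively_append_iff successively_Cons)
        show "hd ?p' = o'" "last ?p' = o'" using less.prems(2,3) unfolding peq ac by (auto simp: hd_append)
      qed (simp add: peq abc(2))
      ultimately show ?thesis by (meson equivclp_trans r_into_equivclp)
    next
      case False
      obtain e where e: "e \<in> M" "\<sigma> e = \<sigma> a \<inter> \<sigma> c \<union> \<sigma> c \<inter> \<sigma> o' \<union> \<sigma> a \<inter> \<sigma> o'"
        using majority[OF M(1,3) oM] by blast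
      \<comment> \<open>Both \<open>i\<close> and \<open>j\<close> separate \<open>b\<close> from
        \<open>o'\<close>, and each has been crossed by one of \<open>a\<close> and
        \<open>c\<close>; with \<open>o'\<close> this makes a majority for crossing both.\<close>
      have e': "\<sigma> e = flip j (flip i (\<sigma> b))"
        unfolding e(2) i j set_eq_iff Un_iff Int_iff mem_flip
        using idiff jdiff False unfolding diff_def mem_Collect_eq by metis
      have ae: "(a, e) \<in> adjacent cubes" using e(1) e' i M adjacent_cubes_iff by metis
      have ec: "(c, e) \<in> adjacent cubes" using e(1) e' j M adjacent_cubes_iff flip_commute by metis
      have sq: "{a, b, c, e} \<in> cubes"
      proof (rule cubesI)
        show "\<sigma> ` {a, b, c, e} = {S. \<sigma> b - {i, j} \<subseteq> S \<and> S \<subseteq> insert i (insert j (\<sigma> b))}"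
          unfolding interval_flip2 using i j e' by auto
        show "finite (insert i (insert j (\<sigma> b)) - (\<sigma> b - {i, j}))"
          by (rule finite_subset[of _ "{i, j}"]) auto
      qed (use M e in auto)
      have ac: "a \<noteq> c" using i j False flip_eq_iff by metis
      have fe: "?f a = Suc (?f e)"
      proof -
        have "j \<in> diff o' a" using diff_flip[OF i, of o'] jdiff False by (simp add: mem_flip)
        moreover have "\<sigma> e = flip j (\<sigma> a)" using e' i by simp
        ultimately show ?thesis using card_diff_flip[OF oM M(1) e(1)] by presburger
      qed
      have "b \<noteq> e" using fe abc(2) by auto
      moreover have "a \<noteq> b" "b \<noteq> c" "a \<noteq> e" "c \<noteq> e" using ab bc ae ec unfolding adjacent_def by auto
      ultimately have dist: "distinct [a, b, c, e]" using ac by simp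
      let ?p' = "p1 @ [a, e, c] @ p2"
      have "elementary_homotopy cubes p ?p'"
        unfolding peq using sq dist adjacent_sym[OF ab] bc ae adjacent_sym[OF ec]
        by (rule elementary_homotopy.square)
      moreover have "equivclp (elementary_homotopy cubes) ?p' [o']"
      proof (rule less.hyps)
        show "edge_path cubes ?p'" using p e(1) ae adjacent_sym[OF ec]
          unfolding peq edge_path_def vertices_cubes
          by (auto simp: successively_append_iff successively_Cons)
        show "hd ?p' = o'" "last ?p' = o'" using ends[of "[e]"] by simp_all
      qed (simp add: peq abc(2) fe)
      ultimately show ?thesis by (meson equivclp_trans r_into_equivclp)
    qed
  qed
qed

theorem CAT0_cubes: "CAT0_cube_complex cubes"
  unfolding CAT0_cube_complex_def simply_connected_complex_def vertices_cubes
  using cube_complex_cubes connected_cubes[unfolded vertices_cubes] flag_link null_homotopic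
  by simp

end

context quadrangle_graph
begin

section \<open>Hulls and iterated medians\<close>

text \<open>Pairs of halfspaces occur because the majority operation preserves every condition on
  two coordinates; \<open>H = H'\<close> covers single halfspaces.\<close>

definition median_hull :: "'a set \<Rightarrow> 'a set" where
  "median_hull A = {x \<in> V. \<forall>H\<in>halfspaces. \<forall>H'\<in>halfspaces. x \<in> H \<and> x \<in> H' \<longrightarrow> (\<exists>a\<in>A. a \<in> H \<and> a \<in> H')}"

lemma hull_sub_V: "median_hull A \<subseteq> V"
  unfolding median_hull_def by blast

lemma sub_hull: "A \<subseteq> V \<Longrightarrow> A \<subseteq> median_hull A"
  unfolding median_hull_def by blast

lemma median_hullD:
  "x \<in> median_hull A \<Longrightarrow> H \<in> halfspaces \<Longrightarrow> H' \<in> halfspaces \<Longrightarrow> x \<in> H \<Longrightarrow> x \<in> H' \<Longrightarrow>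
    \<exists>a\<in>A. a \<in> H \<and> a \<in> H'"
  unfolding median_hull_def by simp

text \<open>Each of \<open>H\<close> and \<open>H'\<close> contains at least two of the three
  points, so one of the points lies in both.\<close>

lemma med_in_hull:
  assumes "x \<in> median_hull A" "y \<in> median_hull A" "z \<in> median_hull A" shows "med x y z \<in> median_hull A"
proof -
  have V: "x \<in> V" "y \<in> V" "z \<in> V" using assms hull_sub_V by auto
  have "\<exists>a\<in>A. a \<in> H \<and> a \<in> H'"
    if H: "H \<in> halfspaces" "H' \<in> halfspaces" "med x y z \<in> H" "med x y z \<in> H'" for H H'
  proof -
    have "x \<in> H \<and> x \<in> H' \<or> y \<in> H \<and> y \<in> H' \<or> z \<in> H \<and> z \<in> H'"
      using H(3,4) unfolding med_in_halfspace[OF H(1) V] med_in_halfspace[OF H(2) V] by blast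
    then show ?thesis
      using median_hullD[OF assms(1) H(1,2)] median_hullD[OF assms(2) H(1,2)]
        median_hullD[OF assms(3) H(1,2)] by blast
  qed
  then show ?thesis using med_in_V[OF V] unfolding median_hull_def by blast
qed

lemma med_refl: "x \<in> V \<Longrightarrow> y \<in> V \<Longrightarrow> med x y x = x" "x \<in> V \<Longrightarrow> y \<in> V \<Longrightarrow> med x y y = y"
  by (rule med_between; simp)+

primrec meds :: "'a set \<Rightarrow> nat \<Rightarrow> 'a set" where
  "meds A 0 = A"
| "meds A (Suc n) = {med x y z | x y z. x \<in> meds A n \<and> y \<in> meds A n \<and> z \<in> meds A n}"

lemma meds_sub_V: "A \<subseteq> V \<Longrightarrow> meds A n \<subseteq> V"
  by (induction n) (auto intro: med_in_V)

lemma meds_mono: assumes "A \<subseteq> V" "k \<le> n" shows "meds A k \<subseteq> meds A n"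
proof (rule lift_Suc_mono_le[OF _ assms(2)])
  fix n show "meds A n \<subseteq> meds A (Suc n)"
  proof
    fix x assume x: "x \<in> meds A n"
    then have "med x x x = x" using meds_sub_V[OF assms(1)] med_refl(1) by blast
    then show "x \<in> meds A (Suc n)" using x by force
  qed
qed

text \<open>A Helly-type argument: three points that each miss at most one halfspace, distinct for the three
  points, have their median in all halfspaces.\<close>

lemma hull_helly:
  assumes "x \<in> median_hull A" "A \<subseteq> V" "A \<noteq> {}" "finite \<H>" "\<H> \<subseteq> halfspaces" "\<And>H. H \<in> \<H> \<Longrightarrow> x \<in> H"
    and "card \<H> \<le> k + 2"
  shows "\<exists>p\<in>meds A k. \<forall>H\<in>\<H>. p \<in> H"
  using assms(4-)
proof (induction k arbitrary: \<H>)
  case 0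
  \<comment> \<open>Two halfspaces through \<open>x\<close> share a point of \<open>A\<close> by the
    definition of the hull, whence the 2 in \<open>k + 2\<close>; each further halfspace costs one
    round of medians.\<close>
  have pair: "\<exists>p\<in>A. p \<in> H \<and> p \<in> H'" if "H \<in> \<H>" "H' \<in> \<H>" for H H'
    using median_hullD[OF assms(1)] 0(2,3) that by (meson subsetD)
  consider "card \<H> = 0" | "card \<H> = 1" | "card \<H> = 2" using 0(4) by linarith
  then show ?case
  proof cases
    case 1 then show ?thesis using assms(3) 0(1) by auto
  next
    case 2
    then obtain H where "\<H> = {H}" by (rule card_1_singletonE)
    then show ?thesis using pair[of H H] by auto
  next
    case 3
    then obtain H H' where "\<H> = {H, H'}" by (auto simp: card_2_iff)
    then show ?thesis using pair[of H H'] by auto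
  qed
next
  case (Suc k)
  show ?case
  proof (cases "card \<H> \<le> k + 2")
    case True
    then obtain p where "p \<in> meds A k" "\<forall>H\<in>\<H>. p \<in> H"
      using Suc.IH[of \<H>] Suc.prems(1-3) by blast
    moreover have "meds A k \<subseteq> meds A (Suc k)" by (rule meds_mono[OF assms(2)]) simp
    ultimately show ?thesis by blast
  next
    case False
    then have "3 \<le> card \<H>" by simp
    then obtain S where S: "S \<subseteq> \<H>" "card S = 3" using obtain_subset_with_card_n by metis
    then obtain H1 H2 H3 where H: "S = {H1, H2, H3}" "H1 \<noteq> H2" "H2 \<noteq> H3" "H1 \<noteq> H3"
      by (auto simp: card_3_iff)
    have rem: "\<exists>p\<in>meds A k. \<forall>H\<in>\<H> - {H'}. p \<in> H" if "H' \<in> \<H>" for H'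
    proof (rule Suc.IH)
      show "card (\<H> - {H'}) \<le> k + 2"
        using card_Diff_singleton[OF that] Suc.prems(4) by simp
    qed (use Suc.prems in auto)
    have sub: "H1 \<in> \<H>" "H2 \<in> \<H>" "H3 \<in> \<H>" using S(1) H(1) by auto
    obtain p1 where p1: "p1 \<in> meds A k" "\<forall>H\<in>\<H> - {H1}. p1 \<in> H" using rem[OF sub(1)] by blast
    obtain p2 where p2: "p2 \<in> meds A k" "\<forall>H\<in>\<H> - {H2}. p2 \<in> H" using rem[OF sub(2)] by blast
    obtain p3 where p3: "p3 \<in> meds A k" "\<forall>H\<in>\<H> - {H3}. p3 \<in> H" using rem[OF sub(3)] by blast
    have V: "p1 \<in> V" "p2 \<in> V" "p3 \<in> V" using p1(1) p2(1) p3(1) meds_sub_V[OF assms(2)] by auto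
    have "med p1 p2 p3 \<in> H" if h: "H \<in> \<H>" for H
    proof -
      have "H \<in> halfspaces" using h Suc.prems(2) by blast
      moreover have "p1 \<in> H \<or> H = H1" "p2 \<in> H \<or> H = H2" "p3 \<in> H \<or> H = H3"
        using h p1(2) p2(2) p3(2) by blast+
      ultimately show ?thesis using med_in_halfspace[OF _ V] H(2-4) by metis
    qed
    moreover have "med p1 p2 p3 \<in> meds A (Suc k)" using p1(1) p2(1) p3(1) by auto
    ultimately show ?thesis by blast
  qed
qed

text \<open>Start from any \<open>a\<close> in \<open>A\<close>. Only the at most \<open>N\<close>
  edges at \<open>x\<close> towards \<open>a\<close> bound halfspaces of \<open>x\<close> that
  \<open>a\<close> misses, and Helly gives \<open>p\<close> in all of these; hence \<open>x\<close>
  is between \<open>a\<close> and \<open>p\<close>. A second application, to the edges towards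
  \<open>a\<close> or \<open>p\<close>, gives \<open>q\<close> on the side of \<open>x\<close>
  wherever \<open>a\<close> or \<open>p\<close> is not. Then no edge at \<open>x\<close> leads
  towards the median of \<open>a\<close>, \<open>p\<close> and \<open>q\<close>, which is therefore
  \<open>x\<close>. The depths are \<open>N\<close> for \<open>p\<close>, \<open>2 * N\<close> for
  \<open>q\<close>, and one more for the last median.\<close>

lemma hull_sub_meds:
  assumes N: "\<And>x z T. x \<in> V \<Longrightarrow> z \<in> V \<Longrightarrow> T \<subseteq> {u. (x, u) \<in> E \<and> between x u z} \<Longrightarrow>
      finite T \<and> card T \<le> N"
    and A: "A \<subseteq> V" "A \<noteq> {}"
  shows "median_hull A \<subseteq> meds A (Suc (2 * N))"
proof
  fix x assume x: "x \<in> median_hull A"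
  then have xV: "x \<in> V" using hull_sub_V by blast
  obtain a where a: "a \<in> A" using A(2) by blast
  then have aV: "a \<in> V" using A(1) by blast
  define T where "T z = {u. (x, u) \<in> E \<and> between x u z}" for z
  have T: "finite (T z)" "card (T z) \<le> N" if "z \<in> V" for z
    using N[OF xV that, of "T z"] unfolding T_def by auto
  have helly: "\<exists>p\<in>meds A k. \<forall>H\<in>halfspace x ` S. p \<in> H"
    if "finite S" "S \<subseteq> {u. (x, u) \<in> E}" "card (halfspace x ` S) \<le> k + 2" for S k
  proof (rule hull_helly[OF x A])
    show "halfspace x ` S \<subseteq> halfspaces" using that(2) halfspaceI by blast
    show "x \<in> H" if "H \<in> halfspace x ` S" for H
      using that \<open>S \<subseteq> _\<close> halfspace_ends(1) by blast
  qed (use that in auto)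
  have TE: "T z \<subseteq> {u. (x, u) \<in> E}" for z unfolding T_def by blast
  have "card (halfspace x ` T a) \<le> N + 2" using card_image_le[OF T(1)[OF aV], of "halfspace x"] T(2)[OF aV] by linarith
  then obtain p where p: "p \<in> meds A N" "\<forall>H\<in>halfspace x ` T a. p \<in> H"
    using helly[OF T(1)[OF aV] TE] by blast
  have pV: "p \<in> V" using p(1) meds_sub_V[OF A(1)] by blast
  have TE2: "T a \<union> T p \<subseteq> {u. (x, u) \<in> E}" using TE by blast
  have "card (halfspace x ` (T a \<union> T p)) \<le> card (T a \<union> T p)"
    using T(1)[OF aV] T(1)[OF pV] by (intro card_image_le) simp
  also have "\<dots> \<le> 2 * N + 2" using card_Un_le[of "T a" "T p"] T(2)[OF aV] T(2)[OF pV] by linarith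
  finally obtain q where q: "q \<in> meds A (2 * N)" "\<forall>H\<in>halfspace x ` (T a \<union> T p). q \<in> H"
    using helly[OF finite_UnI[OF T(1)[OF aV] T(1)[OF pV]] TE2] by blast
  have qV: "q \<in> V" using q(1) meds_sub_V[OF A(1)] by blast
  have T_iff: "u \<in> T z \<longleftrightarrow> z \<notin> halfspace x u" if "(x, u) \<in> E" "z \<in> V" for u z
    using that edge_cases[OF that] between_edge[OF that(1), of z] dist_commute[of z x] dist_commute[of z u]
    unfolding T_def halfspace_def mem_Collect_eq by linarith
  have toward: "\<exists>u. (x, u) \<in> E \<and> n \<notin> halfspace x u" if n: "n \<in> V" "n \<noteq> x" for n
  proof -
    obtain u where u: "(x, u) \<in> E" "dist x n = Suc (dist u n)"
      using step_towards[OF xV n(1) n(2)[symmetric]] by blast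
    then have "n \<notin> halfspace x u"
      using dist_commute[of n x] dist_commute[of n u] by (simp add: halfspace_def)
    then show ?thesis using u(1) by blast
  qed
  have "med x a p = x"
  proof (rule ccontr)
    let ?n = "med x a p"
    assume "?n \<noteq> x"
    then obtain u where u: "(x, u) \<in> E" "?n \<notin> halfspace x u" using toward[OF med_in_V[OF xV aV pV]] by blast
    then have "a \<notin> halfspace x u \<and> p \<notin> halfspace x u"
      using med_in_halfspace[OF halfspaceI[OF u(1)] xV aV pV] halfspace_ends(1)[OF u(1)] by blast
    then show False using p(2) T_iff[OF u(1) aV] by blast
  qed
  then have bet: "between a x p" using is_median_med[OF xV aV pV] unfolding is_median_def by metis
  have "med a p q = x"
  proof (rule ccontr)
    let ?n = "med a p q"
    assume "?n \<noteq> x"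
    then obtain u where u: "(x, u) \<in> E" "?n \<notin> halfspace x u" using toward[OF med_in_V[OF aV pV qV]] by blast
    note H = halfspaceI[OF u(1)]
    \<comment> \<open>As \<open>x\<close> is between \<open>a\<close> and \<open>p\<close>, a
      halfspace containing \<open>x\<close> contains one of them; if it misses the other, it
      contains \<open>q\<close> by the choice of \<open>q\<close>.\<close>
    have "a \<in> halfspace x u \<or> p \<in> halfspace x u"
      using halfspace_convex_compl[OF H _ _ xV bet] aV pV halfspace_ends(1)[OF u(1)] by blast
    moreover have "q \<in> halfspace x u" if "a \<notin> halfspace x u \<or> p \<notin> halfspace x u"
      using that q(2) T_iff[OF u(1) aV] T_iff[OF u(1) pV] by blast
    ultimately show False using med_in_halfspace[OF H aV pV qV] u(2) by blast
  qed
  moreover have "a \<in> meds A (2 * N)" "p \<in> meds A (2 * N)"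
    using meds_mono[OF A(1), of 0 "2 * N"] meds_mono[OF A(1), of N "2 * N"] a p(1) by auto
  ultimately show "x \<in> meds A (Suc (2 * N))" using q(1) by force
qed

text \<open>Replacing the arguments by points of \<open>A\<close> within \<open>r\<close> moves the
  median by at most \<open>3 * r\<close>, and the new median is within \<open>D\<close> of
  \<open>A\<close>; so each round of medians turns \<open>r\<close> into
  \<open>3 * r + D\<close>.\<close>

lemma meds_near:
  assumes A: "A \<subseteq> V" and D: "\<And>a b c. a \<in> A \<Longrightarrow> b \<in> A \<Longrightarrow> c \<in> A \<Longrightarrow> \<exists>e\<in>A. dist (med a b c) e \<le> D"
  shows "\<exists>r. \<forall>x\<in>meds A n. \<exists>a\<in>A. dist x a \<le> r"
proof (induction n)
  case 0
  show ?case by (rule exI[of _ 0]) (metis dist_refl le_refl meds.simps(1))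
next
  case (Suc n)
  then obtain r where r: "\<And>x. x \<in> meds A n \<Longrightarrow> \<exists>a\<in>A. dist x a \<le> r" by blast
  have "\<exists>a\<in>A. dist w a \<le> 3 * r + D" if w': "w \<in> meds A (Suc n)" for w
  proof -
    obtain x y z where w: "w = med x y z" "x \<in> meds A n" "y \<in> meds A n" "z \<in> meds A n"
      using w' by auto
    obtain a b c where abc: "a \<in> A" "dist x a \<le> r" "b \<in> A" "dist y b \<le> r" "c \<in> A" "dist z c \<le> r"
      using r w(2-4) by metis
    obtain e where e: "e \<in> A" "dist (med a b c) e \<le> D" using D abc by blast
    have V: "x \<in> V" "y \<in> V" "z \<in> V" "a \<in> V" "b \<in> V" "c \<in> V" "e \<in> V"
      using w(2-4) meds_sub_V[OF A] A abc(1,3,5) e(1) by auto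
    have "dist w e \<le> dist w (med a b c) + dist (med a b c) e"
      using dist_triangle V med_in_V w(1) by simp
    also have "dist w (med a b c) \<le> dist x a + dist y b + dist z c"
      unfolding w(1) using med_lipschitz V by blast
    finally have "dist w e \<le> 3 * r + D" using abc e(2) by linarith
    then show ?thesis using e(1) by blast
  qed
  then show ?case by blast
qed

end

section \<open>The cube complex of a median subalgebra\<close>

locale median_subalgebra = quadrangle_graph +
  fixes M :: "'a set" and base :: 'a
  assumes M_sub: "M \<subseteq> V" and base_in: "base \<in> M"
    and med_closed: "x \<in> M \<Longrightarrow> y \<in> M \<Longrightarrow> z \<in> M \<Longrightarrow> med x y z \<in> M"
begin

text \<open>Of the two sides of a wall, the one missing \<open>base\<close> is taken. Halfspaces
  with equal traces on \<open>M\<close> become one wall, which is how distances can shrink; an empty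
  trace belongs to no \<open>walls_at x\<close>.\<close>

definition walls :: "'a set set" where
  "walls = {H \<inter> M | H. H \<in> halfspaces \<and> base \<notin> H}"

definition walls_at :: "'a \<Rightarrow> 'a set set" where
  "walls_at x = {T \<in> walls. x \<in> T}"

lemma walls_sep:
  assumes "x \<in> M" "y \<in> M" "x \<noteq> y"
  shows "\<exists>T\<in>walls. x \<in> T \<longleftrightarrow> y \<notin> T"
proof -
  obtain H where H: "H \<in> halfspaces" "x \<in> H" "y \<notin> H" using halfspace_separates M_sub assms by blast
  show ?thesis
  proof (cases "base \<in> H")
    case True
    then have "(V - H) \<inter> M \<in> walls" using compl_halfspaces H(1) unfolding walls_def by blast
    then show ?thesis using H assms M_sub by (intro bexI[of _ "(V - H) \<inter> M"]) auto
  next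
    case False
    then have "H \<inter> M \<in> walls" using H(1) unfolding walls_def by blast
    then show ?thesis using H assms by (intro bexI[of _ "H \<inter> M"]) auto
  qed
qed

lemma walls_between:
  assumes "T \<in> walls" "x \<in> M" "q \<in> M" "y \<in> M" "between x q y" "x \<in> T \<longleftrightarrow> y \<in> T"
  shows "q \<in> T \<longleftrightarrow> x \<in> T"
proof -
  obtain H where H: "T = H \<inter> M" "H \<in> halfspaces" using assms(1) unfolding walls_def by blast
  have qV: "q \<in> V" "x \<in> V" "y \<in> V" using assms M_sub by blast+
  show ?thesis
    using halfspace_convex[OF H(2) _ _ qV(1) assms(5)] halfspace_convex_compl[OF H(2) _ _ qV(1) assms(5)]
      qV assms(2-4,6) unfolding H(1) by blast
qed

lemma med_in_wall:
  assumes "T \<in> walls" "x \<in> M" "y \<in> M" "z \<in> M"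
  shows "med x y z \<in> T \<longleftrightarrow> x \<in> T \<and> y \<in> T \<or> y \<in> T \<and> z \<in> T \<or> x \<in> T \<and> z \<in> T"
proof -
  obtain H where H: "T = H \<inter> M" "H \<in> halfspaces" using assms(1) unfolding walls_def by blast
  have V: "x \<in> V" "y \<in> V" "z \<in> V" using assms M_sub by blast+
  show ?thesis unfolding H(1) using med_in_halfspace[OF H(2) V] med_closed assms by blast
qed

lemma walls_at_med:
  assumes "x \<in> M" "y \<in> M" "z \<in> M"
  shows "walls_at (med x y z) =
    walls_at x \<inter> walls_at y \<union> walls_at y \<inter> walls_at z \<union> walls_at x \<inter> walls_at z"
  unfolding walls_at_def using med_in_wall[OF _ assms] by blast

lemma inj_walls_at: "inj_on walls_at M"
proof (rule inj_onI, rule ccontr)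
  fix x y assume "x \<in> M" "y \<in> M" "walls_at x = walls_at y" "x \<noteq> y"
  then show False using walls_sep[of x y] unfolding walls_at_def by blast
qed

text \<open>Take \<open>z\<close> closest to \<open>x\<close> among the points of \<open>M\<close>
  other than \<open>x\<close> between \<open>x\<close> and \<open>y\<close>. No further point of
  \<open>M\<close> is between \<open>x\<close> and \<open>z\<close>, so the projection
  \<open>med x z q\<close> sends every \<open>q\<close> in \<open>M\<close> to \<open>x\<close> or
  \<open>z\<close>. A wall separating these two consists of the points projected to one of them,
  which leaves only one such wall.\<close>

lemma step_in_M:
  assumes "x \<in> M" "y \<in> M" "x \<noteq> y"
  shows "\<exists>z\<in>M. z \<noteq> x \<and> between x z y \<and>
    (\<exists>T\<in>walls. (x \<in> T \<longleftrightarrow> y \<notin> T) \<and> walls_at z = flip T (walls_at x))"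
proof -
  have V: "x \<in> V" "y \<in> V" using assms M_sub by auto
  let ?P = "\<lambda>z. z \<in> M \<and> z \<noteq> x \<and> between x z y"
  have "?P y" using assms by simp
  then obtain z where z: "?P z" "\<And>z'. ?P z' \<Longrightarrow> dist x z \<le> dist x z'"
    using arg_min_natI[of ?P y "dist x"] arg_min_nat_le[of ?P _ "dist x"] by blast
  have zM: "z \<in> M" "z \<in> V" using z(1) M_sub by auto
  have no_mid: "q = x \<or> q = z" if q: "q \<in> M" "between x q z" for q
  proof (rule ccontr)
    assume "\<not> (q = x \<or> q = z)"
    moreover have "q \<in> V" using q M_sub by blast
    moreover have "between x q y" using between_trans(1)[OF _ q(2) V(1,2) zM(2) \<open>q \<in> V\<close>] z(1) by blast
    ultimately have "dist x z \<le> dist x q" "dist q z \<noteq> 0" using z(2) q(1) dist_eq_0 zM(2) by auto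
    then show False using q(2) by simp
  qed
  have proj: "med x z q = x \<or> med x z q = z" if "q \<in> M" for q
  proof -
    have "q \<in> V" using that M_sub by blast
    then have "between x (med x z q) z" using between_med[OF V(1) zM(2)] by simp
    then show ?thesis using no_mid med_closed assms(1) zM(1) that by blast
  qed
  obtain T0 where T0: "T0 \<in> walls" "x \<in> T0 \<longleftrightarrow> z \<notin> T0" using walls_sep assms(1) z(1) by metis
  have wall_proj: "q \<in> T \<longleftrightarrow> med x z q \<in> T" if "T \<in> walls" "x \<in> T \<longleftrightarrow> z \<notin> T" "q \<in> M" for T q
    using med_in_wall[OF that(1) assms(1) zM(1) that(3)] that(2) by blast
  have base_T: "base \<notin> T" if "T \<in> walls" for T using that unfolding walls_def by blast
  have uniq: "T = T0" if T: "T \<in> walls" "x \<in> T \<longleftrightarrow> z \<notin> T" for T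
  proof -
    \<comment> \<open>The base point lies in no wall, so neither does its projection to
      \<open>x\<close> or \<open>z\<close>. Hence both walls contain the same one of these two
      points.\<close>
    have b: "med x z base \<notin> T" "med x z base \<notin> T0"
      using wall_proj[OF T base_in] wall_proj[OF T0 base_in] base_T T(1) T0(1) by blast+
    have "x \<in> T \<longleftrightarrow> x \<in> T0" using proj[OF base_in] b T(2) T0(2) by metis
    moreover from this have "z \<in> T \<longleftrightarrow> z \<in> T0" using T(2) T0(2) by blast
    ultimately have "q \<in> T \<longleftrightarrow> q \<in> T0" if "q \<in> M" for q
      using wall_proj[OF T that] wall_proj[OF T0 that] proj[OF that] by metis
    moreover have "T \<subseteq> M" "T0 \<subseteq> M" using T(1) T0(1) unfolding walls_def by blast+
    ultimately show ?thesis by blast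
  qed
  have "T \<in> walls_at z \<longleftrightarrow> T \<in> flip T0 (walls_at x)" for T
    using uniq[of T] T0 unfolding mem_flip walls_at_def by blast
  then have "walls_at z = flip T0 (walls_at x)" by blast
  moreover have "x \<in> T0 \<longleftrightarrow> y \<notin> T0"
    using walls_between[OF T0(1) assms(1) zM(1) assms(2)] z(1) T0(2) by blast
  ultimately show ?thesis using z(1) T0(1) by blast
qed

sublocale alg: median_algebra M walls_at
proof
  show "inj_on walls_at M" by (rule inj_walls_at)
  show "finite (walls_at x - walls_at y)" if "x \<in> M" "y \<in> M" for x y
  proof (rule finite_subset)
    show "walls_at x - walls_at y \<subseteq> (\<lambda>H. H \<inter> M) ` sep x y"
      using that unfolding walls_at_def walls_def sep_def by blast
    show "finite ((\<lambda>H. H \<inter> M) ` sep x y)" using sep_card that M_sub by blast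
  qed
  show "\<exists>m\<in>M. walls_at m =
      walls_at x \<inter> walls_at y \<union> walls_at y \<inter> walls_at z \<union> walls_at x \<inter> walls_at z"
    if "x \<in> M" "y \<in> M" "z \<in> M" for x y z
    using walls_at_med[OF that] med_closed[OF that] by blast
  show "\<exists>z\<in>M. \<exists>i. (i \<in> walls_at x \<longleftrightarrow> i \<notin> walls_at y) \<and> walls_at z = flip i (walls_at x)"
    if xy: "x \<in> M" "y \<in> M" "x \<noteq> y" for x y
  proof -
    obtain z T where "z \<in> M" "T \<in> walls" "x \<in> T \<longleftrightarrow> y \<notin> T" "walls_at z = flip T (walls_at x)"
      using step_in_M[OF xy] by blast
    then show ?thesis unfolding walls_at_def by blast
  qed
qed

abbreviation "CM \<equiv> alg.cubes"

sublocale sub: connected_simple_graph M "adjacent CM"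
proof -
  interpret cm: cat0_complex CM by standard (rule alg.CAT0_cubes)
  show "connected_simple_graph M (adjacent CM)"
    using cm.connected_simple_graph_axioms unfolding alg.vertices_cubes .
qed

text \<open>Each step towards \<open>y\<close> in \<open>M\<close> costs one edge of the new complex
  and at least one edge of the ambient graph.\<close>

lemma sub_dist_le: "x \<in> M \<Longrightarrow> y \<in> M \<Longrightarrow> sub.dist x y \<le> dist x y"
proof (induction "dist x y" arbitrary: x rule: less_induct)
  case less
  show ?case
  proof (cases "x = y")
    case False
    then obtain z T where z: "z \<in> M" "z \<noteq> x" "between x z y" "walls_at z = flip T (walls_at x)"
      using step_in_M less.prems by blast
    have "(x, z) \<in> adjacent CM" using alg.adjacent_cubes_iff z less.prems by blast
    then have "sub.dist x z = 1" by (rule sub.dist_edge)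
    moreover have "dist x z \<noteq> 0" using dist_eq_0[of x z] z(1,2) less.prems M_sub by blast
    moreover have "sub.dist z y \<le> dist z y" using less.hyps z calculation less.prems(2) by simp
    ultimately show ?thesis
      using sub.dist_triangle[OF less.prems(1) z(1) less.prems(2)] z(3) by simp
  qed simp
qed

text \<open>On every wall but the one crossed by the edge, \<open>x\<close> and \<open>z\<close>
  agree, and so does any \<open>q\<close> between them.\<close>

lemma adjacent_between:
  assumes "(x, z) \<in> adjacent CM" "q \<in> M" "between x q z"
  shows "q = x \<or> q = z"
proof -
  obtain T where T: "x \<in> M" "z \<in> M" "walls_at z = flip T (walls_at x)"
    using assms(1) alg.adjacent_cubes_iff by blast
  have "S \<in> walls_at q \<longleftrightarrow> S \<in> walls_at x" if "S \<noteq> T" for S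
  proof (cases "S \<in> walls")
    case True
    have "S \<in> walls_at z \<longleftrightarrow> S \<in> walls_at x" using T(3) that by (simp add: mem_flip)
    then have "x \<in> S \<longleftrightarrow> z \<in> S" using True unfolding walls_at_def by blast
    then show ?thesis using walls_between[OF True T(1) assms(2) T(2) assms(3)] True
      unfolding walls_at_def by blast
  qed (simp add: walls_at_def)
  then have "walls_at q = (if T \<in> walls_at q \<longleftrightarrow> T \<in> walls_at x then walls_at x else flip T (walls_at x))"
    by (intro set_eqI) (metis mem_flip)
  then have "walls_at q = walls_at x \<or> walls_at q = walls_at z" unfolding T(3) by metis
  then show ?thesis using inj_walls_at assms(2) T(1,2) unfolding inj_on_def by blast
qed

text \<open>Projecting a coarse path in \<open>M\<close> to the interval between adjacent points of \<open>M\<close> shows that these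
  points are at bounded distance.\<close>

lemma adjacent_dist_le:
  assumes chain: "\<And>x y. x \<in> M \<Longrightarrow> y \<in> M \<Longrightarrow> \<exists>n s. s 0 = x \<and> s n = y \<and> (\<forall>i\<le>n. s i \<in> M) \<and>
      (\<forall>i<n. dist (s i) (s (Suc i)) \<le> R)"
    and xz: "(x, z) \<in> adjacent CM"
  shows "dist x z \<le> R"
proof -
  have M: "x \<in> M" "z \<in> M" and ne: "x \<noteq> z" using sub.edge_in[OF xz] sub.edge_neq[OF xz] by auto
  then have V: "x \<in> V" "z \<in> V" using M_sub by auto
  obtain n :: nat and s where s: "s 0 = x" "s n = z" "\<And>i. i \<le> n \<Longrightarrow> s i \<in> M"
    "\<And>i. i < n \<Longrightarrow> dist (s i) (s (Suc i)) \<le> R"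
    using chain[OF M] by blast
  define t where "t i = med x z (s i)" for i
  have t: "t i = x \<or> t i = z" if "i \<le> n" for i
  proof -
    have "s i \<in> M" "s i \<in> V" using s(3)[OF that] M_sub by auto
    then show ?thesis unfolding t_def
      using adjacent_between[OF xz] between_med[OF V] med_closed[OF M] by blast
  qed
  have "t 0 = x" "t n = z" unfolding t_def s(1,2) using med_refl V by auto
  then have "t n \<noteq> x" "\<not> t 0 \<noteq> x" using ne by auto
  then obtain i where i: "i < n" "t i = x" "t (Suc i) \<noteq> x"
    using ex_least_nat_less[of "\<lambda>i. t i \<noteq> x" n] by blast
  then have ti: "t (Suc i) = z" using t[of "Suc i"] by simp
  have "s i \<in> V" "s (Suc i) \<in> V" using s(3)[of i] s(3)[of "Suc i"] i(1) M_sub by auto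
  \<comment> \<open>The projection does not increase distances, and between these two indices it
    jumps from \<open>x\<close> to \<open>z\<close>.\<close>
  then have "dist (t i) (t (Suc i)) \<le> dist (s i) (s (Suc i))"
    unfolding t_def using med_lipschitz[of x z "s i" x z "s (Suc i)"] V by simp
  then show ?thesis using s(4)[OF i(1)] i(2) ti by simp
qed

lemma dist_le_sub:
  assumes adj: "\<And>x z. (x, z) \<in> adjacent CM \<Longrightarrow> dist x z \<le> R"
    and "x \<in> M" "y \<in> M"
  shows "dist x y \<le> R * sub.dist x y"
proof -
  have "(x, y) \<in> adjacent CM ^^ n \<Longrightarrow> y \<in> M \<Longrightarrow> dist x y \<le> R * n" for n
  proof (induction n arbitrary: y)
    case 0
    then show ?case by simp
  next
    case (Suc n)
    then obtain z where z: "(x, z) \<in> adjacent CM ^^ n" "(z, y) \<in> adjacent CM" by auto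
    have "z \<in> M" using sub.edge_in z(2) by blast
    then have "dist x y \<le> dist x z + dist z y" using dist_triangle assms(2) Suc.prems(2) M_sub by blast
    also have "\<dots> \<le> R * n + R" using Suc.IH[OF z(1) \<open>z \<in> M\<close>] adj[OF z(2)] by simp
    finally show ?case by simp
  qed
  then show ?thesis using sub.dist_relpow[OF assms(2,3)] assms(3) by blast
qed

text \<open>Let \<open>x\<close> and \<open>z\<close> be the bottom and top corners of the cube and
  \<open>y i\<close> the neighbours of \<open>x\<close> in it. An ambient geodesic from
  \<open>x\<close> to \<open>y i\<close> starts with an edge to some \<open>u i\<close>, which also
  leads towards \<open>z\<close> because \<open>y i\<close> is between \<open>x\<close> and
  \<open>z\<close>. The \<open>u i\<close> are distinct: otherwise some halfspace would contain
  \<open>x\<close> but neither \<open>y i\<close> nor \<open>y j\<close>, although \<open>x\<close>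
  is the median of \<open>x\<close>, \<open>y i\<close> and \<open>y j\<close>.\<close>

lemma cube_dimension:
  assumes N: "\<And>x z T. x \<in> V \<Longrightarrow> z \<in> V \<Longrightarrow> T \<subseteq> {u. (x, u) \<in> E \<and> between x u z} \<Longrightarrow>
      finite T \<and> card T \<le> N"
    and Q: "Q \<in> CM" "is_cube CM n Q"
  shows "n \<le> N"
proof -
  obtain A B where AB: "Q \<subseteq> M" "A \<subseteq> B" "finite (B - A)" "walls_at ` Q = {S. A \<subseteq> S \<and> S \<subseteq> B}"
    by (rule alg.cubesE[OF Q(1)])
  have "(2::nat) ^ n = 2 ^ card (B - A)"
    using cube_card(1)[OF Q(2)] cube_card(1)[OF alg.chart[OF AB]] by simp
  then have n: "n = card (B - A)" by simp
  have pt: "\<exists>y\<in>M. walls_at y = S" if "A \<subseteq> S" "S \<subseteq> B" for S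
  proof -
    have "S \<in> walls_at ` Q" unfolding AB(4) using that by simp
    then show ?thesis using AB(1) by blast
  qed
  obtain x where x: "x \<in> M" "walls_at x = A" using pt[of A] AB(2) by blast
  obtain z where z: "z \<in> M" "walls_at z = B" using pt[of B] AB(2) by blast
  have "\<forall>i\<in>B - A. \<exists>y. y \<in> M \<and> walls_at y = insert i A" using pt AB(2) by blast
  then obtain y where y: "\<And>i. i \<in> B - A \<Longrightarrow> y i \<in> M" "\<And>i. i \<in> B - A \<Longrightarrow> walls_at (y i) = insert i A"
    by metis
  have V: "x \<in> V" "z \<in> V" and yV: "\<And>i. i \<in> B - A \<Longrightarrow> y i \<in> V" using x z y(1) M_sub by auto
  have "\<forall>i\<in>B - A. \<exists>u. (x, u) \<in> E \<and> between x u (y i)"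
  proof
    fix i assume i: "i \<in> B - A"
    then have "x \<noteq> y i" using x(2) y(2)[OF i] by auto
    then obtain u where "(x, u) \<in> E" "dist x (y i) = Suc (dist u (y i))"
      using step_towards[OF V(1) yV[OF i]] by blast
    then show "\<exists>u. (x, u) \<in> E \<and> between x u (y i)" using between_edge by blast
  qed
  then obtain u where u: "\<And>i. i \<in> B - A \<Longrightarrow> (x, u i) \<in> E" "\<And>i. i \<in> B - A \<Longrightarrow> between x (u i) (y i)"
    by metis
  have eq_med: "w = med a b c" if "w \<in> M" "a \<in> M" "b \<in> M" "c \<in> M"
    "walls_at w = walls_at a \<inter> walls_at b \<union> walls_at b \<inter> walls_at c \<union> walls_at a \<inter> walls_at c"
    for w a b c
  proof -
    have "walls_at w = walls_at (med a b c)" using walls_at_med that by simp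
    then show ?thesis using inj_walls_at med_closed that(1-4) unfolding inj_on_def by blast
  qed
  have bet: "between x (u i) z" if i: "i \<in> B - A" for i
  proof -
    have "y i = med x z (y i)"
      using i AB(2) by (intro eq_med) (auto simp: x z y)
    then have "between x (y i) z" using between_med[OF V yV[OF i]] by simp
    then show ?thesis
      using between_trans(1)[OF _ u(2)[OF i] V yV[OF i] edge_in(2)[OF u(1)[OF i]]] by blast
  qed
  have inj_u: "inj_on u (B - A)"
  proof (rule inj_onI, rule ccontr)
    fix i j assume ij: "i \<in> B - A" "j \<in> B - A" "u i = u j" "i \<noteq> j"
    let ?H = "halfspace x (u i)"
    have "x = med x (y i) (y j)"
      using ij by (intro eq_med) (auto simp: x z y)
    moreover have "y i \<notin> ?H" "y j \<notin> ?H"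
      using u[OF ij(1)] u[OF ij(2)] ij(3) dist_edge[OF u(1)[OF ij(1)]]
      unfolding halfspace_def by (simp_all add: dist_commute[of "y i"] dist_commute[of "y j"])
    moreover have "x \<in> ?H" using halfspace_ends(1) u(1)[OF ij(1)] by blast
    ultimately show False
      using med_in_halfspace[OF halfspaceI[OF u(1)[OF ij(1)]] V(1) yV[OF ij(1)] yV[OF ij(2)]] by simp
  qed
  have "card (u ` (B - A)) \<le> N" using N[OF V, of "u ` (B - A)"] u(1) bet by blast
  then show ?thesis using card_image[OF inj_u] n by simp
qed

end

section \<open>Coarse median spaces\<close>

text \<open>Serves the case of an empty \<open>X\<close>, in which there is no point to take as the
  base of the walls.\<close>

lemma CAT0_empty: "CAT0_cube_complex {}" "finite_dimensional {}"
  by (simp_all add: CAT0_cube_complex_def cube_complex_def simply_connected_complex_def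
      connected_graph_def edge_path_def finite_dimensional_def)

lemma quasiisometric_empty: "quasiisometric {} dX {} dY"
  unfolding quasiisometric_def quasiisometry_def quasiisometric_embedding_def
  by (auto intro: exI[of _ 0] exI[of _ 1])

theorem proposition2p12:
  fixes X :: "'x set" and d :: "'x \<Rightarrow> 'x \<Rightarrow> real" and m :: "'x \<Rightarrow> 'x \<Rightarrow> 'x \<Rightarrow> 'x"
    and C :: "'c set set" and \<Phi> :: "'x \<Rightarrow> 'c"
  assumes "coarse_median_space X d m"
    and "coarsely_connected X d"
    and "CAT0_cube_complex C" and "finite_dimensional C"
    and "quasiisometric_embedding X d (vertices C) (skeleton_dist C) \<Phi>"
    and "quasimedian X m (skeleton_dist C) (skeleton_median C) \<Phi>"
  shows "\<exists>C' :: 'c set set. CAT0_cube_complex C' \<and> finite_dimensional C' \<and>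
           quasiisometric X d (vertices C') (skeleton_dist C')"
proof (cases "X = {}")
  case True
  then show ?thesis using CAT0_empty quasiisometric_empty[of d "skeleton_dist {}"] by (intro exI[of _ "{}"]) simp
next
  case False
  interpret cat0_complex C by standard (rule assms(3))
  obtain N where N: "\<And>Q n. Q \<in> C \<Longrightarrow> is_cube C n Q \<Longrightarrow> n \<le> N"
    using assms(4) unfolding finite_dimensional_def by metis
  have bound: "finite T \<and> card T \<le> N"
    if "x \<in> vertices C" "z \<in> vertices C" "T \<subseteq> {u. (x, u) \<in> adjacent C \<and> between x u z}" for x z T
    by (rule interval_neighbours_card[OF _ that]) (rule N)
  obtain x0 where x0: "x0 \<in> X" using False by blast
  note coarse = assms(1)[unfolded coarse_median_space_def]
  have metric: "Metric_space X d" using coarse by (rule conjunct1)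
  have m_in: "m x y z \<in> X" if "x \<in> X" "y \<in> X" "z \<in> X" for x y z
    using conjunct1[OF conjunct2[OF coarse]] that by simp
  have d_nonneg: "0 \<le> d x y" for x y using Metric_space.nonneg[OF metric] .
  have \<Phi>V: "\<And>x. x \<in> X \<Longrightarrow> \<Phi> x \<in> vertices C"
    using assms(5) unfolding quasiisometric_embedding_def by blast
  obtain k c where kc: "k \<ge> 1" "c \<ge> 0"
    and qi: "\<forall>x\<in>X. \<forall>y\<in>X. d x y / k - c \<le> skeleton_dist C (\<Phi> x) (\<Phi> y) \<and>
      skeleton_dist C (\<Phi> x) (\<Phi> y) \<le> k * d x y + c"
    using assms(5) unfolding quasiisometric_embedding_def by (elim conjE exE) (rule that)
  have lower: "d x y / k - c \<le> real (dist (\<Phi> x) (\<Phi> y))"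
    and upper: "real (dist (\<Phi> x) (\<Phi> y)) \<le> k * d x y + c" if "x \<in> X" "y \<in> X" for x y
    using qi that unfolding skeleton_dist_def by simp_all
  obtain D where qm: "\<forall>x\<in>X. \<forall>y\<in>X. \<forall>z\<in>X.
      skeleton_dist C (\<Phi> (m x y z)) (skeleton_median C (\<Phi> x) (\<Phi> y) (\<Phi> z)) \<le> D"
    using assms(6) unfolding quasimedian_def by (elim exE) (rule that)
  have D: "real (dist (\<Phi> (m x y z)) (med (\<Phi> x) (\<Phi> y) (\<Phi> z))) \<le> D"
    if "x \<in> X" "y \<in> X" "z \<in> X" for x y z
    using qm that unfolding skeleton_dist_def skeleton_median_def by simp
  let ?A = "\<Phi> ` X"
  let ?M = "median_hull ?A"
  have A: "?A \<subseteq> vertices C" "?A \<noteq> {}" using image_subsetI[of X \<Phi>, OF \<Phi>V] False by simp_all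
  have med_near: "\<exists>e\<in>?A. dist (med a b c') e \<le> nat \<lceil>D\<rceil>" if abc: "a \<in> ?A" "b \<in> ?A" "c' \<in> ?A" for a b c'
  proof -
    obtain x y z where x: "x \<in> X" "a = \<Phi> x" and y: "y \<in> X" "b = \<Phi> y" and z: "z \<in> X" "c' = \<Phi> z"
      using abc by blast
    have "dist (med a b c') (\<Phi> (m x y z)) \<le> nat \<lceil>D\<rceil>"
      using D[OF x(1) y(1) z(1)] dist_commute[of "med a b c'" "\<Phi> (m x y z)"] unfolding x(2) y(2) z(2) by linarith
    then show ?thesis using m_in[OF x(1) y(1) z(1)] by blast
  qed
  have "\<exists>r. \<forall>x\<in>meds ?A (Suc (2 * N)). \<exists>a\<in>?A. dist x a \<le> r"
    by (rule meds_near[OF A(1)]) (rule med_near)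
  then obtain r where r: "\<And>x. x \<in> meds ?A (Suc (2 * N)) \<Longrightarrow> \<exists>a\<in>?A. dist x a \<le> r" by blast
  have hull: "?M \<subseteq> meds ?A (Suc (2 * N))" by (rule hull_sub_meds[OF _ A]) (rule bound)
  have near: "\<exists>u\<in>X. dist x (\<Phi> u) \<le> r" if "x \<in> ?M" for x
    using r[OF subsetD[OF hull that]] by blast
  have AM: "?A \<subseteq> ?M" by (rule sub_hull[OF A(1)])
  interpret S: median_subalgebra "vertices C" "adjacent C" ?M "\<Phi> x0"
  proof
    show "?M \<subseteq> vertices C" by (rule hull_sub_V)
    show "\<Phi> x0 \<in> ?M" using AM x0 by blast
    show "\<And>x y z. x \<in> ?M \<Longrightarrow> y \<in> ?M \<Longrightarrow> z \<in> ?M \<Longrightarrow> med x y z \<in> ?M" by (rule med_in_hull)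
  qed
  obtain L where L: "L > 0" "\<And>x y. x \<in> X \<Longrightarrow> y \<in> X \<Longrightarrow> \<exists>n s. s 0 = x \<and> s n = y \<and>
      (\<forall>i\<le>n. s i \<in> X) \<and> (\<forall>i<n. d (s i) (s (Suc i)) \<le> L)"
    using assms(2) unfolding coarsely_connected_def by metis
  \<comment> \<open>\<open>r\<close> bounds the first and last jumps of the chain, from the hull to
    the image of \<open>X\<close> and back, and \<open>k * L + c\<close> bounds the images of the
    steps in \<open>X\<close>. The successor makes \<open>R\<close> positive, so that it can be
    divided by.\<close>
  define R where "R = Suc (max r (nat \<lceil>k * L + c\<rceil>))"
  have chain: "\<exists>n s. s 0 = x \<and> s n = y \<and> (\<forall>i\<le>n. s i \<in> ?M) \<and> (\<forall>i<n. dist (s i) (s (Suc i)) \<le> R)"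
    if xy: "x \<in> ?M" "y \<in> ?M" for x y
  proof -
    obtain u where u: "u \<in> X" "dist x (\<Phi> u) \<le> r" using near xy(1) by blast
    obtain v where v: "v \<in> X" "dist y (\<Phi> v) \<le> r" using near xy(2) by blast
    obtain n s where s: "s 0 = u" "s n = v" "\<And>i. i \<le> n \<Longrightarrow> s i \<in> X"
      "\<And>i. i < n \<Longrightarrow> d (s i) (s (Suc i)) \<le> L" using L(2)[OF u(1) v(1)] by blast
    \<comment> \<open>The chain is \<open>x\<close>, then the images of \<open>s 0\<close> up to
      \<open>s n\<close>, then \<open>y\<close>; this shifts the indices by one.\<close>
    define t where "t i = (if i = 0 then x else if i \<le> Suc n then \<Phi> (s (i - 1)) else y)" for i
    have "t i \<in> ?M" if "i \<le> Suc (Suc n)" for i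
    proof -
      have "\<Phi> (s (i - 1)) \<in> ?M" if "i \<le> Suc n" using s(3)[of "i - 1"] that AM by auto
      then show ?thesis using xy unfolding t_def by simp
    qed
    moreover have "dist (t i) (t (Suc i)) \<le> R" if i: "i < Suc (Suc n)" for i
    proof -
      consider "i = 0" | j where "i = Suc j" "j < n" | "i = Suc n"
        using i by (cases i) (auto simp: less_Suc_eq)
      then show ?thesis
      proof cases
        case 1 then show ?thesis using u(2) s(1) unfolding t_def R_def by simp
      next
        case 2
        have "real (dist (\<Phi> (s j)) (\<Phi> (s (Suc j)))) \<le> k * d (s j) (s (Suc j)) + c"
          using upper s(3) 2(2) by simp
        also have "\<dots> \<le> k * L + c" using s(4)[OF 2(2)] kc(1) by (simp add: mult_left_mono)
        finally have "dist (\<Phi> (s j)) (\<Phi> (s (Suc j))) \<le> nat \<lceil>k * L + c\<rceil>" by linarith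
        then show ?thesis using 2 unfolding t_def R_def by simp
      next
        case 3 then show ?thesis using v(2) s(2) dist_commute[of y] unfolding t_def R_def by simp
      qed
    qed
    moreover have "t 0 = x" "t (Suc (Suc n)) = y" unfolding t_def by simp_all
    ultimately show ?thesis by blast
  qed
  have adj: "dist x z \<le> R" if "(x, z) \<in> adjacent S.CM" for x z
    by (rule S.adjacent_dist_le[OF _ that]) (rule chain)
  have dist_sub: "dist x y \<le> R * S.sub.dist x y" if "x \<in> ?M" "y \<in> ?M" for x y
    by (rule S.dist_le_sub[OF _ that]) (rule adj)
  have \<Phi>M: "\<And>x. x \<in> X \<Longrightarrow> \<Phi> x \<in> ?M" using AM by blast
  have R: "real R \<ge> 1" unfolding R_def by simp
  have "quasiisometry X d ?M (skeleton_dist S.CM) \<Phi>"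
    unfolding quasiisometry_def quasiisometric_embedding_def skeleton_dist_def
  proof (intro conjI exI ballI)
    show "\<Phi> \<in> X \<rightarrow> ?M" using \<Phi>M by blast
    \<comment> \<open>On \<open>M\<close> the new distance is at most the old one and at least the
      old one divided by \<open>R\<close>. This gives the multiplicative constant
      \<open>k * real R\<close>, and the additive constant \<open>c\<close> can be kept.\<close>
    show "1 \<le> k * real R" using mult_mono[OF kc(1) R] kc(1) by simp
    show "0 \<le> c" by (rule kc(2))
    fix x y assume xy: "x \<in> X" "y \<in> X"
    have "d x y / k - c \<le> real R * real (S.sub.dist (\<Phi> x) (\<Phi> y))"
      using lower[OF xy] dist_sub[OF \<Phi>M[OF xy(1)] \<Phi>M[OF xy(2)]] by (simp flip: of_nat_mult)
    then have "(d x y / k - c) / real R \<le> real (S.sub.dist (\<Phi> x) (\<Phi> y))"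
      using R by (simp add: divide_le_eq mult.commute)
    moreover have "c / real R \<le> c" using R kc(2) by (simp add: divide_le_eq mult_le_cancel_left1)
    ultimately show "d x y / (k * real R) - c \<le> real (S.sub.dist (\<Phi> x) (\<Phi> y))"
      by (simp add: diff_divide_distrib)
    have "real (S.sub.dist (\<Phi> x) (\<Phi> y)) \<le> k * d x y + c"
      using S.sub_dist_le[OF \<Phi>M[OF xy(1)] \<Phi>M[OF xy(2)]] upper[OF xy] by linarith
    also have "k * d x y \<le> k * real R * d x y"
      using mult_right_mono[OF mult_left_mono[OF R, of k] d_nonneg[of x y]] kc(1) by simp
    finally show "real (S.sub.dist (\<Phi> x) (\<Phi> y)) \<le> k * real R * d x y + c" by simp
  next
    show "\<exists>x\<in>X. real (S.sub.dist (\<Phi> x) y) \<le> real r" if y: "y \<in> ?M" for y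
    proof -
      obtain u where u: "u \<in> X" "dist y (\<Phi> u) \<le> r" using near y by blast
      have "S.sub.dist (\<Phi> u) y \<le> r"
        using S.sub_dist_le[OF \<Phi>M[OF u(1)] y] u(2) dist_commute[of y] by simp
      then show ?thesis using u(1) by auto
    qed
  qed
  then have "quasiisometric X d (vertices S.CM) (skeleton_dist S.CM)"
    unfolding quasiisometric_def S.alg.vertices_cubes by blast
  moreover have "n \<le> N" if "Q \<in> S.CM" "is_cube S.CM n Q" for Q n
    by (rule S.cube_dimension[OF _ that]) (rule bound)
  then have "finite_dimensional S.CM" unfolding finite_dimensional_def by blast
  ultimately show ?thesis using S.alg.CAT0_cubes by blast
qed

end
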